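(* Let $(X_0,X_1)$ be a Banach couple with continuous embedding $X_1\hookrightarrow X_0$. Let $1<p<\infty$, $0\le\lambda<1$, $0<T<\infty$ and $$\theta:=1-\frac{1-\lambda}{p}\in(0,1).$$ There is a constant $C$, independent of $u$, such that the following holds. Let $u\in\mathbb E^{p,\lambda}(0,T;X_0,X_1)$, that is, $u\in\mathcal M^{p,\lambda}(0,T;X_1)$ with $X_0$-valued distributional derivative $\partial_t u\in\mathcal M^{p,\lambda}(0,T;X_0)$. Then $u$ admits an $X_0$-valued absolutely continuous representative on $[0,T]$, still denoted by $u$, such that: (i) for every $0\le s<t\le T$, $$u(t)-u(s)=\int_s^t\partial_t u(\tau)\,d\tau\quad\text{in }X_0,$$ and $$\|u(t)-u(s)\|_{X_0}\le |t-s|^\theta\,\|\partial_t u\|_{\mathcal M^{p,\lambda}(0,T;X_0)};$$ (ii) for every $t\in[0,T]$, $u(t)\in(X_0,X_1)_{\theta,\infty}$, and $$\sup_{t\in[0,T]}\|u(t)\|_{(X_0,X_1)_{\theta,\infty}}\le C\Bigl(\|u\|_{\mathcal M^{p,\lambda}(0,T;X_1)}+\|\partial_t u\|_{\mathcal M^{p,\lambda}(0,T;X_0)}\Bigr);$$ (iii) in particular, $u\in C^{0,\theta}([0,T];X_0)\cap L^\infty\bigl(0,T;(X_0,X_1)_{\theta,\infty}\bigr)$, and the endpoint traces $u(0)$ and $u(T)$ are well-defined elements of $(X_0,X_1)_{\theta,\infty}$.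
   Context: For a Banach space $X$, $1<p<\infty$, $0\le\lambda<1$ and $T>0$, the time-Morrey space $\mathcal M^{p,\lambda}(0,T;X)$ consists of the (strongly measurable) functions $f:(0,T)\to X$ with finite norm $$\|f\|_{\mathcal M^{p,\lambda}(0,T;X)}:=\sup_{I\subset(0,T)}|I|^{-\lambda/p}\Bigl(\int_I\|f(t)\|_X^p\,dt\Bigr)^{1/p},$$ the supremum being over all intervals $I\subset(0,T)$. The Morrey evolution class is $\mathbb E^{p,\lambda}(0,T;X_0,X_1):=\{u: u\in\mathcal M^{p,\lambda}(0,T;X_1),\ \partial_t u\in\mathcal M^{p,\lambda}(0,T;X_0)\}$, with $\partial_t u$ understood in the sense of $X_0$-valued distributions. A Banach couple is a pair of Banach spaces continuously embedded in a common Hausdorff topological vector space. For $x\in X_0+X_1$ and $r>0$, $$K(r,x;X_0,X_1):=\inf\{\|x_0\|_{X_0}+r\|x_1\|_{X_1}: x=x_0+x_1,\ x_0\in X_0,\ x_1\in X_1\}.$$ For $0<\theta<1$, $(X_0,X_1)_{\theta,\infty}$ is the set of $x\in X_0+X_1$ with $\|x\|_{(X_0,X_1)_{\theta,\infty}}:=\sup_{r>0}r^{-\theta}K(r,x;X_0,X_1)<\infty$. For $0<\beta\le1$, $C^{0,\beta}([0,T];X)$ is the space of $u\in C([0,T];X)$ with $\sup_{0\le s<t\le T}\|u(t)-u(s)\|_X/|t-s|^\beta<\infty$. *)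

theory Defs
  imports "HOL-Analysis.Analysis"
begin

section \<open>Strong measurability and the Bochner integral\<close>

text \<open>The Bochner integral of HOL-Analysis requires a second-countable, hence separable, target
  space. The definitions below are for arbitrary normed spaces.\<close>

text \<open>Strong measurability with values in a normed space whose carrier is a set \<open>E\<close> inside an
  ambient vector space and whose norm is the function \<open>N\<close>.\<close>

definition strongly_measurable_in ::
    "'s measure \<Rightarrow> 'v::real_vector set \<Rightarrow> ('v \<Rightarrow> real) \<Rightarrow> ('s \<Rightarrow> 'v) \<Rightarrow> bool" where
  "strongly_measurable_in M E N f \<longleftrightarrow>
    (\<exists>s :: nat \<Rightarrow> 's \<Rightarrow> 'v.
      (\<forall>i. simple_function M (s i) \<and> s i ` space M \<subseteq> E) \<and>
      (AE x in M. f x \<in> E \<and> (\<lambda>i. N (f x - s i x)) \<longlonglongrightarrow> 0))"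

abbreviation strongly_measurable :: "'s measure \<Rightarrow> ('s \<Rightarrow> 'a::real_normed_vector) \<Rightarrow> bool" where
  "strongly_measurable M f \<equiv> strongly_measurable_in M UNIV norm f"

text \<open>The definition is that of \<open>has_bochner_integral\<close>, with strong measurability in place of
  Borel measurability.\<close>

definition has_strong_integral ::
    "'s measure \<Rightarrow> ('s \<Rightarrow> 'a::real_normed_vector) \<Rightarrow> 'a \<Rightarrow> bool" where
  "has_strong_integral M f x \<longleftrightarrow>
    strongly_measurable M f \<and>
    (\<exists>s. (\<forall>i. Bochner_Integration.simple_bochner_integrable M (s i)) \<and>
         (\<lambda>i. \<integral>\<^sup>+t. ennreal (norm (f t - s i t)) \<partial>M) \<longlonglongrightarrow> 0 \<and>
         (\<lambda>i. Bochner_Integration.simple_bochner_integral M (s i)) \<longlonglongrightarrow> x)"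


section \<open>Distributional derivatives on \<open>(0,T)\<close>\<close>

definition test_functions :: "real \<Rightarrow> (real \<Rightarrow> real) set" where
  "test_functions T = {\<phi>.
    (\<forall>k x. (deriv ^^ k) \<phi> differentiable (at x)) \<and>
    compact (closure {x. \<phi> x \<noteq> 0}) \<and> closure {x. \<phi> x \<noteq> 0} \<subseteq> {0<..<T}}"

definition locally_integrable :: "real \<Rightarrow> (real \<Rightarrow> 'a::real_normed_vector) \<Rightarrow> bool" where
  "locally_integrable T f \<longleftrightarrow>
    (\<forall>a b. 0 < a \<and> a < b \<and> b < T \<longrightarrow> (\<exists>x. has_strong_integral (lebesgue_on {a..b}) f x))"

definition has_distributional_derivative ::
    "real \<Rightarrow> (real \<Rightarrow> 'a::real_normed_vector) \<Rightarrow> (real \<Rightarrow> 'a) \<Rightarrow> bool" where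
  "has_distributional_derivative T f g \<longleftrightarrow>
    locally_integrable T f \<and> locally_integrable T g \<and>
    (\<forall>\<phi>\<in>test_functions T. \<exists>x.
      has_strong_integral (lebesgue_on {0<..<T}) (\<lambda>t. deriv \<phi> t *\<^sub>R f t) (- x) \<and>
      has_strong_integral (lebesgue_on {0<..<T}) (\<lambda>t. \<phi> t *\<^sub>R g t) x)"


section \<open>Time-Morrey spaces\<close>

text \<open>Degenerate intervals are left out, since the factor \<open>|I| powr (- lam / p)\<close> has no meaning for them.\<close>

definition subintervals :: "real \<Rightarrow> real set set" where
  "subintervals T = {I. is_interval I \<and> I \<subseteq> {0<..<T} \<and> 0 < measure lebesgue I}"

definition morrey_quantity ::
    "real \<Rightarrow> real \<Rightarrow> (real \<Rightarrow> 'a::real_normed_vector) \<Rightarrow> real set \<Rightarrow> real" where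
  "morrey_quantity p lam f I =
    measure lebesgue I powr (- lam / p) *
      (\<integral>t. norm (f t) powr p \<partial>lebesgue_on I) powr (1 / p)"

definition morrey_norm ::
    "real \<Rightarrow> real \<Rightarrow> real \<Rightarrow> (real \<Rightarrow> 'a::real_normed_vector) \<Rightarrow> real" where
  "morrey_norm T p lam f = (SUP I\<in>subintervals T. morrey_quantity p lam f I)"

text \<open>Integrability on \<open>(0,T)\<close> and boundedness of the supremum together say that the norm is
  finite; without them the real-valued integral and supremum have no meaning.\<close>

definition morrey_space ::
    "real \<Rightarrow> real \<Rightarrow> real \<Rightarrow> (real \<Rightarrow> 'a::real_normed_vector) set" where
  "morrey_space T p lam = {f.
    strongly_measurable (lebesgue_on {0<..<T}) f \<and>
    integrable (lebesgue_on {0<..<T}) (\<lambda>t. norm (f t) powr p) \<and>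
    bdd_above (morrey_quantity p lam f ` subintervals T)}"

text \<open>\<open>j\<close> is the embedding of \<open>X\<^sub>1\<close> into \<open>X\<^sub>0\<close>.\<close>

definition morrey_evolution ::
    "real \<Rightarrow> real \<Rightarrow> real \<Rightarrow> ('b::real_normed_vector \<Rightarrow> 'a::real_normed_vector) \<Rightarrow>
      (real \<Rightarrow> 'b) set" where
  "morrey_evolution T p lam j = {u. u \<in> morrey_space T p lam \<and>
    (\<exists>g\<in>morrey_space T p lam. has_distributional_derivative T (j \<circ> u) g)}"


section \<open>Banach couples and real interpolation\<close>

text \<open>The spaces \<open>X\<^sub>0\<close>, \<open>X\<^sub>1\<close> are types \<open>'a\<close>, \<open>'b\<close>, embedded by \<open>i0\<close>, \<open>i1\<close> in a common type
  \<open>'v\<close>. HOL has no class of topological vector spaces, so the continuity of the vector space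
  operations of \<open>'v\<close> is part of the definition.\<close>

definition banach_couple ::
    "('a::banach \<Rightarrow> 'v::{real_vector,t2_space}) \<Rightarrow> ('b::banach \<Rightarrow> 'v) \<Rightarrow> bool" where
  "banach_couple i0 i1 \<longleftrightarrow>
    continuous_on UNIV (\<lambda>(x :: 'v, y). x + y) \<and>
    continuous_on UNIV (\<lambda>(c :: real, x :: 'v). c *\<^sub>R x) \<and>
    linear i0 \<and> inj i0 \<and> continuous_on UNIV i0 \<and>
    linear i1 \<and> inj i1 \<and> continuous_on UNIV i1"

definition K_functional ::
    "('a::banach \<Rightarrow> 'v::real_vector) \<Rightarrow> ('b::banach \<Rightarrow> 'v) \<Rightarrow> real \<Rightarrow> 'v \<Rightarrow> real" where
  "K_functional i0 i1 r x = Inf {norm x0 + r * norm x1 |x0 x1. x = i0 x0 + i1 x1}"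

definition interp_norm ::
    "('a::banach \<Rightarrow> 'v::real_vector) \<Rightarrow> ('b::banach \<Rightarrow> 'v) \<Rightarrow> real \<Rightarrow> 'v \<Rightarrow> real" where
  "interp_norm i0 i1 \<theta> x = (SUP r\<in>{0<..}. r powr (- \<theta>) * K_functional i0 i1 r x)"

definition interp_space ::
    "('a::banach \<Rightarrow> 'v::real_vector) \<Rightarrow> ('b::banach \<Rightarrow> 'v) \<Rightarrow> real \<Rightarrow> 'v set" where
  "interp_space i0 i1 \<theta> = {x. (\<exists>x0 x1. x = i0 x0 + i1 x1) \<and>
    bdd_above ((\<lambda>r. r powr (- \<theta>) * K_functional i0 i1 r x) ` {0<..})}"

definition Linfty_interp ::
    "real \<Rightarrow> ('a::banach \<Rightarrow> 'v::real_vector) \<Rightarrow> ('b::banach \<Rightarrow> 'v) \<Rightarrow> real \<Rightarrow>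
      (real \<Rightarrow> 'v) set" where
  "Linfty_interp T i0 i1 \<theta> = {f.
    strongly_measurable_in (lebesgue_on {0<..<T})
      (interp_space i0 i1 \<theta>) (interp_norm i0 i1 \<theta>) f \<and>
    (\<exists>B. AE t in lebesgue_on {0<..<T}. interp_norm i0 i1 \<theta> (f t) \<le> B)}"


section \<open>Absolutely continuous and Hoelder continuous functions\<close>

definition absolutely_continuous_on ::
    "real \<Rightarrow> real \<Rightarrow> (real \<Rightarrow> 'a::real_normed_vector) \<Rightarrow> bool" where
  "absolutely_continuous_on a b f \<longleftrightarrow>
    (\<forall>\<epsilon>>0. \<exists>\<delta>>0. \<forall>(n::nat) s t.
      (\<forall>i<n. a \<le> s i \<and> s i \<le> t i \<and> t i \<le> b) \<and>
      (\<forall>i<n. \<forall>k<n. i \<noteq> k \<longrightarrow> {s i<..<t i} \<inter> {s k<..<t k} = {}) \<and>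
      (\<Sum>i<n. t i - s i) < \<delta> \<longrightarrow>
      (\<Sum>i<n. norm (f (t i) - f (s i))) < \<epsilon>)"

definition holder_space :: "real \<Rightarrow> real \<Rightarrow> (real \<Rightarrow> 'a::real_normed_vector) set" where
  "holder_space T \<beta> = {f. continuous_on {0..T} f \<and>
    bdd_above {norm (f t - f s) / \<bar>t - s\<bar> powr \<beta> |s t. 0 \<le> s \<and> s < t \<and> t \<le> T}}"

end

theory Submission
  imports Defs
begin

text \<open>Let \<open>M\<close> be Lebesgue measure on \<open>(0,T)\<close> and \<open>G t = \<integral>\<^bsub>(0,t)\<^esub> g\<close>. Integration by parts reduces the
  existence of the absolutely continuous representative to the du Bois-Reymond lemma for \<open>w = j u - G\<close>:
  testing \<open>w\<close> with primitives of explicit bumps built from \<open>exp (- c / x)\<close> and letting the bumps tend to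
  indicator functions of intervals shows that all integrals of \<open>w - c\<close> vanish for a suitable constant
  \<open>c\<close>, hence \<open>w = c\<close> almost everywhere. The increments of \<open>v = c + G\<close> are bounded by Hoelder's
  inequality and the Morrey norm of \<open>g\<close>. For the interpolation bound, every interval of length \<open>h\<close>
  contains a point \<open>r\<close> with \<open>v r = j (u r)\<close> at which \<open>norm (u r)\<close> is at most the \<open>p\<close>-mean of
  \<open>norm u\<close> over the interval, hence at most \<open>h powr (\<theta> - 1)\<close> times its Morrey norm. The decomposition
  \<open>v t = (v t - v r) + j (u r)\<close> then estimates the \<open>K\<close>-functional at small parameters \<open>h\<close>.\<close>

section \<open>The strong integral over a complete measure\<close>

text \<open>The target spaces need not be separable, and no duality is used: the du Bois-Reymond
  argument runs directly on vector-valued integrals, and a function whose integral over every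
  measurable set is zero is shown to vanish through its simple approximants rather than by testing
  with functionals. Strong measurability only asks for simple functions that converge almost
  everywhere, so the measurability of \<open>norm (f x)\<close> rests on the completeness of the
  measure; hence the locale \<open>complete_measure\<close>. The exponent is
  \<open>\<theta> = (1 - 1 / p) + lam / p\<close>: Hoelder's inequality contributes the first
  summand, the Morrey norm the second. The bound for \<open>norm (u r)\<close> is of order
  \<open>h powr (\<theta> - 1)\<close>, and since the \<open>K\<close>-functional multiplies it by
  \<open>h\<close>, both parts of the decomposition are of order \<open>h powr \<theta>\<close>. For
  \<open>h \<le> T / 2\<close> an interval of length \<open>h\<close> with endpoint \<open>t\<close>
  fits into \<open>[0,T]\<close> on one side of \<open>t\<close>. Larger parameters are treated
  separately, so the constant \<open>C = 2 + L / (T / 2)\<close> depends on \<open>T\<close> and on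
  a bound \<open>L\<close> for \<open>j\<close>.\<close>

abbreviation "simple_bochner_integrable \<equiv> Bochner_Integration.simple_bochner_integrable"
abbreviation "simple_bochner_integral \<equiv> Bochner_Integration.simple_bochner_integral"

text \<open>Completeness makes every preimage that differs from a measurable set by a subset of a
  null set measurable.\<close>

lemma (in complete_measure) borel_measurable_AE_eq:
  fixes f f' :: "'a \<Rightarrow> 'b::topological_space"
  assumes f': "f' \<in> borel_measurable M" and eq: "AE x in M. f x = f' x"
  shows "f \<in> borel_measurable M"
proof (rule measurableI)
  fix B :: "'b set" assume B: "B \<in> sets borel"
  have "f' -` B \<inter> space M \<in> sets M"
    using f' B by (rule measurable_sets)
  moreover have "AE x in M. x \<in> f' -` B \<inter> space M \<longleftrightarrow> x \<in> f -` B \<inter> space M"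
    using eq by eventually_elim auto
  ultimately show "f -` B \<inter> space M \<in> sets M"
    by (intro in_sets_AE[where B="f -` B \<inter> space M" and A="f' -` B \<inter> space M"]) auto
qed auto

lemma (in complete_measure) borel_measurable_AE_LIMSEQ:
  fixes f :: "'a \<Rightarrow> real"
  assumes F: "\<And>i. F i \<in> borel_measurable M" and lim: "AE x in M. (\<lambda>i. F i x) \<longlonglongrightarrow> f x"
  shows "f \<in> borel_measurable M"
proof (rule borel_measurable_AE_eq)
  show "(\<lambda>x. lim (\<lambda>i. F i x)) \<in> borel_measurable M"
    using F by (rule borel_measurable_lim_metric)
  show "AE x in M. f x = lim (\<lambda>i. F i x)"
    using lim by eventually_elim (simp add: limI)
qed

lemma complete_measure_lebesgue_on:
  assumes S: "S \<in> sets lebesgue"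
  shows "complete_measure (lebesgue_on S)"
proof
  fix A B assume *: "B \<subseteq> A" "A \<in> null_sets (lebesgue_on S)"
  then have "A \<in> null_sets lebesgue" "A \<subseteq> S"
    using S by (auto simp: null_sets_restrict_space)
  then have "B \<in> null_sets lebesgue" "B \<subseteq> S"
    using * by (auto intro: null_sets_completion_subset)
  then show "B \<in> sets (lebesgue_on S)"
    using S by (auto simp: sets_restrict_space_iff)
qed

section \<open>Calculus of strongly measurable functions\<close>

lemma strongly_measurableE:
  assumes "strongly_measurable M f"
  obtains s where "\<And>i. simple_function M (s i)" "AE x in M. (\<lambda>i. s i x) \<longlonglongrightarrow> f x"
proof -
  obtain s where "\<And>i. simple_function M (s i)" "AE x in M. (\<lambda>i. norm (f x - s i x)) \<longlonglongrightarrow> 0"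
    using assms unfolding strongly_measurable_in_def by auto
  moreover have "(\<lambda>i. norm (f x - s i x)) \<longlonglongrightarrow> 0 \<longleftrightarrow> (\<lambda>i. s i x) \<longlonglongrightarrow> f x" for x
    by (subst LIM_zero_iff[symmetric, of "\<lambda>i. s i x"], subst tendsto_norm_zero_iff[symmetric])
       (simp add: norm_minus_commute)
  ultimately show ?thesis
    using that[of s] by simp
qed

lemma strongly_measurableI:
  assumes "\<And>i. simple_function M (s i)" "AE x in M. (\<lambda>i. s i x) \<longlonglongrightarrow> f x"
  shows "strongly_measurable M f"
  unfolding strongly_measurable_in_def
proof (intro exI[of _ s] conjI allI)
  show "AE x in M. f x \<in> UNIV \<and> (\<lambda>i. norm (f x - s i x)) \<longlonglongrightarrow> 0"
    using assms(2) by eventually_elim (auto intro!: tendsto_eq_intros)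
qed (use assms(1) in auto)

lemma strongly_measurable_simple: "simple_function M s \<Longrightarrow> strongly_measurable M s"
  by (rule strongly_measurableI[of _ "\<lambda>_. s"]) auto

lemma strongly_measurable_const [simp]: "strongly_measurable M (\<lambda>x. c)"
  by (rule strongly_measurable_simple) simp

lemma strongly_measurable_cong_AE:
  assumes "strongly_measurable M f" "AE x in M. f x = g x"
  shows "strongly_measurable M g"
proof -
  from assms(1) obtain s where s: "\<And>i. simple_function M (s i)" "AE x in M. (\<lambda>i. s i x) \<longlonglongrightarrow> f x"
    by (rule strongly_measurableE) blast
  show ?thesis
    by (rule strongly_measurableI[of _ s], fact s(1)) (use s(2) assms(2) in eventually_elim, simp)
qed

text \<open>\<open>h\<close> sends two simple functions to a simple function, so sequential
  continuity of \<open>h\<close> is enough and no product sigma-algebra on the targets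
  enters.\<close>

lemma strongly_measurable_compose2:
  assumes f: "strongly_measurable M f" and g: "strongly_measurable M g"
    and lim: "\<And>a b X Y. X \<longlonglongrightarrow> a \<Longrightarrow> Y \<longlonglongrightarrow> b \<Longrightarrow> (\<lambda>i. h (X i) (Y i)) \<longlonglongrightarrow> h a b"
  shows "strongly_measurable M (\<lambda>x. h (f x) (g x))"
proof -
  from f obtain s where s: "\<And>i. simple_function M (s i)" "AE x in M. (\<lambda>i. s i x) \<longlonglongrightarrow> f x"
    by (rule strongly_measurableE) blast
  from g obtain t where t: "\<And>i. simple_function M (t i)" "AE x in M. (\<lambda>i. t i x) \<longlonglongrightarrow> g x"
    by (rule strongly_measurableE) blast
  show ?thesis
  proof (rule strongly_measurableI)
    show "simple_function M (\<lambda>x. h (s i x) (t i x))" for i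
      using s(1) t(1) by (rule simple_function_compose2)
    show "AE x in M. (\<lambda>i. h (s i x) (t i x)) \<longlonglongrightarrow> h (f x) (g x)"
      using s(2) t(2) by eventually_elim (rule lim)
  qed
qed

lemma strongly_measurable_add:
  "strongly_measurable M f \<Longrightarrow> strongly_measurable M g \<Longrightarrow> strongly_measurable M (\<lambda>x. f x + g x)"
  by (rule strongly_measurable_compose2[where h="(+)"]) (auto intro: tendsto_add)

lemma strongly_measurable_diff:
  "strongly_measurable M f \<Longrightarrow> strongly_measurable M g \<Longrightarrow> strongly_measurable M (\<lambda>x. f x - g x)"
  by (rule strongly_measurable_compose2[where h="(-)"]) (auto intro: tendsto_diff)

lemma strongly_measurable_bounded_linear:
  assumes "bounded_linear L" "strongly_measurable M f"
  shows "strongly_measurable M (\<lambda>x. L (f x))"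
  by (rule strongly_measurable_compose2[OF assms(2,2), where h="\<lambda>x _. L x"])
     (rule bounded_linear.tendsto[OF assms(1)])

lemma strongly_measurable_real:
  fixes w :: "'s \<Rightarrow> real"
  assumes "w \<in> borel_measurable M"
  shows "strongly_measurable M w"
proof -
  obtain F where "\<And>i. simple_function M (F i)" "\<And>x. x \<in> space M \<Longrightarrow> (\<lambda>i. F i x) \<longlonglongrightarrow> w x"
    using borel_measurable_implies_sequence_metric[OF assms, of 0] by metis
  then show ?thesis
    by (intro strongly_measurableI[of _ F]) auto
qed

lemma strongly_measurable_scaleR:
  fixes w :: "'s \<Rightarrow> real"
  assumes "w \<in> borel_measurable M" "strongly_measurable M f"
  shows "strongly_measurable M (\<lambda>x. w x *\<^sub>R f x)"
  by (rule strongly_measurable_compose2[OF strongly_measurable_real[OF assms(1)] assms(2), where h="(*\<^sub>R)"])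
     (rule tendsto_scaleR)

text \<open>The norms of the simple approximants are Borel and converge almost everywhere;
  completeness turns such a limit into a Borel function.\<close>

lemma (in complete_measure) borel_measurable_norm_strongly_measurable:
  assumes "strongly_measurable M f"
  shows "(\<lambda>x. norm (f x)) \<in> borel_measurable M"
proof -
  from assms obtain s where s: "\<And>i. simple_function M (s i)" "AE x in M. (\<lambda>i. s i x) \<longlonglongrightarrow> f x"
    by (rule strongly_measurableE) blast
  show ?thesis
  proof (rule borel_measurable_AE_LIMSEQ)
    show "(\<lambda>x. norm (s i x)) \<in> borel_measurable M" for i
      using simple_function_compose1[OF s(1), of norm] by (rule borel_measurable_simple_function)
    show "AE x in M. (\<lambda>i. norm (s i x)) \<longlonglongrightarrow> norm (f x)"
      using s(2) by eventually_elim (rule tendsto_norm)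
  qed
qed

text \<open>Bochner's criterion. For Banach targets and complete measures it is equivalent to the
  existence of the strong integral, by \<open>has_strong_integral_alt\<close> and
  \<open>has_strong_integral_exists\<close>, and it is easier to check than an approximating
  sequence.\<close>

definition strongly_integrable :: "'s measure \<Rightarrow> ('s \<Rightarrow> 'a::real_normed_vector) \<Rightarrow> bool" where
  "strongly_integrable M f \<longleftrightarrow> strongly_measurable M f \<and> integrable M (\<lambda>x. norm (f x))"

lemma strongly_integrable_simple:
  assumes "simple_bochner_integrable M s"
  shows "strongly_integrable M s"
proof -
  have "simple_bochner_integrable M (\<lambda>x. norm (s x))"
    using simple_bochner_integrable_compose2[of "\<lambda>x _. norm x", OF _ assms assms] by simp
  then have "integrable M (\<lambda>x. norm (s x))"
    by (rule integrableI_simple_bochner_integrable)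
  then show ?thesis
    using assms
    by (auto simp: strongly_integrable_def Bochner_Integration.simple_bochner_integrable.simps
        intro: strongly_measurable_simple)
qed

lemma (in complete_measure) strongly_integrable_bound:
  assumes "strongly_measurable M f" "integrable M h" "AE x in M. norm (f x) \<le> h x"
  shows "strongly_integrable M f"
  unfolding strongly_integrable_def
proof
  show "integrable M (\<lambda>x. norm (f x))"
    using borel_measurable_norm_strongly_measurable[OF assms(1)]
    by (intro Bochner_Integration.integrable_bound[OF assms(2)])
       (use assms(3) in auto)
qed fact

lemma (in complete_measure) strongly_integrable_add:
  assumes "strongly_integrable M f" "strongly_integrable M g"
  shows "strongly_integrable M (\<lambda>x. f x + g x)"
  using assms unfolding strongly_integrable_def[of _ f] strongly_integrable_def[of _ g]
  by (intro strongly_integrable_bound[where h="\<lambda>x. norm (f x) + norm (g x)"])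
     (auto intro: strongly_measurable_add norm_triangle_ineq)

lemma (in complete_measure) strongly_integrable_diff:
  assumes "strongly_integrable M f" "strongly_integrable M g"
  shows "strongly_integrable M (\<lambda>x. f x - g x)"
  using assms unfolding strongly_integrable_def[of _ f] strongly_integrable_def[of _ g]
  by (intro strongly_integrable_bound[where h="\<lambda>x. norm (f x) + norm (g x)"])
     (auto intro: strongly_measurable_diff norm_triangle_ineq4)

lemma (in complete_measure) integrable_norm_diff:
  assumes "strongly_integrable M f" "strongly_integrable M g"
  shows "integrable M (\<lambda>x. norm (f x - g x))"
  using strongly_integrable_diff[OF assms] by (simp add: strongly_integrable_def)

lemma (in complete_measure) strongly_integrable_bounded_linear:
  assumes L: "bounded_linear L" and f: "strongly_integrable M f"
  shows "strongly_integrable M (\<lambda>x. L (f x))"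
proof -
  obtain K where K: "\<And>x. norm (L x) \<le> norm x * K"
    using bounded_linear.bounded[OF L] by blast
  show ?thesis
    using f K unfolding strongly_integrable_def[of _ f]
    by (intro strongly_integrable_bound[where h="\<lambda>x. norm (f x) * K"])
       (auto intro: strongly_measurable_bounded_linear[OF L])
qed

lemma (in complete_measure) strongly_integrable_scaleR:
  fixes w :: "'a \<Rightarrow> real"
  assumes w: "w \<in> borel_measurable M" "\<And>x. x \<in> space M \<Longrightarrow> \<bar>w x\<bar> \<le> B"
    and f: "strongly_integrable M f"
  shows "strongly_integrable M (\<lambda>x. w x *\<^sub>R f x)"
  using f w unfolding strongly_integrable_def[of _ f]
  by (intro strongly_integrable_bound[where h="\<lambda>x. B * norm (f x)"])
     (auto intro!: strongly_measurable_scaleR mult_right_mono AE_I2)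

lemma (in complete_measure) strongly_integrable_scaleR_const:
  fixes h :: "'a \<Rightarrow> real"
  assumes h: "integrable M h"
  shows "strongly_integrable M (\<lambda>x. h x *\<^sub>R c)"
  using h by (intro strongly_integrable_bound[where h="\<lambda>x. \<bar>h x\<bar> * norm c"])
     (auto intro!: strongly_measurable_scaleR)

lemma (in complete_measure) ennreal_integral_norm:
  assumes "strongly_integrable M f"
  shows "ennreal (\<integral>x. norm (f x) \<partial>M) = (\<integral>\<^sup>+x. ennreal (norm (f x)) \<partial>M)"
  using assms by (simp add: strongly_integrable_def nn_integral_eq_integral)

lemma simple_bochner_integral_norm_le:
  assumes "simple_bochner_integrable M s" "simple_bochner_integrable M t"
  shows "norm (simple_bochner_integral M s - simple_bochner_integral M t) \<le> (\<integral>x. norm (s x - t x) \<partial>M)"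
proof -
  have st: "simple_bochner_integrable M (\<lambda>x. s x - t x)"
    "simple_bochner_integrable M (\<lambda>x. norm (s x - t x))"
    using simple_bochner_integrable_compose2[of "(-)" M s t]
      simple_bochner_integrable_compose2[of "\<lambda>x y. norm (x - y)" M s t] assms by auto
  have "norm (simple_bochner_integral M s - simple_bochner_integral M t)
      = norm (simple_bochner_integral M (\<lambda>x. s x - t x))"
    using assms by (simp add: simple_bochner_integral_diff)
  also have "\<dots> \<le> simple_bochner_integral M (\<lambda>x. norm (s x - t x))"
    by (rule simple_bochner_integral_norm_bound[OF st(1)])
  also have "\<dots> = (\<integral>x. norm (s x - t x) \<partial>M)"
    using has_bochner_integral_simple_bochner_integrable[OF st(2)]
    by (simp add: has_bochner_integral_iff)
  finally show ?thesis .
qed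

text \<open>Turns the \<open>L\<^sup>1\<close> distances into real integrals, to which ordinary
  limits, sums and monotonicity apply.\<close>

lemma (in complete_measure) has_strong_integral_alt:
  "has_strong_integral M f x \<longleftrightarrow> strongly_integrable M f \<and>
    (\<exists>s. (\<forall>i. simple_bochner_integrable M (s i)) \<and>
         (\<lambda>i. \<integral>t. norm (f t - s i t) \<partial>M) \<longlonglongrightarrow> 0 \<and>
         (\<lambda>i. simple_bochner_integral M (s i)) \<longlonglongrightarrow> x)"
proof
  assume "has_strong_integral M f x"
  then obtain s where f: "strongly_measurable M f" and s: "\<And>i. simple_bochner_integrable M (s i)"
    "(\<lambda>i. \<integral>\<^sup>+ t. ennreal (norm (f t - s i t)) \<partial>M) \<longlonglongrightarrow> 0"
    "(\<lambda>i. simple_bochner_integral M (s i)) \<longlonglongrightarrow> x"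
    unfolding has_strong_integral_def by blast
  have si: "strongly_integrable M (s i)" for i
    using s(1) by (rule strongly_integrable_simple)
  have meas: "(\<lambda>t. norm (f t - s i t)) \<in> borel_measurable M" for i
    using f si by (auto simp: strongly_integrable_def
        intro!: borel_measurable_norm_strongly_measurable strongly_measurable_diff)
  \<comment> \<open>A single index with finite distance suffices: \<open>f\<close> is then the sum
    of the integrable functions \<open>f - s i\<close> and \<open>s i\<close>.\<close>
  have "eventually (\<lambda>i. (\<integral>\<^sup>+ t. ennreal (norm (f t - s i t)) \<partial>M) < 1) sequentially"
    using s(2) by (rule order_tendstoD) simp
  then obtain i where "(\<integral>\<^sup>+ t. ennreal (norm (f t - s i t)) \<partial>M) < 1"
    by (auto simp: eventually_sequentially)
  then have "integrable M (\<lambda>t. norm (f t - s i t))"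
    using meas by (intro integrableI_bounded) (auto elim: order.strict_trans)
  then have "strongly_integrable M (\<lambda>t. f t - s i t)"
    using f si by (auto simp: strongly_integrable_def intro!: strongly_measurable_diff)
  from strongly_integrable_add[OF this si[of i]] have fi: "strongly_integrable M f"
    by simp
  have "(\<lambda>i. ennreal (\<integral>t. norm (f t - s i t) \<partial>M)) \<longlonglongrightarrow> ennreal 0"
    using s(2) by (simp add: ennreal_integral_norm[OF strongly_integrable_diff[OF fi si]])
  then have "(\<lambda>i. \<integral>t. norm (f t - s i t) \<partial>M) \<longlonglongrightarrow> 0"
    by (subst (asm) tendsto_ennreal_iff) (auto intro!: always_eventually)
  with fi s show "strongly_integrable M f \<and>
    (\<exists>s. (\<forall>i. simple_bochner_integrable M (s i)) \<and>
         (\<lambda>i. \<integral>t. norm (f t - s i t) \<partial>M) \<longlonglongrightarrow> 0 \<and>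
         (\<lambda>i. simple_bochner_integral M (s i)) \<longlonglongrightarrow> x)"
    by blast
next
  assume R: "strongly_integrable M f \<and>
    (\<exists>s. (\<forall>i. simple_bochner_integrable M (s i)) \<and>
         (\<lambda>i. \<integral>t. norm (f t - s i t) \<partial>M) \<longlonglongrightarrow> 0 \<and>
         (\<lambda>i. simple_bochner_integral M (s i)) \<longlonglongrightarrow> x)"
  then obtain s where f: "strongly_integrable M f" and s: "\<And>i. simple_bochner_integrable M (s i)"
    "(\<lambda>i. \<integral> t. norm (f t - s i t) \<partial>M) \<longlonglongrightarrow> 0"
    "(\<lambda>i. simple_bochner_integral M (s i)) \<longlonglongrightarrow> x" by blast
  have si: "strongly_integrable M (s i)" for i
    using s(1) by (rule strongly_integrable_simple)
  have "(\<lambda>i. ennreal (\<integral>t. norm (f t - s i t) \<partial>M)) \<longlonglongrightarrow> ennreal 0"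
    using s(2) by (rule tendsto_ennrealI)
  then have "(\<lambda>i. \<integral>\<^sup>+ t. ennreal (norm (f t - s i t)) \<partial>M) \<longlonglongrightarrow> 0"
    by (simp add: ennreal_integral_norm[OF strongly_integrable_diff[OF f si]])
  with f s show "has_strong_integral M f x"
    unfolding has_strong_integral_def strongly_integrable_def by blast
qed

text \<open>The approximating functions are truncated to \<open>{norm (s i) \<le> 2 * norm f}\<close>, which makes
  dominated convergence applicable.\<close>

lemma (in complete_measure) strongly_integrable_approx:
  assumes f: "strongly_integrable M f"
  obtains s where "\<And>i. simple_bochner_integrable M (s i)" "(\<lambda>i. \<integral>t. norm (f t - s i t) \<partial>M) \<longlonglongrightarrow> 0"
proof -
  have fm: "strongly_measurable M f" and fi: "integrable M (\<lambda>x. norm (f x))"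
    using f by (auto simp: strongly_integrable_def)
  from fm obtain s where s: "\<And>i. simple_function M (s i)" "AE x in M. (\<lambda>i. s i x) \<longlonglongrightarrow> f x"
    by (rule strongly_measurableE) blast
  define A where "A i = {x\<in>space M. norm (s i x) \<le> 2 * norm (f x)}" for i
  define t where "t i x = indicator (A i) x *\<^sub>R s i x" for i x
  have [measurable]: "(\<lambda>x. norm (f x)) \<in> borel_measurable M"
    using fi by auto
  have [measurable]: "(\<lambda>x. norm (s i x)) \<in> borel_measurable M" for i
    using simple_function_compose1[OF s(1), of norm] by (rule borel_measurable_simple_function)
  have A: "A i \<in> sets M" for i
    unfolding A_def by measurable
  have t: "simple_function M (t i)" for i
    unfolding t_def using A s(1) by (intro simple_function_compose2[where h="(*\<^sub>R)"] simple_function_indicator)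
  have tle: "norm (t i x) \<le> 2 * norm (f x)" for i x
    by (auto simp: t_def A_def indicator_def)
  have tm: "strongly_measurable M (t i)" for i
    using t by (rule strongly_measurable_simple)
  have ti: "simple_bochner_integrable M (t i)" for i
  proof (rule simple_bochner_integrableI_bounded[OF t])
    have "integrable M (\<lambda>x. 2 * norm (f x))"
      using fi by simp
    then have "strongly_integrable M (t i)"
      using tm tle by (intro strongly_integrable_bound[of "t i" "\<lambda>x. 2 * norm (f x)"]) auto
    from ennreal_integral_norm[OF this] show "(\<integral>\<^sup>+x. norm (t i x) \<partial>M) < \<infinity>"
      by (metis ennreal_less_top infinity_ennreal_def)
  qed
  have lim: "AE x in M. (\<lambda>i. norm (f x - t i x)) \<longlonglongrightarrow> 0"
    using s(2) AE_space
  proof eventually_elim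
    case (elim x)
    have "(\<lambda>i. t i x) \<longlonglongrightarrow> f x"
    \<comment> \<open>Unless \<open>f x = 0\<close>, the bound \<open>2 * norm (f x)\<close> lies
      strictly above the limit of \<open>norm (s i x)\<close>, so the truncation is eventually
      inactive; where \<open>f x = 0\<close> it forces \<open>t i x = 0\<close>.\<close>
    proof (cases "f x = 0")
      case True
      then have "t i x = 0" for i
        using tle[of i x] by simp
      then show ?thesis
        using True by simp
    next
      case False
      then have "eventually (\<lambda>i. norm (s i x) < 2 * norm (f x)) sequentially"
        using tendsto_norm[OF elim(1)] by (intro order_tendstoD) auto
      then have "eventually (\<lambda>i. t i x = s i x) sequentially"
        by eventually_elim (use elim in \<open>auto simp: t_def A_def\<close>)
      then show ?thesis
        using elim(1) by (simp add: filterlim_cong)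
    qed
    then show ?case
      by (auto intro!: tendsto_eq_intros)
  qed
  have "(\<lambda>i. \<integral>x. norm (f x - t i x) \<partial>M) \<longlonglongrightarrow> (\<integral>x. 0 \<partial>M)"
  proof (rule integral_dominated_convergence)
    show "(\<lambda>x. norm (f x - t i x)) \<in> borel_measurable M" for i
      by (intro borel_measurable_norm_strongly_measurable strongly_measurable_diff fm tm)
    show "integrable M (\<lambda>x. 3 * norm (f x))"
      using fi by simp
    show "AE x in M. norm (norm (f x - t i x)) \<le> 3 * norm (f x)" for i
    proof (rule AE_I2)
      fix x show "norm (norm (f x - t i x)) \<le> 3 * norm (f x)"
        using norm_triangle_ineq4[of "f x" "t i x"] tle[of i x] by simp
    qed
  qed (use lim in auto)
  then show ?thesis
    using that[of t] ti by simp
qed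

text \<open>The integral is nonexpansive in \<open>L\<^sup>1\<close>, by the triangle inequality on
  simple approximants of both functions. Comparing two functions at once makes uniqueness, the norm
  bound and the limit theorems instances.\<close>

lemma (in complete_measure) has_strong_integral_norm_diff_le:
  assumes "has_strong_integral M f x" "has_strong_integral M g y"
  shows "norm (x - y) \<le> (\<integral>t. norm (f t - g t) \<partial>M)"
proof -
  obtain s where f: "strongly_integrable M f" and s: "\<And>i. simple_bochner_integrable M (s i)"
    "(\<lambda>i. \<integral>t. norm (f t - s i t) \<partial>M) \<longlonglongrightarrow> 0" "(\<lambda>i. simple_bochner_integral M (s i)) \<longlonglongrightarrow> x"
    using assms(1) unfolding has_strong_integral_alt by blast
  obtain r where g: "strongly_integrable M g" and r: "\<And>i. simple_bochner_integrable M (r i)"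
    "(\<lambda>i. \<integral>t. norm (g t - r i t) \<partial>M) \<longlonglongrightarrow> 0" "(\<lambda>i. simple_bochner_integral M (r i)) \<longlonglongrightarrow> y"
    using assms(2) unfolding has_strong_integral_alt by blast
  note int = f g strongly_integrable_simple[OF s(1)] strongly_integrable_simple[OF r(1)]
  note D = integrable_norm_diff[OF f int(3)] integrable_norm_diff[OF g int(4)]
    integrable_norm_diff[OF int(3,4)] integrable_norm_diff[OF f g]
  have "norm (simple_bochner_integral M (s i) - simple_bochner_integral M (r i))
    \<le> (\<integral>t. norm (f t - s i t) \<partial>M) + (\<integral>t. norm (g t - r i t) \<partial>M) + (\<integral>t. norm (f t - g t) \<partial>M)" for i
  proof -
    have "norm (simple_bochner_integral M (s i) - simple_bochner_integral M (r i))
      \<le> (\<integral>t. norm (s i t - r i t) \<partial>M)"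
      using s(1) r(1) by (rule simple_bochner_integral_norm_le)
    also have "\<dots> \<le> (\<integral>t. norm (f t - s i t) + norm (g t - r i t) + norm (f t - g t) \<partial>M)"
    proof (rule integral_mono)
      fix t
      have "s i t - r i t = (f t - g t) - (f t - s i t) + (g t - r i t)" by simp
      also have "norm \<dots> \<le> norm (f t - g t) + norm (f t - s i t) + norm (g t - r i t)"
        by (meson add_right_mono norm_triangle_ineq norm_triangle_ineq4 order_trans)
      finally show "norm (s i t - r i t) \<le> norm (f t - s i t) + norm (g t - r i t) + norm (f t - g t)"
        by simp
    qed (auto intro!: D Bochner_Integration.integrable_add)
    also have "\<dots> = (\<integral>t. norm (f t - s i t) \<partial>M) + (\<integral>t. norm (g t - r i t) \<partial>M) + (\<integral>t. norm (f t - g t) \<partial>M)"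
      by (simp add: D)
    finally show ?thesis .
  qed
  then have "norm (x - y) \<le> 0 + 0 + (\<integral>t. norm (f t - g t) \<partial>M)"
    by (intro LIMSEQ_le[OF tendsto_norm[OF tendsto_diff[OF s(3) r(3)]]
          tendsto_add[OF tendsto_add[OF s(2) r(2)] tendsto_const]]) auto
  then show ?thesis by simp
qed

lemma (in complete_measure) has_strong_integral_unique:
  assumes "has_strong_integral M f x" "has_strong_integral M f y"
  shows "x = y"
  using has_strong_integral_norm_diff_le[OF assms] by simp

text \<open>The integrals of the approximants form a Cauchy sequence by the nonexpansive estimate;
  here the completeness of the target is used.\<close>

lemma (in complete_measure) has_strong_integral_exists:
  fixes f :: "'a \<Rightarrow> 'b::banach"
  assumes f: "strongly_integrable M f"
  shows "\<exists>x. has_strong_integral M f x"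
proof -
  obtain s where s: "\<And>i. simple_bochner_integrable M (s i)" "(\<lambda>i. \<integral>t. norm (f t - s i t) \<partial>M) \<longlonglongrightarrow> 0"
    using strongly_integrable_approx[OF f] by blast
  have si: "strongly_integrable M (s i)" for i
    using s(1) by (rule strongly_integrable_simple)
  have "Cauchy (\<lambda>i. simple_bochner_integral M (s i))"
  proof (rule CauchyI)
    fix e :: real assume e: "e > 0"
    then have "eventually (\<lambda>i. (\<integral>t. norm (f t - s i t) \<partial>M) < e / 2) sequentially"
      by (intro order_tendstoD[OF s(2)]) auto
    then obtain N where N: "\<And>i. i \<ge> N \<Longrightarrow> (\<integral>t. norm (f t - s i t) \<partial>M) < e / 2"
      by (auto simp: eventually_sequentially)
    have "norm (simple_bochner_integral M (s m) - simple_bochner_integral M (s n)) < e"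
      if "m \<ge> N" "n \<ge> N" for m n
    proof -
      note D = integrable_norm_diff[OF f si] integrable_norm_diff[OF si si]
      have "norm (simple_bochner_integral M (s m) - simple_bochner_integral M (s n))
          \<le> (\<integral>t. norm (s m t - s n t) \<partial>M)"
        by (intro simple_bochner_integral_norm_le s)
      also have "\<dots> \<le> (\<integral>t. norm (f t - s m t) + norm (f t - s n t) \<partial>M)"
        by (intro integral_mono D Bochner_Integration.integrable_add)
           (metis norm_minus_commute norm_diff_triangle_le order_refl)
      also have "\<dots> = (\<integral>t. norm (f t - s m t) \<partial>M) + (\<integral>t. norm (f t - s n t) \<partial>M)"
        by (intro Bochner_Integration.integral_add D)
      also have "\<dots> < e"
        using N[OF that(1)] N[OF that(2)] by simp
      finally show ?thesis .
    qed
    then show "\<exists>N. \<forall>m\<ge>N. \<forall>n\<ge>N.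
        norm (simple_bochner_integral M (s m) - simple_bochner_integral M (s n)) < e"
      by blast
  qed
  then obtain x where "(\<lambda>i. simple_bochner_integral M (s i)) \<longlonglongrightarrow> x"
    using Cauchy_convergent convergent_def by blast
  then show ?thesis
    using f s unfolding has_strong_integral_alt by blast
qed

lemma (in complete_measure) has_strong_integral_add:
  assumes "has_strong_integral M f x" "has_strong_integral M g y"
  shows "has_strong_integral M (\<lambda>t. f t + g t) (x + y)"
proof -
  obtain s where f: "strongly_integrable M f" and s: "\<And>i. simple_bochner_integrable M (s i)"
    "(\<lambda>i. \<integral>t. norm (f t - s i t) \<partial>M) \<longlonglongrightarrow> 0" "(\<lambda>i. simple_bochner_integral M (s i)) \<longlonglongrightarrow> x"
    using assms(1) unfolding has_strong_integral_alt by blast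
  obtain r where g: "strongly_integrable M g" and r: "\<And>i. simple_bochner_integrable M (r i)"
    "(\<lambda>i. \<integral>t. norm (g t - r i t) \<partial>M) \<longlonglongrightarrow> 0" "(\<lambda>i. simple_bochner_integral M (r i)) \<longlonglongrightarrow> y"
    using assms(2) unfolding has_strong_integral_alt by blast
  note int = f g strongly_integrable_simple[OF s(1)] strongly_integrable_simple[OF r(1)]
  note D = integrable_norm_diff[OF f int(3)] integrable_norm_diff[OF g int(4)]
    integrable_norm_diff[OF int(3,4)] integrable_norm_diff[OF f g]
  show ?thesis
    unfolding has_strong_integral_alt
  proof (intro conjI exI[of _ "\<lambda>i t. s i t + r i t"] allI)
    show "strongly_integrable M (\<lambda>t. f t + g t)"
      using f g by (rule strongly_integrable_add)
    show sr: "simple_bochner_integrable M (\<lambda>t. s i t + r i t)" for i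
      using s(1) r(1) by (intro simple_bochner_integrable_compose2[where p="(+)"]) auto
    have "(\<lambda>i. (\<integral>t. norm (f t - s i t) \<partial>M) + (\<integral>t. norm (g t - r i t) \<partial>M)) \<longlonglongrightarrow> 0"
      using tendsto_add[OF s(2) r(2)] by simp
    then show "(\<lambda>i. \<integral>t. norm (f t + g t - (s i t + r i t)) \<partial>M) \<longlonglongrightarrow> 0"
    proof (rule tendsto_sandwich[OF _ _ tendsto_const, rotated 2])
      show "eventually (\<lambda>i. (\<integral>t. norm (f t + g t - (s i t + r i t)) \<partial>M)
          \<le> (\<integral>t. norm (f t - s i t) \<partial>M) + (\<integral>t. norm (g t - r i t) \<partial>M)) sequentially"
      proof (intro always_eventually allI)
        fix i
        have "(\<integral>t. norm (f t + g t - (s i t + r i t)) \<partial>M)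
            \<le> (\<integral>t. norm (f t - s i t) + norm (g t - r i t) \<partial>M)"
          using integrable_norm_diff[OF strongly_integrable_add[OF f g]
              strongly_integrable_simple[OF sr]]
          by (intro integral_mono norm_diff_triangle_ineq) (auto intro: D)
        also have "\<dots> = (\<integral>t. norm (f t - s i t) \<partial>M) + (\<integral>t. norm (g t - r i t) \<partial>M)"
          by (intro Bochner_Integration.integral_add) (auto intro: D int)
        finally show "(\<integral>t. norm (f t + g t - (s i t + r i t)) \<partial>M)
          \<le> (\<integral>t. norm (f t - s i t) \<partial>M) + (\<integral>t. norm (g t - r i t) \<partial>M)" .
      qed
    qed auto
    show "(\<lambda>i. simple_bochner_integral M (\<lambda>t. s i t + r i t)) \<longlonglongrightarrow> x + y"
      using tendsto_add[OF s(3) r(3)] s(1) r(1) by (simp add: simple_bochner_integral_add)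
  qed
qed

lemma (in complete_measure) has_strong_integral_bounded_linear:
  assumes L: "bounded_linear L" and "has_strong_integral M f x"
  shows "has_strong_integral M (\<lambda>t. L (f t)) (L x)"
proof -
  interpret L: bounded_linear L by fact
  obtain K where K: "\<And>x. norm (L x) \<le> norm x * K"
    using L.bounded by blast
  obtain s where f: "strongly_integrable M f" and s: "\<And>i. simple_bochner_integrable M (s i)"
    "(\<lambda>i. \<integral>t. norm (f t - s i t) \<partial>M) \<longlonglongrightarrow> 0" "(\<lambda>i. simple_bochner_integral M (s i)) \<longlonglongrightarrow> x"
    using assms(2) unfolding has_strong_integral_alt by blast
  note D = strongly_integrable_diff[OF f strongly_integrable_simple[OF s(1)]]
  show ?thesis
    unfolding has_strong_integral_alt
  proof (intro conjI exI[of _ "\<lambda>i t. L (s i t)"] allI)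
    show "strongly_integrable M (\<lambda>t. L (f t))"
      using L f by (rule strongly_integrable_bounded_linear)
    show "simple_bochner_integrable M (\<lambda>t. L (s i t))" for i
      using simple_bochner_integrable_compose2[OF _ s(1)[of i] s(1)[of i], of "\<lambda>x _. L x"]
      by (simp add: L.zero)
    have "(\<lambda>i. (\<integral>t. norm (f t - s i t) \<partial>M) * K) \<longlonglongrightarrow> 0"
      using tendsto_mult_right[OF s(2), of K] by simp
    then show "(\<lambda>i. \<integral>t. norm (L (f t) - L (s i t)) \<partial>M) \<longlonglongrightarrow> 0"
    proof (rule tendsto_sandwich[OF _ _ tendsto_const, rotated 2])
      show "eventually (\<lambda>i. (\<integral>t. norm (L (f t) - L (s i t)) \<partial>M)
          \<le> (\<integral>t. norm (f t - s i t) \<partial>M) * K) sequentially"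
      proof (intro always_eventually allI)
        fix i
        have "(\<integral>t. norm (L (f t - s i t)) \<partial>M) \<le> (\<integral>t. norm (f t - s i t) * K \<partial>M)"
          using D[of i] strongly_integrable_bounded_linear[OF L D[of i]] K
          unfolding strongly_integrable_def by (intro integral_mono) auto
        then show "(\<integral>t. norm (L (f t) - L (s i t)) \<partial>M) \<le> (\<integral>t. norm (f t - s i t) \<partial>M) * K"
          by (simp add: L.diff)
      qed
    qed auto
    show "(\<lambda>i. simple_bochner_integral M (\<lambda>t. L (s i t))) \<longlonglongrightarrow> L x"
      using L.tendsto[OF s(3)] s(1) by (simp add: simple_bochner_integral_linear L.linear)
  qed
qed

lemma (in complete_measure) has_strong_integral_real:
  fixes h :: "'a \<Rightarrow> real"
  assumes "integrable M h"
  shows "has_strong_integral M h (\<integral>x. h x \<partial>M)"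
proof -
  have "has_bochner_integral M h (\<integral>x. h x \<partial>M)"
    using assms by (rule has_bochner_integral_integrable)
  then show ?thesis
    unfolding has_strong_integral_def has_bochner_integral.simps
    using strongly_measurable_real by blast
qed

lemma (in complete_measure) has_strong_integral_cong_AE:
  assumes "has_strong_integral M f x" "AE t in M. f t = g t"
  shows "has_strong_integral M g x"
proof -
  have "(\<integral>\<^sup>+t. ennreal (norm (g t - s t)) \<partial>M) = (\<integral>\<^sup>+t. ennreal (norm (f t - s t)) \<partial>M)" for s
    using assms(2) by (intro nn_integral_cong_AE) auto
  then show ?thesis
    using assms strongly_measurable_cong_AE[OF _ assms(2)] unfolding has_strong_integral_def by simp
qed

lemma (in complete_measure) has_strong_integral_simple:
  assumes "simple_bochner_integrable M s"
  shows "has_strong_integral M s (simple_bochner_integral M s)"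
  unfolding has_strong_integral_alt
  using assms by (auto intro!: exI[of _ "\<lambda>_. s"] strongly_integrable_simple)

text \<open>Transfers an integral over \<open>(0,T)\<close> with an indicator to an integral over a
  subinterval, the form that (i) asks for.\<close>

lemma (in complete_measure) has_strong_integral_restrict_space:
  assumes S: "S \<in> sets M" and f: "has_strong_integral M (\<lambda>t. indicator S t *\<^sub>R f t) x"
  shows "has_strong_integral (restrict_space M S) f x"
proof -
  define h where "h t = indicat_real S t *\<^sub>R f t" for t
  have hx: "has_strong_integral M h x"
    using f by (simp add: h_def[abs_def])
  then have h: "strongly_integrable M h"
    by (simp add: has_strong_integral_alt)
  have S': "S \<inter> space M \<in> sets M" using S by auto
  obtain s where s: "\<And>i. simple_bochner_integrable M (s i)" "(\<lambda>i. \<integral>t. norm (h t - s i t) \<partial>M) \<longlonglongrightarrow> 0"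
    using strongly_integrable_approx[OF h] by blast
  \<comment> \<open>Cutting off the approximants does not increase their distance to
    \<open>h\<close>, which vanishes off \<open>S\<close>; and \<open>s i\<close> is simple
    integrable on the restricted space exactly when \<open>r i\<close> is on
    \<open>M\<close>.\<close>
  define r where "r i t = indicat_real S t *\<^sub>R s i t" for i t
  have r: "simple_bochner_integrable M (r i)" for i
  proof (rule simple_bochner_integrableI_bounded)
    show "simple_function M (r i)"
      using s(1)[of i] S unfolding r_def Bochner_Integration.simple_bochner_integrable.simps
      by (intro simple_function_compose2[where h="(*\<^sub>R)"] simple_function_indicator) auto
    have "(\<integral>\<^sup>+t. norm (r i t) \<partial>M) \<le> (\<integral>\<^sup>+t. norm (s i t) \<partial>M)"
      by (intro nn_integral_mono) (auto simp: r_def indicator_def)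
    also have "\<dots> < \<infinity>"
      using ennreal_integral_norm[OF strongly_integrable_simple[OF s(1)]]
      by (metis ennreal_less_top infinity_ennreal_def)
    finally show "(\<integral>\<^sup>+t. norm (r i t) \<partial>M) < \<infinity>" .
  qed
  have ri: "strongly_integrable M (r i)" for i
    using r by (rule strongly_integrable_simple)
  have le: "norm (h t - r i t) \<le> norm (h t - s i t)" for i t
    by (auto simp: h_def r_def indicator_def)
  have lim: "(\<lambda>i. \<integral>t. norm (h t - r i t) \<partial>M) \<longlonglongrightarrow> 0"
  proof (rule tendsto_sandwich[OF _ _ tendsto_const s(2)])
    show "eventually (\<lambda>i. (\<integral>t. norm (h t - r i t) \<partial>M) \<le> (\<integral>t. norm (h t - s i t) \<partial>M)) sequentially"
      using le integrable_norm_diff[OF h ri] integrable_norm_diff[OF h strongly_integrable_simple[OF s(1)]]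
      by (intro always_eventually allI integral_mono) auto
  qed auto
  show ?thesis
    unfolding has_strong_integral_def
  proof (intro conjI exI[of _ s] allI)
    show sS: "simple_bochner_integrable (restrict_space M S) (s i)" for i
      using r[of i] simple_bochner_integrable_restrict_space[OF S', of "s i"]
      by (simp add: r_def[abs_def])
    obtain q where q: "\<And>i. simple_function M (q i)" "AE x in M. (\<lambda>i. q i x) \<longlonglongrightarrow> h x"
      by (rule strongly_measurableE[OF conjunct1[OF h[unfolded strongly_integrable_def]]]) (erule that)
    show "strongly_measurable (restrict_space M S) f"
    proof (rule strongly_measurableI)
      show "simple_function (restrict_space M S) (q i)" for i
        unfolding simple_function_restrict_space[OF S']
        by (intro simple_function_compose2[where h="(*\<^sub>R)"] simple_function_indicator S q)
      show "AE x in restrict_space M S. (\<lambda>i. q i x) \<longlonglongrightarrow> f x"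
        unfolding AE_restrict_space_iff[OF S'] using q(2) by eventually_elim (auto simp: h_def)
    qed
    have "(\<integral>\<^sup>+ t. ennreal (norm (f t - s i t)) \<partial>restrict_space M S) = ennreal (\<integral>t. norm (h t - r i t) \<partial>M)" for i
      unfolding nn_integral_restrict_space[OF S'] ennreal_integral_norm[OF strongly_integrable_diff[OF h ri]]
      by (intro nn_integral_cong) (auto simp: h_def r_def indicator_def)
    then show "(\<lambda>i. \<integral>\<^sup>+ t. ennreal (norm (f t - s i t)) \<partial>restrict_space M S) \<longlonglongrightarrow> 0"
      using tendsto_ennrealI[OF lim] by simp
    have "simple_bochner_integral (restrict_space M S) (s i) = simple_bochner_integral M (r i)" for i
      using simple_bochner_integral_restrict_space[OF S' sS] by (simp add: r_def[abs_def])
    moreover have "(\<lambda>i. simple_bochner_integral M (r i)) \<longlonglongrightarrow> x"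
    proof (rule LIM_zero_cancel, rule Lim_null_comparison[OF _ lim])
      show "eventually (\<lambda>i. norm (simple_bochner_integral M (r i) - x) \<le> (\<integral>t. norm (h t - r i t) \<partial>M)) sequentially"
        using has_strong_integral_norm_diff_le[OF hx has_strong_integral_simple[OF r]]
        by (simp add: norm_minus_commute)
    qed
    ultimately show "(\<lambda>i. simple_bochner_integral (restrict_space M S) (s i)) \<longlonglongrightarrow> x"
      by simp
  qed
qed

section \<open>The integral as an operator, with limit theorems and an induction rule\<close>

definition strong_integral :: "'s measure \<Rightarrow> ('s \<Rightarrow> 'a::real_normed_vector) \<Rightarrow> 'a" where
  "strong_integral M f = (THE x. has_strong_integral M f x)"

lemma (in complete_measure) strong_integral_eqI:
  "has_strong_integral M f x \<Longrightarrow> strong_integral M f = x"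
  unfolding strong_integral_def using has_strong_integral_unique by blast

lemma (in complete_measure) has_strong_integral_strong_integral:
  fixes f :: "'a \<Rightarrow> 'b::banach"
  assumes "strongly_integrable M f"
  shows "has_strong_integral M f (strong_integral M f)"
  using has_strong_integral_exists[OF assms] strong_integral_eqI by metis

lemma (in complete_measure) strong_integral_add:
  fixes f g :: "'a \<Rightarrow> 'b::banach"
  assumes "strongly_integrable M f" "strongly_integrable M g"
  shows "strong_integral M (\<lambda>t. f t + g t) = strong_integral M f + strong_integral M g"
  by (intro strong_integral_eqI has_strong_integral_add has_strong_integral_strong_integral assms)

lemma (in complete_measure) strong_integral_bounded_linear:
  fixes f :: "'a \<Rightarrow> 'b::banach"
  assumes "bounded_linear L" "strongly_integrable M f"
  shows "strong_integral M (\<lambda>t. L (f t)) = L (strong_integral M f)"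
  by (rule strong_integral_eqI[OF has_strong_integral_bounded_linear[OF assms(1)
      has_strong_integral_strong_integral[OF assms(2)]]])

lemma (in complete_measure) strong_integral_diff:
  fixes f g :: "'a \<Rightarrow> 'b::banach"
  assumes "strongly_integrable M f" "strongly_integrable M g"
  shows "strong_integral M (\<lambda>t. f t - g t) = strong_integral M f - strong_integral M g"
  using strong_integral_add[OF assms(1) strongly_integrable_bounded_linear[OF bounded_linear_minus[OF bounded_linear_ident] assms(2)]]
    strong_integral_bounded_linear[OF bounded_linear_minus[OF bounded_linear_ident] assms(2)]
  by simp

lemma (in complete_measure) strong_integral_scaleR_const:
  fixes h :: "'a \<Rightarrow> real" and c :: "'b::banach"
  assumes "integrable M h"
  shows "strong_integral M (\<lambda>t. h t *\<^sub>R c) = (\<integral>t. h t \<partial>M) *\<^sub>R c"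
  by (rule strong_integral_eqI[OF has_strong_integral_bounded_linear[OF bounded_linear_scaleR_left
      has_strong_integral_real[OF assms]]])

lemma (in complete_measure) strong_integral_cong_AE:
  fixes f :: "'a \<Rightarrow> 'b::banach"
  assumes "strongly_integrable M f" "AE t in M. f t = g t"
  shows "strong_integral M g = strong_integral M f"
  by (intro strong_integral_eqI has_strong_integral_cong_AE[OF has_strong_integral_strong_integral] assms)

lemma (in complete_measure) norm_strong_integral_diff_le:
  fixes f :: "'a \<Rightarrow> 'b::banach"
  assumes "strongly_integrable M f" "strongly_integrable M g"
  shows "norm (strong_integral M f - strong_integral M g) \<le> (\<integral>t. norm (f t - g t) \<partial>M)"
  by (intro has_strong_integral_norm_diff_le has_strong_integral_strong_integral assms)

lemma (in complete_measure) norm_strong_integral_le: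
  fixes f :: "'a \<Rightarrow> 'b::banach"
  assumes "strongly_integrable M f"
  shows "norm (strong_integral M f) \<le> (\<integral>t. norm (f t) \<partial>M)"
proof -
  \<comment> \<open>The zero function gets the integral zero from linearity; comparing
    \<open>f\<close> with it gives the norm bound.\<close>
  have "has_strong_integral M (\<lambda>t. 0 *\<^sub>R f t) (0 *\<^sub>R strong_integral M f)"
    by (rule has_strong_integral_bounded_linear[OF bounded_linear_scaleR_right
        has_strong_integral_strong_integral[OF assms]])
  then show ?thesis
    using has_strong_integral_norm_diff_le[OF has_strong_integral_strong_integral[OF assms], of "\<lambda>t. 0" 0] by simp
qed

lemma (in complete_measure) strong_integral_LIMSEQ:
  fixes f :: "'a \<Rightarrow> 'b::banach"
  assumes f: "strongly_integrable M f" and F: "\<And>i. strongly_integrable M (F i)"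
    and lim: "(\<lambda>i. \<integral>t. norm (f t - F i t) \<partial>M) \<longlonglongrightarrow> 0"
  shows "(\<lambda>i. strong_integral M (F i)) \<longlonglongrightarrow> strong_integral M f"
proof (rule LIM_zero_cancel, rule Lim_null_comparison[OF _ lim])
  show "eventually (\<lambda>i. norm (strong_integral M (F i) - strong_integral M f)
      \<le> (\<integral>t. norm (f t - F i t) \<partial>M)) sequentially"
    using norm_strong_integral_diff_le[OF f F] by (simp add: norm_minus_commute)
qed

text \<open>Simple functions are dense in \<open>L\<^sup>1\<close>, so closure under sums and
  \<open>L\<^sup>1\<close> limits extends a property to all integrable functions. The rule reduces
  vector-valued integration by parts to a scalar Fubini argument.\<close>

lemma (in complete_measure) strongly_integrable_induct [consumes 1, case_names cong base add lim]:
  fixes f :: "'a \<Rightarrow> 'b::real_normed_vector"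
  assumes f: "strongly_integrable M f"
    and cong: "\<And>f g. P f \<Longrightarrow> (\<And>t. t \<in> space M \<Longrightarrow> f t = g t) \<Longrightarrow> P g"
    and base: "\<And>A c. A \<in> sets M \<Longrightarrow> emeasure M A < \<infinity> \<Longrightarrow> P (\<lambda>t. indicat_real A t *\<^sub>R c)"
    and add: "\<And>f g. strongly_integrable M f \<Longrightarrow> strongly_integrable M g \<Longrightarrow> P f \<Longrightarrow> P g \<Longrightarrow> P (\<lambda>t. f t + g t)"
    and lim: "\<And>f s. strongly_integrable M f \<Longrightarrow> (\<And>i. strongly_integrable M (s i)) \<Longrightarrow> (\<And>i. P (s i)) \<Longrightarrow>
      (\<lambda>i. \<integral>t. norm (f t - s i t) \<partial>M) \<longlonglongrightarrow> 0 \<Longrightarrow> P f"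
  shows "P f"
proof -
  have simple: "P s" if s: "simple_bochner_integrable M s" for s
  proof -
    have sf: "simple_function M s" and fin: "emeasure M {y \<in> space M. s y \<noteq> 0} \<noteq> \<infinity>"
      using s by (auto simp: Bochner_Integration.simple_bochner_integrable.simps)
    define A where "A y = {x \<in> space M. s x = y}" for y
    have A: "A y \<in> sets M" for y
      using simple_functionD(2)[OF sf, of "{y}"] by (simp add: A_def vimage_def Int_def conj_commute)
    have fA: "emeasure M (A y) < \<infinity>" if "y \<noteq> 0" for y
    proof -
      have "emeasure M (A y) \<le> emeasure M {y \<in> space M. s y \<noteq> 0}"
      proof (rule emeasure_mono)
        have "{y \<in> space M. s y \<noteq> 0} = space M - A 0" by (auto simp: A_def)
        then show "{y \<in> space M. s y \<noteq> 0} \<in> sets M" using A by auto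
      qed (use that in \<open>auto simp: A_def\<close>)
      also have "\<dots> < \<infinity>" using fin by (simp add: less_top[symmetric])
      finally show ?thesis .
    qed
    \<comment> \<open>Finite measure is guaranteed only for level sets of nonzero values, hence
      \<open>0 \<notin> Y\<close>. The sum reproduces \<open>s\<close> on \<open>space M\<close>,
      which is all that \<open>cong\<close> asks for.\<close>
    have "P (\<lambda>t. \<Sum>y\<in>Y. indicat_real (A y) t *\<^sub>R y) \<and> strongly_integrable M (\<lambda>t. \<Sum>y\<in>Y. indicat_real (A y) t *\<^sub>R y)"
      if "finite Y" "0 \<notin> Y" for Y
      using that
    proof (induction Y rule: finite_induct)
      case empty
      have "P (\<lambda>t. indicat_real {} t *\<^sub>R 0)" by (rule base) auto
      then show ?case by (simp add: strongly_integrable_def)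
    next
      case (insert y Y)
      have "strongly_integrable M (\<lambda>t. indicat_real (A y) t *\<^sub>R y)"
        using insert.prems A fA[of y] by (intro strongly_integrable_scaleR_const) auto
      moreover have "P (\<lambda>t. indicat_real (A y) t *\<^sub>R y)"
        using insert.prems by (intro base A fA) auto
      ultimately show ?case
        unfolding sum.insert[OF insert.hyps] using insert.prems insert.IH
        by (intro conjI add strongly_integrable_add) auto
    qed
    then have "P (\<lambda>t. \<Sum>y\<in>s ` space M - {0}. indicat_real (A y) t *\<^sub>R y)"
      using simple_functionD(1)[OF sf] by blast
    then show "P s"
    proof (rule cong)
      fix t assume t: "t \<in> space M"
      have "(\<Sum>y\<in>s ` space M - {0}. indicat_real (A y) t *\<^sub>R y) = (\<Sum>y\<in>s ` space M - {0}. if y = s t then y else 0)"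
        using t by (intro sum.cong) (auto simp: A_def)
      then show "(\<Sum>y\<in>s ` space M - {0}. indicat_real (A y) t *\<^sub>R y) = s t"
        using t simple_functionD(1)[OF sf] by (auto simp: image_iff)
    qed
  qed
  obtain s where "\<And>i. simple_bochner_integrable M (s i)" "(\<lambda>i. \<integral>t. norm (f t - s i t) \<partial>M) \<longlonglongrightarrow> 0"
    using strongly_integrable_approx[OF f] by blast
  then show "P f"
    using f simple strongly_integrable_simple by (intro lim[of f s]) auto
qed


section \<open>Smooth bumps\<close>

text \<open>The functions \<open>poly P (1 / x) * exp (- c / x)\<close>, extended by \<open>0\<close> to \<open>x \<le> 0\<close>, are closed under
  differentiation.\<close>

definition flat :: "real \<Rightarrow> real poly \<Rightarrow> real \<Rightarrow> real" where
  "flat c P x = (if x > 0 then poly P (1 / x) * exp (- c / x) else 0)"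

text \<open>The chain rule for \<open>y = 1 / x\<close>: the \<open>y\<close>-derivative of
  \<open>poly P y * exp (- c * y)\<close> is multiplied by \<open>- y^2\<close>, and
  \<open>[:0, 0, 1:]\<close> is the polynomial \<open>y^2\<close>.\<close>

definition flat_deriv :: "real \<Rightarrow> real poly \<Rightarrow> real poly" where
  "flat_deriv c P = [:0, 0, 1:] * (smult c P - pderiv P)"

lemma flat_minus: "flat c (- P) x = - flat c P x"
  by (simp add: flat_def)

lemma tendsto_poly_mult_exp_neg:
  fixes c :: real
  assumes "c > 0"
  shows "((\<lambda>y. poly P y * exp (- c * y)) \<longlongrightarrow> 0) at_top"
proof -
  have mono: "((\<lambda>y. y ^ n * exp (- c * y)) \<longlongrightarrow> 0) at_top" for n
  proof -
    have "((\<lambda>y. (c * y) ^ n / exp (c * y)) \<longlongrightarrow> 0) at_top"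
      using assms by (intro filterlim_compose[OF tendsto_power_div_exp_0]
          filterlim_tendsto_pos_mult_at_top[OF tendsto_const] filterlim_ident) auto
    from tendsto_mult_right[OF this, of "1 / c ^ n"] show ?thesis
      using assms by (simp add: power_mult_distrib exp_minus field_simps)
  qed
  have "((\<lambda>y. \<Sum>i\<le>degree P. coeff P i * (y ^ i * exp (- c * y))) \<longlongrightarrow> (\<Sum>i\<le>degree P. coeff P i * 0)) at_top"
    by (intro tendsto_sum tendsto_mult_left mono)
  then show ?thesis
    by (simp add: poly_altdef sum_distrib_right mult.assoc)
qed

lemma has_real_derivative_flat:
  assumes c: "c > 0"
  shows "(flat c P has_real_derivative flat c (flat_deriv c P) x) (at x)"
proof -
  consider "x > 0" | "x < 0" | "x = 0" by linarith
  then show ?thesis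
  proof cases
    case 1
    have "((\<lambda>x. poly P (1 / x) * exp (- c / x)) has_real_derivative flat c (flat_deriv c P) x) (at x)"
      using 1 by (auto intro!: derivative_eq_intros DERIV_chain2[OF poly_DERIV]
          simp: flat_def flat_deriv_def field_simps power2_eq_square)
    then show ?thesis
      by (rule has_field_derivative_transform_within_open[where S="{0<..}"]) (use 1 in \<open>auto simp: flat_def\<close>)
  next
    case 2
    have "((\<lambda>x. 0) has_real_derivative flat c (flat_deriv c P) x) (at x)"
      using 2 by (simp add: flat_def)
    then show ?thesis
      by (rule has_field_derivative_transform_within_open[where S="{..<0}"]) (use 2 in \<open>auto simp: flat_def\<close>)
  next
    case 3
    \<comment> \<open>For \<open>h > 0\<close> and \<open>y = 1 / h\<close> the difference quotient
      at \<open>0\<close> is \<open>y * poly P y * exp (- c * y)\<close>, and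
      \<open>pCons 0 P\<close> is the polynomial \<open>y * P\<close>. From the left the quotient is
      zero.\<close>
    have "((\<lambda>h. poly (pCons 0 P) (inverse h) * exp (- c * inverse h)) \<longlongrightarrow> 0) (at_right 0)"
      by (rule filterlim_compose[OF tendsto_poly_mult_exp_neg[OF c] filterlim_inverse_at_top_right])
    then have "((\<lambda>h. flat c P h / h) \<longlongrightarrow> 0) (at_right 0)"
      by (rule Lim_transform_eventually)
         (auto simp: eventually_at_filter flat_def field_simps)
    moreover have "((\<lambda>h. flat c P h / h) \<longlongrightarrow> 0) (at_left 0)"
      by (rule Lim_transform_eventually[OF tendsto_const])
         (auto simp: eventually_at_filter flat_def)
    ultimately have "((\<lambda>h. flat c P h / h) \<longlongrightarrow> 0) (at 0)"
      by (intro filterlim_split_at)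
    then show ?thesis
      using 3 by (simp add: has_field_derivative_iff flat_def)
  qed
qed

text \<open>Smoothness follows from closure under differentiation: the product rule turns a
  generator into a sum of two generators. The factor \<open>r\<close> in \<open>add\<close> makes it
  possible to correct a bump to mean zero by a multiple of another one.\<close>

inductive_set smooth_bumps :: "(real \<Rightarrow> real) set" where
  flat: "c > 0 \<Longrightarrow> (\<lambda>x. flat c P (x - a) * flat c Q (b - x)) \<in> smooth_bumps"
| add: "f \<in> smooth_bumps \<Longrightarrow> g \<in> smooth_bumps \<Longrightarrow> (\<lambda>x. f x + r * g x) \<in> smooth_bumps"

lemma smooth_bumps_deriv:
  assumes "f \<in> smooth_bumps"
  shows "\<exists>f'\<in>smooth_bumps. \<forall>x. (f has_real_derivative f' x) (at x)"
  using assms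
proof induction
  case (flat c P a Q b)
  define f' where "f' x = flat c (flat_deriv c P) (x - a) * flat c Q (b - x)
      + 1 * (flat c P (x - a) * flat c (- flat_deriv c Q) (b - x))" for x
  have "f' \<in> smooth_bumps"
    unfolding f'_def[abs_def] by (intro smooth_bumps.intros flat)
  moreover have "((\<lambda>x. flat c P (x - a) * flat c Q (b - x)) has_real_derivative f' x) (at x)" for x
    unfolding f'_def flat_minus
    by (auto intro!: derivative_eq_intros DERIV_chain2[OF has_real_derivative_flat[OF flat]])
  ultimately show ?case by blast
next
  case (add f g r)
  then obtain f' g' where "f' \<in> smooth_bumps" "\<And>x. (f has_real_derivative f' x) (at x)"
    "g' \<in> smooth_bumps" "\<And>x. (g has_real_derivative g' x) (at x)" by blast
  then show ?case
    by (intro bexI[of _ "\<lambda>x. f' x + r * g' x"] smooth_bumps.add)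
       (auto intro!: derivative_eq_intros)
qed

lemma smooth_bumps_differentiable:
  assumes "f \<in> smooth_bumps"
  shows "(deriv ^^ k) f \<in> smooth_bumps" "(deriv ^^ k) f differentiable (at x)"
proof -
  show *: "(deriv ^^ k) f \<in> smooth_bumps" for k
  proof (induction k)
    case (Suc k)
    then obtain f' where "f' \<in> smooth_bumps" "\<And>x. ((deriv ^^ k) f has_real_derivative f' x) (at x)"
      using smooth_bumps_deriv by blast
    moreover from this have "deriv ((deriv ^^ k) f) = f'"
      by (intro ext DERIV_imp_deriv)
    ultimately show ?case by simp
  qed (use assms in simp)
  show "(deriv ^^ k) f differentiable (at x)"
    using smooth_bumps_deriv[OF *] real_differentiable_def by blast
qed

lemma smooth_bumps_continuous: "f \<in> smooth_bumps \<Longrightarrow> continuous_on S f"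
  using smooth_bumps_deriv by (meson DERIV_continuous_on DERIV_subset top_greatest)

section \<open>Primitives of smooth bumps, and bumps that approximate intervals\<close>

lemma integrable_lebesgue_on_subset:
  fixes f :: "'a::euclidean_space \<Rightarrow> 'b::{banach, second_countable_topology}"
  assumes "integrable (lebesgue_on S) f" "S \<in> sets lebesgue" "A \<in> sets lebesgue" "A \<subseteq> S"
  shows "integrable (lebesgue_on A) f"
  using set_integrable_subset[of lebesgue S f A] assms
  by (simp add: integrable_restrict_space set_integrable_def)

lemma integral_lebesgue_on_FTC:
  fixes f F :: "real \<Rightarrow> real"
  assumes "a \<le> b" and F: "\<And>x. (F has_real_derivative f x) (at x)" and f: "continuous_on UNIV f"
  shows "integrable (lebesgue_on {a<..<b}) f" "(\<integral>x. f x \<partial>lebesgue_on {a<..<b}) = F b - F a"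
proof -
  have "integrable (lebesgue_on {a..b}) f"
    using continuous_imp_integrable_real[of a b f] f continuous_on_subset by blast
  then show int: "integrable (lebesgue_on {a<..<b}) f"
    by (rule integrable_lebesgue_on_subset) auto
  have "(f has_integral F b - F a) {a..b}"
    using F by (intro fundamental_theorem_of_calculus \<open>a \<le> b\<close>)
      (auto simp: has_real_derivative_iff_has_vector_derivative[symmetric] intro: DERIV_subset)
  then have "integral {a<..<b} f = F b - F a"
    using integral_open_interval_real[of a b f] by (simp add: integral_unique)
  then show "(\<integral>x. f x \<partial>lebesgue_on {a<..<b}) = F b - F a"
    using lebesgue_integral_eq_integral[OF int] by simp
qed

text \<open>Mean zero is what lets one primitive vanish on both sides of the support of
  \<open>\<psi>\<close>. It is smooth because its derivative lies in
  \<open>smooth_bumps\<close>.\<close>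

lemma smooth_bump_primitive:
  assumes \<psi>: "\<psi> \<in> smooth_bumps" and "0 < a" "b < T" and zero: "\<And>x. x \<notin> {a..b} \<Longrightarrow> \<psi> x = 0"
    and "0 < T" and int: "(\<integral>x. \<psi> x \<partial>lebesgue_on {0<..<T}) = 0"
  obtains \<phi> where "\<phi> \<in> test_functions T" "\<And>x. (\<phi> has_real_derivative \<psi> x) (at x)" "\<phi> T = 0"
proof -
  have cont: "continuous_on UNIV \<psi>"
    using \<psi> by (rule smooth_bumps_continuous)
  then have "\<exists>F. \<forall>x::real. -\<infinity> < ereal x \<longrightarrow> ereal x < \<infinity> \<longrightarrow> (F has_vector_derivative \<psi> x) (at x)"
    by (intro einterval_antiderivative) (auto simp: continuous_on_eq_continuous_at)
  then obtain F where F: "\<And>x. (F has_real_derivative \<psi> x) (at x)"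
    by (auto simp: has_real_derivative_iff_has_vector_derivative)
  define \<phi> where "\<phi> x = F x - F 0" for x
  have \<phi>: "(\<phi> has_real_derivative \<psi> x) (at x)" for x
    unfolding \<phi>_def by (auto intro!: derivative_eq_intros F)
  have "F T - F 0 = 0"
    using integral_lebesgue_on_FTC(2)[OF _ F cont, of 0 T] \<open>0 < T\<close> int by simp
  then have ends: "\<phi> 0 = 0" "\<phi> T = 0"
    by (auto simp: \<phi>_def)
  have \<phi>0: "\<phi> x = 0" if "x \<notin> {a..b}" for x
  proof -
    \<comment> \<open>\<open>\<phi>\<close> is constant on each half-line outside
      \<open>{a..b}\<close>; the left one contains \<open>0\<close>, the right one \<open>T\<close>,
      and \<open>\<phi>\<close> vanishes at both points.\<close>
    have const: "\<phi> y = \<phi> z" if "convex S" "S \<inter> {a..b} = {}" "y \<in> S" "z \<in> S" for S y z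
    proof (rule has_field_derivative_zero_constant[OF that(1), of \<phi>, THEN exE])
      show "(\<phi> has_field_derivative 0) (at x within S)" if "x \<in> S" for x
      proof -
        have "\<psi> x = 0" using zero \<open>S \<inter> {a..b} = {}\<close> that by blast
        then show ?thesis using \<phi>[of x] by (simp add: has_field_derivative_at_within)
      qed
    qed (use that in auto)
    from \<open>x \<notin> {a..b}\<close> consider "x < a" | "x > b" by fastforce
    then show ?thesis
    proof cases
      case 1
      have "{..<a} \<inter> {a..b} = {}" by auto
      from const[OF _ this, of x 0] show ?thesis using 1 ends \<open>0 < a\<close> by simp
    next
      case 2
      have "{b<..} \<inter> {a..b} = {}" by auto
      from const[OF _ this, of x T] show ?thesis using 2 ends \<open>b < T\<close> by simp
    qed
  qed
  have sub: "closure {x. \<phi> x \<noteq> 0} \<subseteq> {a..b}"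
  proof (rule closure_minimal)
    show "{x. \<phi> x \<noteq> 0} \<subseteq> {a..b}" using \<phi>0 by blast
  qed simp
  have "(deriv ^^ k) \<phi> differentiable (at x)" for k x
  proof (cases k)
    case 0
    then show ?thesis using \<phi> real_differentiable_def by auto
  next
    case (Suc m)
    have "deriv \<phi> = \<psi>" by (intro ext DERIV_imp_deriv \<phi>)
    then show ?thesis
      using smooth_bumps_differentiable(2)[OF \<psi>] by (simp add: Suc funpow_Suc_right del: funpow.simps)
  qed
  moreover have "compact (closure {x. \<phi> x \<noteq> 0})"
    using compact_Int_closed[OF compact_Icc[of a b] closed_closure[of "{x. \<phi> x \<noteq> 0}"]] sub
    by (simp add: Int_absorb1)
  moreover have "closure {x. \<phi> x \<noteq> 0} \<subseteq> {0<..<T}"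
    using sub \<open>0 < a\<close> \<open>b < T\<close> by fastforce
  ultimately have "\<phi> \<in> test_functions T"
    unfolding test_functions_def by blast
  then show ?thesis
    using that \<phi> ends by blast
qed

text \<open>The inset \<open>1 / real (Suc n)\<close> keeps the support compactly inside
  \<open>(0,T)\<close> even for \<open>a = 0\<close> and \<open>b = T\<close>; the same null
  sequence as exponent constant lets both factors tend to \<open>1\<close> inside the
  interval.\<close>

definition interval_bump :: "real \<Rightarrow> real \<Rightarrow> nat \<Rightarrow> real \<Rightarrow> real" where
  "interval_bump a b n x = flat (1 / real (Suc n)) 1 (x - (a + 1 / real (Suc n))) *
     flat (1 / real (Suc n)) 1 ((b - 1 / real (Suc n)) - x)"

lemma interval_bump_smooth: "interval_bump a b n \<in> smooth_bumps"
  unfolding interval_bump_def[abs_def] by (rule smooth_bumps.flat) simp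

lemma interval_bump_bounds: "0 \<le> interval_bump a b n x" "interval_bump a b n x \<le> 1"
proof -
  have *: "0 \<le> flat (1 / real (Suc n)) 1 x" "flat (1 / real (Suc n)) 1 x \<le> 1" for x
    by (auto simp: flat_def)
  show "0 \<le> interval_bump a b n x" "interval_bump a b n x \<le> 1"
    unfolding interval_bump_def by (intro mult_nonneg_nonneg mult_le_one *)+
qed

lemma interval_bump_eq_0:
  "x \<notin> {a + 1 / real (Suc n)..b - 1 / real (Suc n)} \<Longrightarrow> interval_bump a b n x = 0"
  by (auto simp: interval_bump_def flat_def)

lemma interval_bump_tendsto: "(\<lambda>n. interval_bump a b n x) \<longlonglongrightarrow> indicator {a<..<b} x"
proof (cases "x \<in> {a<..<b}")
  case False
  have "interval_bump a b n x = 0" for n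
  proof (rule interval_bump_eq_0)
    have "0 < 1 / real (Suc n)" by simp
    then show "x \<notin> {a + 1 / real (Suc n)..b - 1 / real (Suc n)}"
      using False unfolding greaterThanLessThan_iff atLeastAtMost_iff by linarith
  qed
  then show ?thesis using False by simp
next
  case True
  have inv: "(\<lambda>n. 1 / real (Suc n)) \<longlonglongrightarrow> 0"
    using LIMSEQ_inverse_real_of_nat by (simp add: inverse_eq_divide)
  have *: "(\<lambda>n. flat (1 / real (Suc n)) 1 (y - 1 / real (Suc n))) \<longlonglongrightarrow> 1" if "y > 0" for y
  proof -
    have "(\<lambda>n. exp (- (1 / real (Suc n)) / (y - 1 / real (Suc n)))) \<longlonglongrightarrow> exp (- 0 / (y - 0))"
      using that by (intro tendsto_intros inv) auto
    then have "(\<lambda>n. exp (- (1 / real (Suc n)) / (y - 1 / real (Suc n)))) \<longlonglongrightarrow> 1" by simp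
    moreover have "eventually (\<lambda>n. 1 / real (Suc n) < y) sequentially"
      using inv that by (rule order_tendstoD)
    then have "eventually (\<lambda>n. exp (- (1 / real (Suc n)) / (y - 1 / real (Suc n)))
        = flat (1 / real (Suc n)) 1 (y - 1 / real (Suc n))) sequentially"
      by eventually_elim (simp add: flat_def)
    ultimately show ?thesis by (rule Lim_transform_eventually)
  qed
  show ?thesis
    using tendsto_mult[OF *[of "x - a"] *[of "b - x"]] True
    by (simp add: interval_bump_def algebra_simps)
qed


section \<open>The du Bois-Reymond lemma\<close>

text \<open>Dominated convergence with majorant \<open>2 * B * norm (f x)\<close>. It serves for
  bumps tending to indicators, for countable unions of sets and for moving endpoints of
  antiderivatives.\<close>

lemma (in complete_measure) strong_integral_bounded_convergence:
  fixes f :: "'a \<Rightarrow> 'b::banach" and w :: "'a \<Rightarrow> real"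
  assumes f: "strongly_integrable M f"
    and F: "\<And>i. F i \<in> borel_measurable M" "\<And>i x. x \<in> space M \<Longrightarrow> \<bar>F i x\<bar> \<le> B"
    and w: "w \<in> borel_measurable M" "\<And>x. x \<in> space M \<Longrightarrow> \<bar>w x\<bar> \<le> B"
    and lim: "AE x in M. (\<lambda>i. F i x) \<longlonglongrightarrow> w x"
  shows "(\<lambda>i. strong_integral M (\<lambda>x. F i x *\<^sub>R f x)) \<longlonglongrightarrow> strong_integral M (\<lambda>x. w x *\<^sub>R f x)"
proof (rule strong_integral_LIMSEQ)
  show "strongly_integrable M (\<lambda>x. w x *\<^sub>R f x)" "strongly_integrable M (\<lambda>x. F i x *\<^sub>R f x)" for i
    by (rule strongly_integrable_scaleR[where B=B]; fact)+
  have nf: "integrable M (\<lambda>x. norm (f x))" using f by (simp add: strongly_integrable_def)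
  have "(\<lambda>i. \<integral>x. \<bar>w x - F i x\<bar> * norm (f x) \<partial>M) \<longlonglongrightarrow> (\<integral>x. 0 \<partial>M)"
  proof (rule integral_dominated_convergence)
    show "(\<lambda>x. \<bar>w x - F i x\<bar> * norm (f x)) \<in> borel_measurable M" for i
      using w(1) F(1)[of i] nf by measurable
    show "integrable M (\<lambda>x. 2 * B * norm (f x))" using nf by simp
    show "AE x in M. (\<lambda>i. \<bar>w x - F i x\<bar> * norm (f x)) \<longlonglongrightarrow> 0"
      using lim
    proof eventually_elim
      fix x assume "(\<lambda>i. F i x) \<longlonglongrightarrow> w x"
      from tendsto_mult_right[OF tendsto_rabs[OF tendsto_diff[OF tendsto_const[of "w x"] this]], of "norm (f x)"]
      show "(\<lambda>i. \<bar>w x - F i x\<bar> * norm (f x)) \<longlonglongrightarrow> 0" by simp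
    qed
    show "AE x in M. norm (\<bar>w x - F i x\<bar> * norm (f x)) \<le> 2 * B * norm (f x)" for i
    proof (rule AE_I2)
      fix x assume "x \<in> space M"
      then have "\<bar>w x - F i x\<bar> \<le> 2 * B" using F(2)[of x i] w(2)[of x] by linarith
      then show "norm (\<bar>w x - F i x\<bar> * norm (f x)) \<le> 2 * B * norm (f x)"
        by (simp add: abs_mult mult_right_mono)
    qed
  qed simp
  then show "(\<lambda>i. \<integral>x. norm (w x *\<^sub>R f x - F i x *\<^sub>R f x) \<partial>M) \<longlonglongrightarrow> 0"
    by (simp flip: scaleR_left_diff_distrib)
qed

text \<open>For a simple function \<open>s\<close> the norm of the integral over a level set equals the integral of
  the norm, so \<open>\<integral> norm s\<close> is at most the \<open>L\<^sup>1\<close> distance from \<open>s\<close> to \<open>f\<close>.\<close>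

lemma strong_integral_zero_imp_AE_zero:
  fixes f :: "'s \<Rightarrow> 'b::banach"
  assumes "complete_measure M" "finite_measure M" and f: "strongly_integrable M f"
    and zero: "\<And>A. A \<in> sets M \<Longrightarrow> strong_integral M (\<lambda>x. indicat_real A x *\<^sub>R f x) = 0"
  shows "AE x in M. f x = 0"
proof -
  interpret complete_measure M by fact
  interpret finite_measure M by fact
  have nf: "integrable M (\<lambda>x. norm (f x))" using f by (simp add: strongly_integrable_def)
  obtain s where s: "\<And>i. simple_bochner_integrable M (s i)" "(\<lambda>i. \<integral>x. norm (f x - s i x) \<partial>M) \<longlonglongrightarrow> 0"
    using strongly_integrable_approx[OF f] by blast
  \<comment> \<open>The distance from \<open>f\<close> to \<open>s i\<close> counts twice: once in
    the triangle inequality, once as the bound for the integral of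
    \<open>norm (s i x)\<close>.\<close>
  have "(\<integral>x. norm (f x) \<partial>M) \<le> 2 * (\<integral>x. norm (f x - s i x) \<partial>M)" for i
  proof -
    have si: "strongly_integrable M (s i)" using s(1) by (rule strongly_integrable_simple)
    then have ns: "integrable M (\<lambda>x. norm (s i x))" by (simp add: strongly_integrable_def)
    have sf: "simple_function M (s i)"
      using s(1) by (auto simp: Bochner_Integration.simple_bochner_integrable.simps)
    note nfs = integrable_norm_diff[OF f si]
    define Y where "Y = s i ` space M"
    have fin: "finite Y" using simple_functionD(1)[OF sf] by (simp add: Y_def)
    define A where "A y = {x \<in> space M. s i x = y}" for y
    have A: "A y \<in> sets M" for y
      using simple_functionD(2)[OF sf, of "{y}"] by (simp add: A_def vimage_def Int_def conj_commute)
    have split: "(\<integral>x. h x \<partial>M) = (\<Sum>y\<in>Y. \<integral>x. indicator (A y) x * h x \<partial>M)"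
      if h: "integrable M h" for h :: "'s \<Rightarrow> real"
    proof -
      have "(\<Sum>y\<in>Y. \<integral>x. indicator (A y) x * h x \<partial>M) = (\<integral>x. (\<Sum>y\<in>Y. indicator (A y) x * h x) \<partial>M)"
        using h A integrable_mult_indicator[OF A h]
        by (intro Bochner_Integration.integral_sum[symmetric]) simp
      also have "\<dots> = (\<integral>x. h x \<partial>M)"
      proof (rule Bochner_Integration.integral_cong[OF refl])
        fix x assume x: "x \<in> space M"
        have "(\<Sum>y\<in>Y. indicator (A y) x * h x) = (\<Sum>y\<in>Y. if s i x = y then h x else 0)"
          using x by (intro sum.cong) (auto simp: A_def)
        also have "\<dots> = h x" using x fin by (simp add: Y_def)
        finally show "(\<Sum>y\<in>Y. indicator (A y) x * h x) = h x" .
      qed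
      finally show ?thesis by simp
    qed
    have le: "(\<integral>x. indicator (A y) x * norm (s i x) \<partial>M) \<le> (\<integral>x. indicator (A y) x * norm (f x - s i x) \<partial>M)" for y
    proof -
      have intA: "strongly_integrable M (\<lambda>x. indicat_real (A y) x *\<^sub>R h x)"
        if "strongly_integrable M h" for h :: "'s \<Rightarrow> 'b"
        using A that by (intro strongly_integrable_scaleR[where B=1]) (auto simp: indicator_def)
      have hA: "integrable M (indicat_real (A y))"
        using A by (simp add: integrable_indicator_iff emeasure_eq_measure sets.Int_space_eq2)
      have "(\<lambda>x. indicator (A y) x * norm (s i x)) = (\<lambda>x. indicator (A y) x * norm y)"
        by (auto simp: A_def indicator_def)
      then have "(\<integral>x. indicator (A y) x * norm (s i x) \<partial>M) = (\<integral>x. indicator (A y) x \<partial>M) * norm y"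
        by simp
      also have "\<dots> = norm ((\<integral>x. indicat_real (A y) x \<partial>M) *\<^sub>R y)"
        by simp
      also have "(\<integral>x. indicat_real (A y) x \<partial>M) *\<^sub>R y = strong_integral M (\<lambda>x. indicat_real (A y) x *\<^sub>R y)"
        using strong_integral_scaleR_const[OF hA, of y] by simp
      also have "(\<lambda>x. indicat_real (A y) x *\<^sub>R y) = (\<lambda>x. indicat_real (A y) x *\<^sub>R s i x)"
        by (auto simp: A_def indicator_def)
      also have "norm (strong_integral M (\<lambda>x. indicat_real (A y) x *\<^sub>R s i x))
          = norm (strong_integral M (\<lambda>x. indicat_real (A y) x *\<^sub>R f x) - strong_integral M (\<lambda>x. indicat_real (A y) x *\<^sub>R s i x))"
        using zero[OF A] by simp
      also have "\<dots> \<le> (\<integral>x. norm (indicat_real (A y) x *\<^sub>R f x - indicat_real (A y) x *\<^sub>R s i x) \<partial>M)"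
        by (intro norm_strong_integral_diff_le intA f si)
      also have "\<dots> = (\<integral>x. indicator (A y) x * norm (f x - s i x) \<partial>M)"
        by (simp flip: scaleR_right_diff_distrib)
      finally show ?thesis .
    qed
    have "(\<integral>x. norm (f x) \<partial>M) \<le> (\<integral>x. norm (f x - s i x) + norm (s i x) \<partial>M)"
      using nf nfs ns by (intro integral_mono) (auto intro: order_trans[OF _ norm_triangle_ineq])
    also have "\<dots> = (\<integral>x. norm (f x - s i x) \<partial>M) + (\<integral>x. norm (s i x) \<partial>M)"
      using nfs ns by simp
    also have "(\<integral>x. norm (s i x) \<partial>M) \<le> (\<integral>x. norm (f x - s i x) \<partial>M)"
      unfolding split[OF ns] split[OF nfs] by (intro sum_mono le)
    finally show ?thesis by simp
  qed
  then have "(\<integral>x. norm (f x) \<partial>M) \<le> 2 * 0"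
    by (intro LIMSEQ_le_const[OF tendsto_mult_left[OF s(2)]]) auto
  then have "(\<integral>x. norm (f x) \<partial>M) = 0"
    by (simp add: antisym integral_nonneg)
  then show ?thesis
    using integral_nonneg_eq_0_iff_AE[OF nf] by simp
qed

lemma complete_measure_interval: "complete_measure (lebesgue_on {a<..<b::real})"
  by (rule complete_measure_lebesgue_on) auto

lemma finite_measure_interval: "finite_measure (lebesgue_on {a<..<b::real})"
proof
  have "emeasure lebesgue {a<..<b} \<noteq> \<infinity>"
    by (cases "a \<le> b") auto
  then show "emeasure (lebesgue_on {a<..<b}) (space (lebesgue_on {a<..<b})) \<noteq> \<infinity>"
    by (simp add: emeasure_restrict_space)
qed

lemma borel_measurable_lebesgue_onI:
  "f \<in> borel_measurable borel \<Longrightarrow> f \<in> borel_measurable (lebesgue_on S)"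
  by (simp add: measurable_completion measurable_restrict_space1)

lemma smooth_bumps_measurable: "\<psi> \<in> smooth_bumps \<Longrightarrow> \<psi> \<in> borel_measurable (lebesgue_on S)"
  by (intro borel_measurable_lebesgue_onI borel_measurable_continuous_onI smooth_bumps_continuous)

lemma smooth_bumps_bounded:
  assumes "\<psi> \<in> smooth_bumps"
  obtains B where "\<And>x. x \<in> {a<..<b} \<Longrightarrow> \<bar>\<psi> x\<bar> \<le> B"
proof -
  have "compact (\<psi> ` {a..b})"
    using smooth_bumps_continuous[OF assms] by (intro compact_continuous_image) auto
  then obtain B where "\<forall>y\<in>\<psi> ` {a..b}. norm y \<le> B"
    using compact_imp_bounded bounded_iff by blast
  then show ?thesis by (intro that[of B]) auto
qed

lemma integral_interval_bump_tendsto: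
  assumes "0 \<le> a" "b \<le> T"
  shows "(\<lambda>n. \<integral>x. interval_bump a b n x \<partial>lebesgue_on {0<..<T})
    \<longlonglongrightarrow> (\<integral>x. indicator {a<..<b} x \<partial>lebesgue_on {0<..<T})"
proof (rule integral_dominated_convergence[where w="\<lambda>_. 1"])
  interpret finite_measure "lebesgue_on {0<..<T}" by (rule finite_measure_interval)
  show "integrable (lebesgue_on {0<..<T}) (\<lambda>x. 1::real)" by simp
  show "indicat_real {a<..<b} \<in> borel_measurable (lebesgue_on {0<..<T})"
    by (intro borel_measurable_lebesgue_onI) auto
qed (use interval_bump_bounds in \<open>auto intro!: interval_bump_tendsto smooth_bumps_measurable interval_bump_smooth\<close>)

text \<open>A bump supported compactly in \<open>(0,T)\<close> differs from a multiple of one fixed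
  bump \<open>\<eta>\<close> by the derivative of a test function, so its integral against
  \<open>w\<close> depends only on its mass. This passes from bumps to intervals, Borel sets and
  Lebesgue sets.\<close>

lemma weak_derivative_zero_imp_const:
  fixes w :: "real \<Rightarrow> 'a::banach"
  defines "M \<equiv> \<lambda>T. lebesgue_on {0<..<T}"
  assumes T: "0 < T" and w: "strongly_integrable (M T) w"
    and zero: "\<And>\<phi>. \<phi> \<in> test_functions T \<Longrightarrow> strong_integral (M T) (\<lambda>t. deriv \<phi> t *\<^sub>R w t) = 0"
  shows "\<exists>c. AE t in M T. w t = c"
proof -
  let ?M = "M T"
  interpret complete_measure ?M unfolding M_def by (rule complete_measure_interval)
  interpret finite_measure ?M unfolding M_def by (rule finite_measure_interval)
  have space: "space ?M = {0<..<T}" by (simp add: M_def)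
  have bump_int: "integrable ?M \<psi>" if \<psi>: "\<psi> \<in> smooth_bumps" for \<psi>
  proof -
    obtain B where "\<And>x. x \<in> {0<..<T} \<Longrightarrow> \<bar>\<psi> x\<bar> \<le> B" using smooth_bumps_bounded[OF \<psi>] by blast
    then show ?thesis
      using smooth_bumps_measurable[OF \<psi>] unfolding M_def
      by (intro finite_measure.integrable_const_bound[OF finite_measure_interval, where B=B]) (auto intro!: AE_I2)
  qed
  have bump_w: "strongly_integrable ?M (\<lambda>t. \<psi> t *\<^sub>R w t)" if \<psi>: "\<psi> \<in> smooth_bumps" for \<psi>
  proof -
    obtain B where "\<And>x. x \<in> {0<..<T} \<Longrightarrow> \<bar>\<psi> x\<bar> \<le> B" using smooth_bumps_bounded[OF \<psi>] by blast
    then show ?thesis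
      using smooth_bumps_measurable[OF \<psi>] w by (intro strongly_integrable_scaleR[where B=B]) (auto simp: M_def)
  qed
  have "(\<integral>x. indicat_real {0<..<T} x \<partial>?M) = T"
    using T by (simp add: M_def measure_restrict_space)
  with integral_interval_bump_tendsto[of 0 T T]
  have "(\<lambda>n. \<integral>x. interval_bump 0 T n x \<partial>?M) \<longlonglongrightarrow> T" by (simp add: M_def)
  then have "eventually (\<lambda>n. (\<integral>x. interval_bump 0 T n x \<partial>?M) > 0) sequentially"
    using T by (rule order_tendstoD)
  then obtain m where m: "(\<integral>x. interval_bump 0 T m x \<partial>?M) > 0"
    by (auto simp: eventually_sequentially)
  define \<eta> where "\<eta> = interval_bump 0 T m"
  define I where "I = (\<integral>x. \<eta> x \<partial>?M)"
  have I: "I > 0" and \<eta>: "\<eta> \<in> smooth_bumps"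
    using m by (auto simp: I_def \<eta>_def interval_bump_smooth)
  \<comment> \<open>The mean of \<open>w\<close> with weight \<open>\<eta>\<close> is the only
    candidate: a constant function equals this mean.\<close>
  define c where "c = (1 / I) *\<^sub>R strong_integral ?M (\<lambda>t. \<eta> t *\<^sub>R w t)"
  have mean: "strong_integral ?M (\<lambda>t. \<psi> t *\<^sub>R w t) = (\<integral>t. \<psi> t \<partial>?M) *\<^sub>R c"
    if \<psi>: "\<psi> \<in> smooth_bumps" and ab: "0 < a" "b < T" and supp: "\<And>x. x \<notin> {a..b} \<Longrightarrow> \<psi> x = 0" for \<psi> a b
  proof -
    \<comment> \<open>\<open>r\<close> gives \<open>\<xi>\<close> mean zero; the support of
      \<open>\<xi>\<close> lies in the hull of the supports of \<open>\<psi>\<close> and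
      \<open>\<eta>\<close>.\<close>
    define r where "r = - (\<integral>t. \<psi> t \<partial>?M) / I"
    define \<xi> where "\<xi> x = \<psi> x + r * \<eta> x" for x
    have \<xi>: "\<xi> \<in> smooth_bumps" unfolding \<xi>_def[abs_def] using \<psi> \<eta> by (rule smooth_bumps.add)
    have "(\<integral>x. \<xi> x \<partial>?M) = 0"
      using I bump_int[OF \<psi>] bump_int[OF \<eta>] by (simp add: \<xi>_def r_def I_def)
    moreover have "\<xi> x = 0" if "x \<notin> {min a (1 / real (Suc m))..max b (T - 1 / real (Suc m))}" for x
    proof -
      have "x \<notin> {a..b}" "x \<notin> {0 + 1 / real (Suc m)..T - 1 / real (Suc m)}" using that by auto
      then show ?thesis using supp interval_bump_eq_0 by (simp add: \<xi>_def \<eta>_def)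
    qed
    moreover have "0 < min a (1 / real (Suc m))" "max b (T - 1 / real (Suc m)) < T"
      using ab by auto
    ultimately obtain \<phi> where "\<phi> \<in> test_functions T" "\<And>x. (\<phi> has_real_derivative \<xi> x) (at x)"
      using smooth_bump_primitive[OF \<xi> _ _ _ T, of "min a (1 / real (Suc m))" "max b (T - 1 / real (Suc m))"]
      unfolding M_def by metis
    moreover from this have "deriv \<phi> = \<xi>" by (intro ext DERIV_imp_deriv)
    ultimately have "0 = strong_integral ?M (\<lambda>t. \<xi> t *\<^sub>R w t)"
      using zero by metis
    also have "\<dots> = strong_integral ?M (\<lambda>t. \<psi> t *\<^sub>R w t + r *\<^sub>R (\<eta> t *\<^sub>R w t))"
      by (simp add: \<xi>_def scaleR_add_left)
    also have "\<dots> = strong_integral ?M (\<lambda>t. \<psi> t *\<^sub>R w t) + r *\<^sub>R strong_integral ?M (\<lambda>t. \<eta> t *\<^sub>R w t)"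
      using bump_w[OF \<psi>] bump_w[OF \<eta>]
      by (simp add: strong_integral_add strongly_integrable_bounded_linear[OF bounded_linear_scaleR_right]
          strong_integral_bounded_linear[OF bounded_linear_scaleR_right] del: scaleR_scaleR)
    also have "r *\<^sub>R strong_integral ?M (\<lambda>t. \<eta> t *\<^sub>R w t) = - (\<integral>t. \<psi> t \<partial>?M) *\<^sub>R c"
      by (simp add: r_def c_def)
    finally show ?thesis by (simp add: eq_neg_iff_add_eq_0)
  qed
  define v where "v t = w t - c" for t
  have const: "strongly_integrable ?M (\<lambda>t. h t *\<^sub>R c)" if "integrable ?M h" for h :: "real \<Rightarrow> real"
    using that by (rule strongly_integrable_scaleR_const)
  have "strongly_integrable ?M (\<lambda>t. 1 *\<^sub>R c)" by (rule const) simp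
  then have v: "strongly_integrable ?M v"
    unfolding v_def[abs_def] using w by (intro strongly_integrable_diff) auto
  have ind_meas: "indicat_real A \<in> borel_measurable ?M" if "A \<in> sets borel" for A
    unfolding M_def using that by (intro borel_measurable_lebesgue_onI) auto
  have ind_v: "strongly_integrable ?M (\<lambda>t. indicat_real A t *\<^sub>R v t)" if "A \<in> sets borel" for A
    by (rule strongly_integrable_scaleR[where B=1, OF ind_meas[OF that] _ v]) (auto simp: indicator_def)
  \<comment> \<open>The endpoints \<open>0\<close> and \<open>T\<close> are allowed because each
    bump is inset. Empty intervals are included and later supply the empty set.\<close>
  have Ioo: "strong_integral ?M (\<lambda>t. indicat_real {a<..<b} t *\<^sub>R v t) = 0" if ab: "0 \<le> a" "b \<le> T" for a b
  proof -
    have "(\<lambda>n. strong_integral ?M (\<lambda>t. interval_bump a b n t *\<^sub>R w t))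
        \<longlonglongrightarrow> strong_integral ?M (\<lambda>t. indicat_real {a<..<b} t *\<^sub>R w t)"
      using interval_bump_bounds
      by (intro strong_integral_bounded_convergence[where B=1] w ind_meas interval_bump_tendsto AE_I2)
         (auto simp: M_def indicator_def intro!: smooth_bumps_measurable interval_bump_smooth)
    moreover have "strong_integral ?M (\<lambda>t. interval_bump a b n t *\<^sub>R w t)
        = (\<integral>t. interval_bump a b n t \<partial>?M) *\<^sub>R c" for n
    proof (rule mean[OF interval_bump_smooth])
      show "0 < a + 1 / real (Suc n)" "b - 1 / real (Suc n) < T"
        using ab divide_pos_pos[of 1 "real (Suc n)"] by linarith+
    qed (rule interval_bump_eq_0)
    moreover have "(\<lambda>n. (\<integral>t. interval_bump a b n t \<partial>?M) *\<^sub>R c) \<longlonglongrightarrow> (\<integral>t. indicat_real {a<..<b} t \<partial>?M) *\<^sub>R c"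
      unfolding M_def by (intro tendsto_scaleR tendsto_const integral_interval_bump_tendsto ab)
    ultimately have "strong_integral ?M (\<lambda>t. indicat_real {a<..<b} t *\<^sub>R w t) = (\<integral>t. indicat_real {a<..<b} t \<partial>?M) *\<^sub>R c"
      using LIMSEQ_unique by fastforce
    moreover have "(\<lambda>t. indicat_real {a<..<b} t *\<^sub>R v t) = (\<lambda>t. indicat_real {a<..<b} t *\<^sub>R w t - indicat_real {a<..<b} t *\<^sub>R c)"
      by (simp add: v_def scaleR_right_diff_distrib)
    moreover have ii: "integrable ?M (indicat_real {a<..<b})"
      by (intro integrable_const_bound[where B=1] ind_meas) (auto simp: indicator_def)
    moreover have "strongly_integrable ?M (\<lambda>t. indicat_real {a<..<b} t *\<^sub>R w t)"
      by (rule strongly_integrable_scaleR[where B=1, OF ind_meas _ w]) (auto simp: indicator_def)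
    ultimately show ?thesis
      using const[OF ii] strong_integral_scaleR_const[OF ii, of c] by (simp add: strong_integral_diff)
  qed
  have total: "strong_integral ?M v = 0"
  proof -
    have "AE t in ?M. indicat_real {0<..<T} t *\<^sub>R v t = v t"
      by (intro AE_I2) (simp add: space)
    from strong_integral_cong_AE[OF ind_v this] show ?thesis using Ioo[of 0 T] by simp
  qed
  \<comment> \<open>Dynkin's argument: open intervals are stable under intersection and generate the
    Borel sets. \<open>total\<close> handles complements; additivity and bounded convergence handle
    countable disjoint unions.\<close>
  have borel: "strong_integral ?M (\<lambda>t. indicat_real A t *\<^sub>R v t) = 0" if "A \<in> sets borel" for A
  proof -
    let ?G = "range (\<lambda>(a, b). {a<..<b::real})"
    have sets_borel: "sets borel = sigma_sets UNIV ?G"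
      by (subst borel_eq_box) (simp add: case_prod_beta)
    have "Int_stable ?G"
      by (auto simp: Int_stable_def image_iff)
    moreover have "?G \<subseteq> Pow UNIV" by simp
    moreover have "A \<in> sigma_sets UNIV ?G"
      using that by (simp add: sets_borel)
    ultimately show ?thesis
    proof (induction rule: sigma_sets_induct_disjoint)
      case (basic A)
      then obtain a b where A: "A = {a<..<b}" by auto
      have "strong_integral ?M (\<lambda>t. indicat_real A t *\<^sub>R v t)
          = strong_integral ?M (\<lambda>t. indicat_real {max a 0<..<min b T} t *\<^sub>R v t)"
        by (intro strong_integral_cong_AE ind_v AE_I2) (auto simp: A indicator_def space)
      also have "\<dots> = 0" by (rule Ioo) auto
      finally show ?case .
    next
      case empty
      then show ?case using Ioo[of 0 0] T by simp
    next
      case (compl A)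
      then have A: "A \<in> sets borel"
        by (simp add: sets_borel)
      have "(\<lambda>t. indicat_real (UNIV - A) t *\<^sub>R v t) = (\<lambda>t. v t - indicat_real A t *\<^sub>R v t)"
        by (auto simp: indicator_def)
      then show ?case using compl total strong_integral_diff[OF v ind_v[OF A]] by simp
    next
      case (union A)
      then have A: "A i \<in> sets borel" for i
        by (auto simp: sets_borel)
      have fin: "strong_integral ?M (\<lambda>t. indicat_real (\<Union>i<n. A i) t *\<^sub>R v t) = 0" for n
      proof (induction n)
        case 0
        then show ?case using Ioo[of 0 0] T by simp
      next
        case (Suc n)
        have "A n \<inter> A i = {}" if "i < n" for i
          using disjoint_family_onD[OF union(1), of n i] that by simp
        then have "A n \<inter> (\<Union>i<n. A i) = {}" by blast
        then have "(\<lambda>t. indicat_real (\<Union>i<Suc n. A i) t *\<^sub>R v t)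
            = (\<lambda>t. indicat_real (A n) t *\<^sub>R v t + indicat_real (\<Union>i<n. A i) t *\<^sub>R v t)"
          by (auto simp: indicator_def lessThan_Suc fun_eq_iff)
        moreover have "(\<Union>i<n. A i) \<in> sets borel" using A by auto
        ultimately show ?case
          using Suc union(3)[of n] strong_integral_add[OF ind_v[OF A] ind_v] by simp
      qed
      have "(\<lambda>n. strong_integral ?M (\<lambda>t. indicat_real (\<Union>i<n. A i) t *\<^sub>R v t))
          \<longlonglongrightarrow> strong_integral ?M (\<lambda>t. indicat_real (\<Union>i. A i) t *\<^sub>R v t)"
        using A by (intro strong_integral_bounded_convergence[where B=1] v ind_meas LIMSEQ_indicator_UN AE_I2)
           (auto simp: indicator_def)
      then show ?case using LIMSEQ_unique[OF _ tendsto_const[of 0]] by (simp add: fin)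
    qed
  qed
  have "AE t in ?M. v t = 0"
  proof (rule strong_integral_zero_imp_AE_zero[OF complete_measure_axioms finite_measure_axioms v])
    fix A assume "A \<in> sets ?M"
    then have A: "A \<in> sets (completion lborel)"
      by (auto simp: M_def sets_restrict_space)
    \<comment> \<open>A Lebesgue set agrees with its Borel \<open>main_part\<close> outside a null
      set, and the integral ignores the difference.\<close>
    obtain N where N: "N \<in> null_sets lborel" "null_part lborel A \<subseteq> N"
      using null_part[OF A] by blast
    have main: "main_part lborel A \<in> sets borel"
      using main_part_sets[OF A] by simp
    have "AE t in lebesgue. t \<notin> N"
      using AE_completion[OF AE_not_in[OF N(1)]] .
    then have "AE t in ?M. t \<notin> N"
      unfolding M_def by (subst AE_restrict_space_iff) auto
    then have "AE t in ?M. indicat_real (main_part lborel A) t *\<^sub>R v t = indicat_real A t *\<^sub>R v t"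
    proof eventually_elim
      case (elim t)
      then have "t \<in> A \<longleftrightarrow> t \<in> main_part lborel A"
        using main_part_null_part_Un[OF A] N(2) by blast
      then show ?case by (simp add: indicator_def)
    qed
    then show "strong_integral ?M (\<lambda>t. indicat_real A t *\<^sub>R v t) = 0"
      using strong_integral_cong_AE[OF ind_v[OF main]] borel[OF main] by simp
  qed
  then show ?thesis
    unfolding v_def by auto
qed


section \<open>Antiderivatives and distributional derivatives\<close>

lemma (in complete_measure) strong_integral_cong:
  assumes "\<And>t. t \<in> space M \<Longrightarrow> f t = g t"
  shows "strong_integral M f = strong_integral M g"
proof -
  have "has_strong_integral M f x \<longleftrightarrow> has_strong_integral M g x" for x
    using has_strong_integral_cong_AE[of f x g] has_strong_integral_cong_AE[of g x f] assms by fastforce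
  then show ?thesis by (simp add: strong_integral_def)
qed

lemma restrict_lebesgue_on:
  assumes "A \<in> sets lebesgue" "S \<in> sets lebesgue" "A \<subseteq> S"
  shows "restrict_space (lebesgue_on S) A = lebesgue_on A"
  using assms by (subst restrict_restrict_space) (auto simp: Int_absorb1)

lemma continuous_on_bounded_Ioo:
  fixes h :: "real \<Rightarrow> 'a::real_normed_vector"
  assumes "continuous_on {a..b} h"
  shows "\<exists>B. \<forall>x\<in>{a<..<b}. norm (h x) \<le> B"
proof -
  have "bounded (h ` {a..b})"
    using assms by (intro compact_imp_bounded compact_continuous_image) auto
  then obtain B where B: "\<And>y. y \<in> h ` {a..b} \<Longrightarrow> norm y \<le> B"
    unfolding bounded_iff by blast
  have "norm (h x) \<le> B" if "x \<in> {a<..<b}" for x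
    using that by (intro B imageI) auto
  then show ?thesis by blast
qed

lemma AE_lebesgue_on_neq:
  fixes S :: "'a::euclidean_space set"
  assumes "S \<in> sets lebesgue"
  shows "AE x in lebesgue_on S. x \<noteq> c"
proof -
  have "AE x in lebesgue. x \<noteq> c"
    by (rule AE_completion[OF AE_lborel_singleton])
  then show ?thesis
    using assms by (subst AE_restrict_space_iff) auto
qed

text \<open>The approximants sample \<open>f\<close> at the grid point to the left of
  \<open>t\<close>, with mesh \<open>1 / real (Suc i)\<close>, and converge by continuity; no
  separability argument for the range is involved.\<close>

lemma strongly_measurable_continuous:
  fixes f :: "real \<Rightarrow> 'a::real_normed_vector"
  assumes f: "continuous_on {a..b} f"
  shows "strongly_measurable (lebesgue_on {a<..<b}) f"
proof (rule strongly_measurableI)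
  let ?M = "lebesgue_on {a<..<b}"
  define q where "q i t = real_of_int \<lfloor>(t - a) * real (Suc i)\<rfloor>" for i t
  have "simple_function ?M (q i)" for i
  proof (rule simple_function_borel_measurable)
    show "q i \<in> borel_measurable ?M"
      unfolding q_def[abs_def] by (intro borel_measurable_lebesgue_onI) measurable
    have "q i ` space ?M \<subseteq> real_of_int ` {0..\<lceil>(b - a) * real (Suc i)\<rceil>}"
    proof (rule image_subsetI)
      fix t assume "t \<in> space ?M"
      then have t: "a < t" "t < b" by auto
      have "\<lfloor>(t - a) * real (Suc i)\<rfloor> \<le> \<lfloor>(b - a) * real (Suc i)\<rfloor>"
        using t by (intro floor_mono mult_right_mono) auto
      also have "\<dots> \<le> \<lceil>(b - a) * real (Suc i)\<rceil>" by linarith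
      finally show "q i t \<in> real_of_int ` {0..\<lceil>(b - a) * real (Suc i)\<rceil>}"
        unfolding q_def using t by (intro imageI) auto
    qed
    then show "finite (q i ` space ?M)" by (rule finite_subset) simp
  qed
  then show "simple_function ?M (\<lambda>t. f (a + q i t / real (Suc i)))" for i
    by (rule simple_function_compose1)
  show "AE t in ?M. (\<lambda>i. f (a + q i t / real (Suc i))) \<longlonglongrightarrow> f t"
  proof (rule AE_I2)
    fix t assume "t \<in> space ?M"
    then have t: "a < t" "t < b" by auto
    have le: "q i t / real (Suc i) \<le> t - a" for i
      unfolding q_def by (subst pos_divide_le_eq) (auto intro: of_int_floor_le)
    have ge: "t - a - 1 / real (Suc i) \<le> q i t / real (Suc i)" for i
    proof -
      have "(t - a) * real (Suc i) - 1 \<le> q i t" unfolding q_def by linarith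
      then have "((t - a) * real (Suc i) - 1) / real (Suc i) \<le> q i t / real (Suc i)"
        by (intro divide_right_mono) auto
      then show ?thesis by (simp add: diff_divide_distrib)
    qed
    \<comment> \<open>Together with \<open>le\<close> this keeps the sample points in
      \<open>{a..b}\<close>, where \<open>f\<close> is known to be continuous.\<close>
    have nonneg: "0 \<le> q i t / real (Suc i)" for i
      using t unfolding q_def by (auto intro!: divide_nonneg_nonneg)
    have "(\<lambda>i. 1 / real (Suc i)) \<longlonglongrightarrow> 0"
      using LIMSEQ_inverse_real_of_nat by (simp add: inverse_eq_divide)
    from tendsto_diff[OF tendsto_const this, of "t - a"]
    have lo: "(\<lambda>i. t - a - 1 / real (Suc i)) \<longlonglongrightarrow> t - a" by simp
    have "(\<lambda>i. q i t / real (Suc i)) \<longlonglongrightarrow> t - a"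
    proof (rule tendsto_sandwich[OF _ _ lo tendsto_const])
      show "eventually (\<lambda>i. t - a - 1 / real (Suc i) \<le> q i t / real (Suc i)) sequentially"
        by (intro always_eventually allI ge)
      show "eventually (\<lambda>i. q i t / real (Suc i) \<le> t - a) sequentially"
        by (intro always_eventually allI le)
    qed
    from tendsto_add[OF tendsto_const this, of a]
    have "(\<lambda>i. a + q i t / real (Suc i)) \<longlonglongrightarrow> t" by simp
    moreover have "a + q i t / real (Suc i) \<in> {a..b}" for i
      using le[of i] nonneg[of i] t by auto
    ultimately show "(\<lambda>i. f (a + q i t / real (Suc i))) \<longlonglongrightarrow> f t"
      using f t unfolding continuous_on_sequentially by (auto simp: o_def)
  qed
qed

text \<open>The measure stays fixed on \<open>(0,T)\<close> and \<open>t\<close> enters through an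
  indicator, so limits in \<open>t\<close> and in \<open>g\<close> are taken on a single measure
  space.\<close>

definition antideriv :: "real \<Rightarrow> (real \<Rightarrow> 'a::real_normed_vector) \<Rightarrow> real \<Rightarrow> 'a" where
  "antideriv T g t = strong_integral (lebesgue_on {0<..<T}) (\<lambda>s. indicat_real {0<..<t} s *\<^sub>R g s)"

lemma strongly_integrable_indicator:
  fixes T :: real
  assumes "strongly_integrable (lebesgue_on {0<..<T}) g" "A \<in> sets borel"
  shows "strongly_integrable (lebesgue_on {0<..<T}) (\<lambda>s. indicat_real A s *\<^sub>R g s)"
proof -
  interpret complete_measure "lebesgue_on {0<..<T}" by (rule complete_measure_interval)
  show ?thesis
    using assms by (intro strongly_integrable_scaleR[where B=1])
      (auto intro!: borel_measurable_lebesgue_onI simp: indicator_def)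
qed

lemma antideriv_diff:
  fixes g :: "real \<Rightarrow> 'a::banach"
  assumes g: "strongly_integrable (lebesgue_on {0<..<T}) g" and st: "0 \<le> s" "s \<le> t" "t \<le> T"
  shows "has_strong_integral (lebesgue_on {s<..<t}) g (antideriv T g t - antideriv T g s)"
proof -
  interpret complete_measure "lebesgue_on {0<..<T}" by (rule complete_measure_interval)
  note ind = strongly_integrable_indicator[OF g]
  \<comment> \<open>On \<open>(0,T)\<close> the difference of the two indicators is that of
    \<open>[s,t)\<close>, so only the point \<open>s\<close> has to be discarded.\<close>
  have "AE r in lebesgue_on {0<..<T}. r \<noteq> s"
    by (rule AE_lebesgue_on_neq) simp
  then have "AE r in lebesgue_on {0<..<T}. indicat_real {0<..<t} r *\<^sub>R g r - indicat_real {0<..<s} r *\<^sub>R g r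
      = indicat_real {s<..<t} r *\<^sub>R g r"
    by eventually_elim (use st in \<open>auto simp: indicator_def\<close>)
  from strong_integral_cong_AE[OF strongly_integrable_diff this]
  have "antideriv T g t - antideriv T g s
      = strong_integral (lebesgue_on {0<..<T}) (\<lambda>r. indicat_real {s<..<t} r *\<^sub>R g r)"
    unfolding antideriv_def by (simp add: strong_integral_diff ind)
  then have "has_strong_integral (lebesgue_on {0<..<T}) (\<lambda>r. indicat_real {s<..<t} r *\<^sub>R g r)
      (antideriv T g t - antideriv T g s)"
    using has_strong_integral_strong_integral[OF ind[of "{s<..<t}"]] by simp
  then have "has_strong_integral (restrict_space (lebesgue_on {0<..<T}) {s<..<t}) g
      (antideriv T g t - antideriv T g s)"
    by (intro has_strong_integral_restrict_space) (use st in \<open>auto simp: sets_restrict_space_iff\<close>)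
  then show ?thesis
    using st by (subst (asm) restrict_lebesgue_on) auto
qed

lemma continuous_on_antideriv:
  fixes g :: "real \<Rightarrow> 'a::banach"
  assumes g: "strongly_integrable (lebesgue_on {0<..<T}) g"
  shows "continuous_on S (antideriv T g)"
proof -
  interpret complete_measure "lebesgue_on {0<..<T}" by (rule complete_measure_interval)
  have "(\<lambda>i. antideriv T g (x i)) \<longlonglongrightarrow> antideriv T g t" if x: "x \<longlonglongrightarrow> t" for x t
    unfolding antideriv_def
  proof (rule strong_integral_bounded_convergence[where B=1, OF g])
    \<comment> \<open>At \<open>r = t\<close> the indicators need not converge.\<close>
    have "AE r in lebesgue_on {0<..<T}. r \<noteq> t"
      by (rule AE_lebesgue_on_neq) simp
    then show "AE r in lebesgue_on {0<..<T}. (\<lambda>i. indicat_real {0<..<x i} r) \<longlonglongrightarrow> indicat_real {0<..<t} r"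
    proof eventually_elim
      case (elim r)
      have "eventually (\<lambda>i. indicat_real {0<..<x i} r = indicat_real {0<..<t} r) sequentially"
      proof (cases "r < t")
        case True
        then have "eventually (\<lambda>i. r < x i) sequentially" using x by (intro order_tendstoD)
        then show ?thesis by eventually_elim (use True in \<open>auto simp: indicator_def\<close>)
      next
        case False
        then have "eventually (\<lambda>i. x i < r) sequentially" using x elim by (intro order_tendstoD) auto
        then show ?thesis by eventually_elim (use False in \<open>auto simp: indicator_def\<close>)
      qed
      then show ?case by (rule tendsto_eventually)
    qed
  qed (auto intro!: borel_measurable_lebesgue_onI simp: indicator_def)
  then show ?thesis
    by (auto simp: continuous_on_sequentially o_def)
qed

text \<open>The bound is uniform in \<open>t\<close>: \<open>L\<^sup>1\<close> convergence of
  functions gives uniform convergence of their antiderivatives, as the limit case of integration by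
  parts requires.\<close>

lemma norm_antideriv_diff_le:
  fixes f g :: "real \<Rightarrow> 'a::banach"
  assumes f: "strongly_integrable (lebesgue_on {0<..<T}) f" and g: "strongly_integrable (lebesgue_on {0<..<T}) g"
  shows "norm (antideriv T f t - antideriv T g t) \<le> (\<integral>s. norm (f s - g s) \<partial>lebesgue_on {0<..<T})"
proof -
  interpret complete_measure "lebesgue_on {0<..<T}" by (rule complete_measure_interval)
  note ind = strongly_integrable_indicator[OF f] strongly_integrable_indicator[OF g]
  have "norm (antideriv T f t - antideriv T g t)
      \<le> (\<integral>s. norm (indicat_real {0<..<t} s *\<^sub>R f s - indicat_real {0<..<t} s *\<^sub>R g s) \<partial>lebesgue_on {0<..<T})"
    unfolding antideriv_def by (intro norm_strong_integral_diff_le ind) auto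
  also have "\<dots> \<le> (\<integral>s. norm (f s - g s) \<partial>lebesgue_on {0<..<T})"
    by (intro integral_mono integrable_norm_diff ind f g) (auto simp: indicator_def)
  finally show ?thesis .
qed

text \<open>Interchanging the integrals over the triangle \<open>s < t\<close> leaves the integral
  of \<open>\<psi>\<close> over \<open>(s,T)\<close>, which is
  \<open>\<phi> T - \<phi> s = - \<phi> s\<close>.\<close>

lemma fubini_primitive:
  fixes \<phi> \<psi> :: "real \<Rightarrow> real"
    and T :: real
  defines "M \<equiv> lebesgue_on {0<..<T}"
  assumes \<phi>: "\<And>x. (\<phi> has_real_derivative \<psi> x) (at x)" "\<phi> T = 0" and \<psi>: "continuous_on UNIV \<psi>"
    and A: "A \<in> sets M"
  shows "(\<integral>t. \<psi> t * (\<integral>s. indicat_real {0<..<t} s * indicat_real A s \<partial>M) \<partial>M)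
    = - (\<integral>s. \<phi> s * indicat_real A s \<partial>M)"
proof -
  let ?M = M
  interpret finite_measure ?M unfolding M_def by (rule finite_measure_interval)
  interpret P: pair_sigma_finite ?M ?M ..
  interpret PF: finite_measure "?M \<Otimes>\<^sub>M ?M" by (intro finite_measure_pair_measure finite_measure_axioms)
  have space: "space ?M = {0<..<T}" by (simp add: M_def)
  obtain B where "\<forall>x\<in>{0<..<T}. norm (\<psi> x) \<le> B"
    using continuous_on_bounded_Ioo[OF continuous_on_subset[OF \<psi> subset_UNIV], of 0 T] by blast
  then have B: "\<bar>\<psi> x\<bar> \<le> B" if "x \<in> {0<..<T}" for x
    using that by auto
  have \<psi>m: "\<psi> \<in> borel_measurable ?M"
    unfolding M_def by (intro borel_measurable_lebesgue_onI borel_measurable_continuous_onI \<psi>)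
  have idm: "(\<lambda>x. x) \<in> borel_measurable ?M"
    unfolding M_def by (intro borel_measurable_lebesgue_onI) auto
  have [measurable]: "fst \<in> borel_measurable (?M \<Otimes>\<^sub>M ?M)" "snd \<in> borel_measurable (?M \<Otimes>\<^sub>M ?M)"
    "(\<lambda>x. \<psi> (fst x)) \<in> borel_measurable (?M \<Otimes>\<^sub>M ?M)"
    "(\<lambda>x. indicat_real A (snd x)) \<in> borel_measurable (?M \<Otimes>\<^sub>M ?M)"
    using measurable_compose[OF measurable_fst idm, of ?M] measurable_compose[OF measurable_snd idm, of ?M]
      measurable_compose[OF measurable_fst \<psi>m, of ?M]
      measurable_compose[OF measurable_snd borel_measurable_indicator[OF A], of ?M] by simp_all
  define f where "f t s = \<psi> t * (indicat_real {0<..<t} s * indicat_real A s)" for t s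
  have f: "integrable (?M \<Otimes>\<^sub>M ?M) (case_prod f)"
  proof (rule PF.integrable_const_bound[where B=B])
    \<comment> \<open>Joint measurability becomes visible once membership of \<open>s\<close> in
      \<open>(0,t)\<close> is written as a condition on both coordinates.\<close>
    have "case_prod f = (\<lambda>x. \<psi> (fst x) * ((if 0 < snd x \<and> snd x < fst x then 1 else 0) * indicat_real A (snd x)))"
      by (auto simp: f_def fun_eq_iff indicator_def)
    also have "\<dots> \<in> borel_measurable (?M \<Otimes>\<^sub>M ?M)" by measurable
    finally show "case_prod f \<in> borel_measurable (?M \<Otimes>\<^sub>M ?M)" .
    show "AE x in ?M \<Otimes>\<^sub>M ?M. norm (case_prod f x) \<le> B"
    proof (rule AE_I2)
      fix x assume "x \<in> space (?M \<Otimes>\<^sub>M ?M)"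
      then have "\<bar>\<psi> (fst x)\<bar> \<le> B" by (intro B) (auto simp: space_pair_measure space)
      then show "norm (case_prod f x) \<le> B"
        by (auto simp: f_def case_prod_beta indicator_def)
    qed
  qed
  have inner: "(\<integral>t. f t s \<partial>?M) = - (\<phi> s * indicat_real A s)" if s: "s \<in> space ?M" for s
  proof -
    have "(\<integral>t. f t s \<partial>?M) = (\<integral>t. (indicat_real {s<..<T} t *\<^sub>R \<psi> t) * indicat_real A s \<partial>?M)"
      using s by (intro Bochner_Integration.integral_cong) (auto simp: f_def indicator_def space)
    also have "\<dots> = (\<integral>t. indicat_real {s<..<T} t *\<^sub>R \<psi> t \<partial>?M) * indicat_real A s" by simp
    also have "(\<integral>t. indicat_real {s<..<T} t *\<^sub>R \<psi> t \<partial>?M) = (\<integral>t. \<psi> t \<partial>restrict_space ?M {s<..<T})"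
      using s by (intro integral_restrict_space[symmetric]) (auto simp: M_def sets_restrict_space_iff)
    also have "restrict_space ?M {s<..<T} = lebesgue_on {s<..<T}"
      using s unfolding M_def by (intro restrict_lebesgue_on) auto
    also have "(\<integral>t. \<psi> t \<partial>lebesgue_on {s<..<T}) = - \<phi> s"
      using integral_lebesgue_on_FTC(2)[OF _ \<phi>(1) \<psi>, of s T] s \<phi>(2) by (simp add: space)
    finally show ?thesis by simp
  qed
  have "(\<integral>t. \<psi> t * (\<integral>s. indicat_real {0<..<t} s * indicat_real A s \<partial>?M) \<partial>?M) = (\<integral>t. \<integral>s. f t s \<partial>?M \<partial>?M)"
    by (simp add: f_def)
  also have "\<dots> = (\<integral>s. \<integral>t. f t s \<partial>?M \<partial>?M)"
    using P.Fubini_integral[OF f] by simp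
  also have "\<dots> = (\<integral>s. - (\<phi> s * indicat_real A s) \<partial>?M)"
    by (intro Bochner_Integration.integral_cong refl inner)
  finally show ?thesis by simp
qed

text \<open>Both sides are additive and continuous for \<open>L\<^sup>1\<close> convergence in
  \<open>g\<close>. This reduces the identity to \<open>g = indicat_real A t *\<^sub>R c\<close>,
  where the vector \<open>c\<close> factors out and a scalar Fubini identity remains.\<close>

lemma integration_by_parts_antideriv:
  fixes g :: "real \<Rightarrow> 'a::banach"
    and T :: real
  defines "M \<equiv> lebesgue_on {0<..<T}"
  assumes \<phi>: "\<And>x. (\<phi> has_real_derivative \<psi> x) (at x)" "\<phi> T = 0" and \<psi>: "continuous_on UNIV \<psi>"
    and g: "strongly_integrable M g"
  shows "strongly_integrable M (\<lambda>t. \<psi> t *\<^sub>R antideriv T g t)" (is ?int)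
    and "strong_integral M (\<lambda>t. \<psi> t *\<^sub>R antideriv T g t) = - strong_integral M (\<lambda>t. \<phi> t *\<^sub>R g t)" (is ?eq)
proof -
  let ?M = M
  interpret complete_measure ?M unfolding M_def by (rule complete_measure_interval)
  interpret finite_measure ?M unfolding M_def by (rule finite_measure_interval)
  have space: "space ?M = {0<..<T}" by (simp add: M_def)
  have cont\<phi>: "continuous_on UNIV \<phi>"
    using \<phi>(1) by (meson DERIV_continuous_on DERIV_subset top_greatest)
  have bdd: "\<exists>B. \<forall>x\<in>{0<..<T}. norm (h x) \<le> B" if "continuous_on UNIV h" for h :: "real \<Rightarrow> 'c::real_normed_vector"
    using continuous_on_bounded_Ioo[of 0 T h] that continuous_on_subset by blast
  have meas: "h \<in> borel_measurable ?M" if "continuous_on UNIV h" for h :: "real \<Rightarrow> real"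
    unfolding M_def by (intro borel_measurable_lebesgue_onI borel_measurable_continuous_onI that)
  obtain B where B: "\<forall>x\<in>{0<..<T}. norm (\<psi> x) \<le> B" using bdd[OF \<psi>] by blast
  obtain B' where B': "\<forall>x\<in>{0<..<T}. norm (\<phi> x) \<le> B'" using bdd[OF cont\<phi>] by blast
  have anti: "strongly_integrable ?M (antideriv T h)" if h: "strongly_integrable ?M h" for h :: "real \<Rightarrow> 'a"
  proof -
    have c: "continuous_on S (antideriv T h)" for S
      using continuous_on_antideriv h by (simp add: M_def)
    then obtain K where "\<forall>x\<in>{0<..<T}. norm (antideriv T h x) \<le> K" using bdd by blast
    then show ?thesis
      using strongly_measurable_continuous[OF c, of 0 T] unfolding M_def[symmetric]
      by (intro strongly_integrable_bound[where h="\<lambda>_. K"] AE_I2) (auto simp: space)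
  qed
  have \<psi>G: "strongly_integrable ?M (\<lambda>t. \<psi> t *\<^sub>R antideriv T h t)" if h: "strongly_integrable ?M h" for h :: "real \<Rightarrow> 'a"
    using B by (intro strongly_integrable_scaleR[where B=B] meas \<psi> anti h) (auto simp: space)
  have \<phi>h: "strongly_integrable ?M (\<lambda>t. \<phi> t *\<^sub>R h t)" if h: "strongly_integrable ?M h" for h :: "real \<Rightarrow> 'a"
    using B' by (intro strongly_integrable_scaleR[where B=B'] meas cont\<phi> h) (auto simp: space)
  show ?int using g by (rule \<psi>G)
  show ?eq
    using g
  proof (induction rule: strongly_integrable_induct)
    case (cong f g)
    have "antideriv T f = antideriv T g"
      using cong(2) unfolding antideriv_def M_def[symmetric] by (intro ext strong_integral_cong) simp
    moreover have "strong_integral ?M (\<lambda>t. \<phi> t *\<^sub>R f t) = strong_integral ?M (\<lambda>t. \<phi> t *\<^sub>R g t)"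
      using cong(2) by (intro strong_integral_cong) simp
    ultimately show ?case using cong(1) by simp
  next
    case (base A c)
    have int2: "integrable ?M (\<lambda>s. indicat_real {0<..<t} s * indicat_real A s)" for t
    proof (rule integrable_const_bound[where B=1])
      have "indicat_real {0<..<t} \<in> borel_measurable ?M"
        unfolding M_def by (intro borel_measurable_lebesgue_onI) auto
      then show "(\<lambda>s. indicat_real {0<..<t} s * indicat_real A s) \<in> borel_measurable ?M"
        by (rule borel_measurable_times[OF _ borel_measurable_indicator[OF base(1)]])
    qed (auto simp: indicator_def)
    have G: "antideriv T (\<lambda>t. indicat_real A t *\<^sub>R c) t
        = (\<integral>s. indicat_real {0<..<t} s * indicat_real A s \<partial>?M) *\<^sub>R c" for t
    proof -
      from strong_integral_scaleR_const[OF int2[of t], of c] show ?thesis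
        by (simp add: antideriv_def M_def)
    qed
    define a where "a t = (\<integral>s. indicat_real {0<..<t} s * indicat_real A s \<partial>?M)" for t
    \<comment> \<open>\<open>a\<close> is the antiderivative of a real function, so the general
      continuity result yields its measurability and boundedness.\<close>
    have ac: "antideriv T (indicat_real A) t = a t" for t
    proof -
      from strong_integral_eqI[OF has_strong_integral_real[OF int2]] show ?thesis
        by (simp add: antideriv_def a_def M_def)
    qed
    have iA: "strongly_integrable ?M (indicat_real A)"
      using strongly_integrable_scaleR_const[of "indicat_real A" "1::real"] base
      by (simp add: integrable_indicator_iff sets.Int_space_eq2)
    have acont: "continuous_on UNIV a"
      using continuous_on_antideriv[of T "indicat_real A" UNIV] iA unfolding ac[abs_def] M_def by (simp add: ac)
    then obtain K where K: "\<forall>x\<in>{0<..<T}. norm (a x) \<le> K" using bdd by blast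
    have "integrable ?M (\<lambda>t. \<psi> t * a t)"
    proof (rule integrable_const_bound[where B="B * K"])
      show "AE t in ?M. norm (\<psi> t * a t) \<le> B * K"
      proof (rule AE_I2)
        fix t assume "t \<in> space ?M"
        then have "\<bar>\<psi> t\<bar> \<le> B" "\<bar>a t\<bar> \<le> K" using B K by (auto simp: space)
        then show "norm (\<psi> t * a t) \<le> B * K"
          by (simp add: abs_mult) (intro mult_mono, auto)
      qed
      show "(\<lambda>t. \<psi> t * a t) \<in> borel_measurable ?M"
        by (intro meas continuous_intros \<psi> acont)
    qed
    from strong_integral_scaleR_const[OF this, of c]
    have 1: "strong_integral ?M (\<lambda>t. \<psi> t *\<^sub>R antideriv T (\<lambda>t. indicat_real A t *\<^sub>R c) t)
        = (\<integral>t. \<psi> t * a t \<partial>?M) *\<^sub>R c"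
      by (simp add: G a_def)
    have "integrable ?M (\<lambda>t. \<phi> t * indicat_real A t)"
    proof (rule integrable_const_bound[where B="B'"])
      show "AE t in ?M. norm (\<phi> t * indicat_real A t) \<le> B'"
        using B' by (intro AE_I2) (force simp: indicator_def space)
      show "(\<lambda>t. \<phi> t * indicat_real A t) \<in> borel_measurable ?M"
        using base(1) meas[OF cont\<phi>] by simp
    qed
    from strong_integral_scaleR_const[OF this, of c]
    have 2: "strong_integral ?M (\<lambda>t. \<phi> t *\<^sub>R indicat_real A t *\<^sub>R c) = (\<integral>t. \<phi> t * indicat_real A t \<partial>?M) *\<^sub>R c"
      by simp
    have "(\<integral>t. \<psi> t * a t \<partial>?M) = - (\<integral>t. \<phi> t * indicat_real A t \<partial>?M)"
      using fubini_primitive[OF \<phi> \<psi>] base(1) by (simp add: a_def M_def)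
    then show ?case unfolding 1 2 by simp
  next
    case (add f g)
    have "antideriv T (\<lambda>t. f t + g t) t = antideriv T f t + antideriv T g t" for t
      using add.hyps strongly_integrable_indicator[of T f] strongly_integrable_indicator[of T g]
      by (simp add: antideriv_def scaleR_add_right strong_integral_add flip: M_def)
    then show ?case
      using add \<psi>G[of f] \<psi>G[of g] \<phi>h[of f] \<phi>h[of g] by (simp add: scaleR_add_right strong_integral_add)
  next
    case (lim f s)
    have 1: "(\<lambda>i. strong_integral ?M (\<lambda>t. \<psi> t *\<^sub>R antideriv T (s i) t))
        \<longlonglongrightarrow> strong_integral ?M (\<lambda>t. \<psi> t *\<^sub>R antideriv T f t)"
    proof (rule strong_integral_LIMSEQ[OF \<psi>G \<psi>G])
      \<comment> \<open>The integrand is bounded uniformly in \<open>t\<close>, so integration over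
        \<open>(0,T)\<close> only costs the factor of its measure.\<close>
      have le: "norm (\<integral>t. norm (\<psi> t *\<^sub>R antideriv T f t - \<psi> t *\<^sub>R antideriv T (s i) t) \<partial>?M)
          \<le> measure ?M (space ?M) * (B * (\<integral>t. norm (f t - s i t) \<partial>?M))" for i
      proof -
        have "(\<integral>t. norm (\<psi> t *\<^sub>R antideriv T f t - \<psi> t *\<^sub>R antideriv T (s i) t) \<partial>?M)
            \<le> (\<integral>t. B * (\<integral>t. norm (f t - s i t) \<partial>?M) \<partial>?M)"
        proof (rule integral_mono)
          show "integrable ?M (\<lambda>t. norm (\<psi> t *\<^sub>R antideriv T f t - \<psi> t *\<^sub>R antideriv T (s i) t))"
            by (intro integrable_norm_diff \<psi>G lim)
          fix t assume "t \<in> space ?M"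
          then have "\<bar>\<psi> t\<bar> \<le> B" using B by (simp add: space)
          moreover have "norm (antideriv T f t - antideriv T (s i) t) \<le> (\<integral>t. norm (f t - s i t) \<partial>?M)"
            using lim by (simp add: M_def norm_antideriv_diff_le)
          ultimately show "norm (\<psi> t *\<^sub>R antideriv T f t - \<psi> t *\<^sub>R antideriv T (s i) t)
              \<le> B * (\<integral>t. norm (f t - s i t) \<partial>?M)"
            unfolding scaleR_right_diff_distrib[symmetric] norm_scaleR
            by (intro mult_mono) auto
        qed simp
        then show ?thesis by (simp add: integral_nonneg)
      qed
      then show "(\<lambda>i. \<integral>t. norm (\<psi> t *\<^sub>R antideriv T f t - \<psi> t *\<^sub>R antideriv T (s i) t) \<partial>?M) \<longlonglongrightarrow> 0"
        using tendsto_mult_left[OF tendsto_mult_left[OF lim.hyps(3), of B], of "measure ?M (space ?M)"]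
        by (intro Lim_null_comparison[OF always_eventually[OF allI[OF le]]]) simp
    qed (use lim in auto)
    have 2: "(\<lambda>i. strong_integral ?M (\<lambda>t. \<phi> t *\<^sub>R s i t)) \<longlonglongrightarrow> strong_integral ?M (\<lambda>t. \<phi> t *\<^sub>R f t)"
    proof (rule strong_integral_LIMSEQ[OF \<phi>h \<phi>h])
      have le: "norm (\<integral>t. norm (\<phi> t *\<^sub>R f t - \<phi> t *\<^sub>R s i t) \<partial>?M) \<le> B' * (\<integral>t. norm (f t - s i t) \<partial>?M)" for i
      proof -
        have "(\<integral>t. norm (\<phi> t *\<^sub>R f t - \<phi> t *\<^sub>R s i t) \<partial>?M) \<le> (\<integral>t. B' * norm (f t - s i t) \<partial>?M)"
          using B' lim unfolding scaleR_right_diff_distrib[symmetric] norm_scaleR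
          by (intro integral_mono integrable_mult_right integrable_norm_diff mult_right_mono)
             (use integrable_norm_diff[OF \<phi>h[OF lim.hyps(1)] \<phi>h[OF lim.hyps(2)[of i]]] in
               \<open>auto simp: space scaleR_right_diff_distrib[symmetric]\<close>)
        then show ?thesis by (simp add: integral_nonneg)
      qed
      then show "(\<lambda>i. \<integral>t. norm (\<phi> t *\<^sub>R f t - \<phi> t *\<^sub>R s i t) \<partial>?M) \<longlonglongrightarrow> 0"
        using tendsto_mult_left[OF lim.hyps(3), of B']
        by (intro Lim_null_comparison[OF always_eventually[OF allI[OF le]]]) simp
    qed (use lim in auto)
    show ?case
      using LIMSEQ_unique[OF 1[unfolded lim.IH] tendsto_minus[OF 2]] by simp
  qed
qed

lemma distributional_derivative_antideriv:
  fixes f g :: "real \<Rightarrow> 'a::banach"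
    and T :: real
  defines "M \<equiv> lebesgue_on {0<..<T}"
  assumes T: "0 < T" and f: "strongly_integrable M f" and g: "strongly_integrable M g"
    and fg: "has_distributional_derivative T f g"
  shows "\<exists>c. AE t in M. f t = c + antideriv T g t"
proof -
  let ?M = M
  interpret complete_measure ?M unfolding M_def by (rule complete_measure_interval)
  \<comment> \<open>The pair \<open>\<phi> t = t - T\<close>, \<open>\<psi> t = 1\<close> serves to
    read off the integrability of the antiderivative itself.\<close>
  have "((\<lambda>t. t - T) has_real_derivative 1) (at x)" for x
    by (auto intro!: derivative_eq_intros)
  from integration_by_parts_antideriv(1)[OF this _ _ g[unfolded M_def]]
  have G: "strongly_integrable ?M (antideriv T g)"
    by (simp add: M_def)
  have w: "strongly_integrable ?M (\<lambda>t. f t - antideriv T g t)"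
    using f G by (rule strongly_integrable_diff)
  have "\<exists>c. AE t in ?M. f t - antideriv T g t = c"
    unfolding M_def
  proof (rule weak_derivative_zero_imp_const[OF T w[unfolded M_def]], fold M_def)
    fix \<phi> assume \<phi>: "\<phi> \<in> test_functions T"
    then have diff: "(deriv ^^ k) \<phi> differentiable (at x)" for k x
      by (auto simp: test_functions_def)
    have d0: "(\<phi> has_real_derivative deriv \<phi> x) (at x)" for x
      using diff[of 0 x] by (simp add: DERIV_deriv_iff_real_differentiable)
    have "isCont (deriv \<phi>) x" for x
      using diff[of 1 x] by (simp add: differentiable_imp_continuous_within)
    then have c: "continuous_on UNIV (deriv \<phi>)"
      by (simp add: continuous_on_eq_continuous_at)
    have "\<phi> T = 0"
    proof (rule ccontr)
      assume "\<phi> T \<noteq> 0"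
      then have "T \<in> closure {x. \<phi> x \<noteq> 0}" by (intro subsetD[OF closure_subset]) simp
      then show False using \<phi> by (auto simp: test_functions_def)
    qed
    note parts = integration_by_parts_antideriv[OF d0 this c g[unfolded M_def], folded M_def]
    obtain x where x: "has_strong_integral ?M (\<lambda>t. deriv \<phi> t *\<^sub>R f t) (- x)"
      "has_strong_integral ?M (\<lambda>t. \<phi> t *\<^sub>R g t) x"
      using fg \<phi> unfolding has_distributional_derivative_def M_def by blast
    then have "strongly_integrable ?M (\<lambda>t. deriv \<phi> t *\<^sub>R f t)"
      by (simp add: has_strong_integral_alt)
    \<comment> \<open>Both integrals are \<open>- x\<close>: the one with \<open>f\<close> by the
      definition of the weak derivative, the one with the antiderivative by parts.\<close>
    from strong_integral_diff[OF this parts(1)]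
    show "strong_integral ?M (\<lambda>t. deriv \<phi> t *\<^sub>R (f t - antideriv T g t)) = 0"
      unfolding parts(2) strong_integral_eqI[OF x(1)] strong_integral_eqI[OF x(2)]
      by (simp add: scaleR_right_diff_distrib)
  qed
  then obtain c where "AE t in ?M. f t - antideriv T g t = c" by blast
  then have "AE t in ?M. f t = c + antideriv T g t"
    by eventually_elim (simp add: algebra_simps)
  then show ?thesis by blast
qed


section \<open>Morrey and interpolation estimates\<close>

text \<open>Hoelder's inequality against the constant \<open>1\<close>, obtained by integrating
  Young's inequality with a free parameter \<open>m\<close> and optimising \<open>m\<close>. The
  value \<open>m = 1\<close> already gives integrability.\<close>

lemma Hoelder_finite_measure:
  fixes f :: "'a \<Rightarrow> real"
  assumes "finite_measure M" and p: "1 < p" and f: "f \<in> borel_measurable M" "\<And>x. 0 \<le> f x"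
    and int: "integrable M (\<lambda>x. f x powr p)"
  shows "integrable M f" "(\<integral>x. f x \<partial>M) \<le> measure M (space M) powr (1 - 1 / p) * (\<integral>x. f x powr p \<partial>M) powr (1 / p)"
proof -
  interpret finite_measure M by fact
  have young: "x \<le> m * (1 - 1 / p) + m powr (1 - p) / p * x powr p" if "m > 0" "x \<ge> 0" for x m :: real
  proof -
    have "x / m * 1 \<le> (x / m) powr p / p + 1 powr (1 / (1 - 1 / p)) / (1 / (1 - 1 / p))"
      using that p by (intro Youngs_inequality) (auto simp: field_simps)
    then have "x / m \<le> (x / m) powr p / p + (1 - 1 / p)" by simp
    then have "m * (x / m) \<le> m * ((x / m) powr p / p + (1 - 1 / p))"
      using that by (intro mult_left_mono) auto
    also have "\<dots> = m * (1 - 1 / p) + m * (x powr p / m powr p) / p"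
      using that by (simp add: powr_divide algebra_simps)
    also have "m * (x powr p / m powr p) / p = m powr (1 - p) / p * x powr p"
      using that by (simp add: powr_diff)
    finally show ?thesis using that by simp
  qed
  show fi: "integrable M f"
  proof (rule Bochner_Integration.integrable_bound)
    show "integrable M (\<lambda>x. 1 * (1 - 1 / p) + 1 powr (1 - p) / p * f x powr p)"
      using int by simp
    show "AE x in M. norm (f x) \<le> norm (1 * (1 - 1 / p) + 1 powr (1 - p) / p * f x powr p)"
    proof (rule AE_I2)
      fix x
      show "norm (f x) \<le> norm (1 * (1 - 1 / p) + 1 powr (1 - p) / p * f x powr p)"
        using young[of 1 "f x"] f(2)[of x] by simp
    qed
  qed (use f in auto)
  define J where "J = (\<integral>x. f x powr p \<partial>M)"
  define V where "V = measure M (space M)"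
  have "J \<ge> 0" "V \<ge> 0" by (auto simp: J_def V_def integral_nonneg)
  show "(\<integral>x. f x \<partial>M) \<le> measure M (space M) powr (1 - 1 / p) * (\<integral>x. f x powr p \<partial>M) powr (1 / p)"
  \<comment> \<open>In these cases the optimal \<open>m\<close> is not a positive number, but
    \<open>f\<close> vanishes almost everywhere.\<close>
  proof (cases "J = 0 \<or> V = 0")
    case True
    have "AE x in M. f x = 0"
      using True
    proof
      assume "J = 0"
      then have "AE x in M. f x powr p = 0"
        using integral_nonneg_eq_0_iff_AE[OF int] by (simp add: J_def)
      then show ?thesis by eventually_elim simp
    next
      assume "V = 0"
      then have "space M \<in> null_sets M"
        by (simp add: V_def null_sets_def emeasure_eq_measure)
      then show ?thesis by (rule AE_I'[where N="space M"]) auto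
    qed
    then have "(\<integral>x. f x \<partial>M) = 0"
      using integral_nonneg_eq_0_iff_AE[OF fi] f(2) by simp
    then show ?thesis by simp
  next
    case False
    then have "J > 0" "V > 0" using \<open>J \<ge> 0\<close> \<open>V \<ge> 0\<close> by auto
    \<comment> \<open>\<open>m\<close> is the \<open>p\<close>-mean of \<open>f\<close>. With
      \<open>m powr p = J / V\<close> the two terms of the bound are \<open>V * m\<close> with the
      weights \<open>1 - 1 / p\<close> and \<open>1 / p\<close>.\<close>
    define m where "m = (J / V) powr (1 / p)"
    have m: "m > 0" using \<open>J > 0\<close> \<open>V > 0\<close> by (simp add: m_def)
    have "(\<integral>x. f x \<partial>M) \<le> (\<integral>x. m * (1 - 1 / p) + m powr (1 - p) / p * f x powr p \<partial>M)"
      using fi int young[OF m f(2)] by (intro integral_mono) auto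
    also have "\<dots> = V * (m * (1 - 1 / p)) + m powr (1 - p) / p * J"
      using int by (simp add: V_def J_def)
    also have "m powr (1 - p) = m / m powr p" using m by (simp add: powr_diff)
    also have "m powr p = J / V" using p \<open>J > 0\<close> \<open>V > 0\<close> by (simp add: m_def powr_powr)
    also have "V * (m * (1 - 1 / p)) + m / (J / V) / p * J = V * m"
      using \<open>J > 0\<close> \<open>V > 0\<close> p by (simp add: field_simps)
    also have "\<dots> = V powr (1 - 1 / p) * J powr (1 / p)"
      using \<open>J > 0\<close> \<open>V > 0\<close> by (simp add: m_def powr_divide powr_diff)
    finally show ?thesis by (simp add: V_def J_def)
  qed
qed

lemma integral_lebesgue_on_subset:
  fixes f :: "'a::euclidean_space \<Rightarrow> real"
  assumes "A \<in> sets lebesgue" "S \<in> sets lebesgue" "A \<subseteq> S"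
  shows "(\<integral>x. f x \<partial>lebesgue_on A) = (\<integral>x. indicator A x * f x \<partial>lebesgue_on S)"
proof -
  have "(\<integral>x. f x \<partial>lebesgue_on A) = (\<integral>x. f x \<partial>restrict_space (lebesgue_on S) A)"
    using assms by (simp add: restrict_lebesgue_on)
  also have "\<dots> = (\<integral>x. indicator A x *\<^sub>R f x \<partial>lebesgue_on S)"
    using assms by (intro integral_restrict_space) (auto simp: sets_restrict_space_iff)
  finally show ?thesis by simp
qed

lemma norm_antideriv_increment_le:
  fixes g :: "real \<Rightarrow> 'a::banach"
  assumes g: "strongly_integrable (lebesgue_on {0<..<T}) g" and st: "0 \<le> s" "s \<le> t" "t \<le> T"
  shows "norm (antideriv T g t - antideriv T g s) \<le> (\<integral>r. norm (g r) \<partial>lebesgue_on {s<..<t})"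
proof -
  interpret complete_measure "lebesgue_on {s<..<t}" by (rule complete_measure_interval)
  note I = antideriv_diff[OF g st]
  have "strongly_integrable (lebesgue_on {s<..<t}) g"
    using I by (simp add: has_strong_integral_alt)
  from norm_strong_integral_le[OF this] show ?thesis
    unfolding strong_integral_eqI[OF I] .
qed

text \<open>The integral of \<open>norm g\<close> over a small set is split at a height \<open>n\<close>: the part above \<open>n\<close> is
  small in \<open>L\<^sup>1\<close>, and the part below contributes at most \<open>n\<close> times the measure.\<close>

lemma absolutely_continuous_on_antideriv:
  fixes g :: "real \<Rightarrow> 'a::banach"
  assumes g: "strongly_integrable (lebesgue_on {0<..<T}) g"
  shows "absolutely_continuous_on 0 T (antideriv T g)"
  unfolding absolutely_continuous_on_def
proof (intro allI impI)
  fix e :: real assume e: "e > 0"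
  let ?M = "lebesgue_on {0<..<T}"
  interpret finite_measure ?M by (rule finite_measure_interval)
  have ng: "integrable ?M (\<lambda>r. norm (g r))" using g by (simp add: strongly_integrable_def)
  define x where "x n r = max 0 (norm (g r) - real n)" for n r
  have xi: "integrable ?M (x n)" for n
    unfolding x_def[abs_def] using ng by (intro integrable_max) auto
  have "(\<lambda>n. \<integral>r. x n r \<partial>?M) \<longlonglongrightarrow> (\<integral>r. 0 \<partial>?M)"
  proof (rule integral_dominated_convergence[where w="\<lambda>r. norm (g r)"])
    show "x n \<in> borel_measurable ?M" for n using xi by auto
    show "AE r in ?M. (\<lambda>n. x n r) \<longlonglongrightarrow> 0"
    proof (rule AE_I2)
      fix r
      obtain N :: nat where "norm (g r) \<le> N" using real_arch_simple by blast
      then have "x n r = 0" if "n \<ge> N" for n using that by (simp add: x_def)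
      then show "(\<lambda>n. x n r) \<longlonglongrightarrow> 0"
        by (intro tendsto_eventually) (auto simp: eventually_sequentially)
    qed
  qed (auto simp: ng x_def)
  then have "eventually (\<lambda>n. (\<integral>r. x n r \<partial>?M) < e / 2) sequentially"
    using e by (intro order_tendstoD) auto
  then obtain n where n: "(\<integral>r. x n r \<partial>?M) < e / 2" by (auto simp: eventually_sequentially)
  \<comment> \<open>Total length below \<open>\<delta>\<close> keeps the contribution below height
    \<open>n\<close> at most \<open>e / 2\<close>; the added \<open>1\<close> covers
    \<open>n = 0\<close>.\<close>
  define \<delta> where "\<delta> = e / (2 * (real n + 1))"
  have "(\<Sum>i<k. norm (antideriv T g (t i) - antideriv T g (s i))) < e"
    if st: "\<And>i. i < k \<Longrightarrow> 0 \<le> s i \<and> s i \<le> t i \<and> t i \<le> T"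
      and disj: "\<And>i l. i < k \<Longrightarrow> l < k \<Longrightarrow> i \<noteq> l \<Longrightarrow> {s i<..<t i} \<inter> {s l<..<t l} = {}"
      and small: "(\<Sum>i<k. t i - s i) < \<delta>" for k :: nat and s t
  proof -
    have ii: "integrable ?M (\<lambda>r. indicator {s i<..<t i} r * h r)"
      if "integrable ?M h" "i < k" for h :: "real \<Rightarrow> real" and i
    proof -
      have "{s i<..<t i} \<subseteq> {0<..<T}" using st[OF that(2)] by auto
      then have "{s i<..<t i} \<in> sets ?M" by (simp add: sets_restrict_space_iff)
      from integrable_mult_indicator[OF this that(1)] show ?thesis by simp
    qed
    have "norm (antideriv T g (t i) - antideriv T g (s i))
        \<le> real n * (t i - s i) + (\<integral>r. indicator {s i<..<t i} r * x n r \<partial>?M)" if i: "i < k" for i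
    proof -
      have sub: "{s i<..<t i} \<subseteq> {0<..<T}" using st[OF i] by auto
      have "norm (antideriv T g (t i) - antideriv T g (s i)) \<le> (\<integral>r. norm (g r) \<partial>lebesgue_on {s i<..<t i})"
        using st[OF i] by (intro norm_antideriv_increment_le g) auto
      also have "\<dots> = (\<integral>r. indicator {s i<..<t i} r * norm (g r) \<partial>?M)"
        using sub by (intro integral_lebesgue_on_subset) auto
      also have "\<dots> \<le> (\<integral>r. indicator {s i<..<t i} r * real n + indicator {s i<..<t i} r * x n r \<partial>?M)"
        using i by (intro integral_mono Bochner_Integration.integrable_add ii ng xi)
          (auto simp: indicator_def x_def)
      also have "\<dots> = (\<integral>r. indicator {s i<..<t i} r * real n \<partial>?M) + (\<integral>r. indicator {s i<..<t i} r * x n r \<partial>?M)"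
        using i by (intro Bochner_Integration.integral_add ii xi) auto
      also have "(\<integral>r. indicator {s i<..<t i} r * real n \<partial>?M) = (\<integral>r. real n \<partial>lebesgue_on {s i<..<t i})"
        using sub by (intro integral_lebesgue_on_subset[symmetric]) auto
      also have "\<dots> = real n * (t i - s i)"
        using st[OF i] by (simp add: measure_restrict_space)
      finally show ?thesis .
    qed
    then have "(\<Sum>i<k. norm (antideriv T g (t i) - antideriv T g (s i)))
        \<le> (\<Sum>i<k. real n * (t i - s i) + (\<integral>r. indicator {s i<..<t i} r * x n r \<partial>?M))"
      by (intro sum_mono) auto
    also have "\<dots> = real n * (\<Sum>i<k. t i - s i) + (\<Sum>i<k. \<integral>r. indicator {s i<..<t i} r * x n r \<partial>?M)"
      by (simp add: sum.distrib sum_distrib_left)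
    also have "(\<Sum>i<k. \<integral>r. indicator {s i<..<t i} r * x n r \<partial>?M)
        = (\<integral>r. (\<Sum>i<k. indicator {s i<..<t i} r * x n r) \<partial>?M)"
      by (intro Bochner_Integration.integral_sum[symmetric] ii xi) auto
    also have "(\<integral>r. (\<Sum>i<k. indicator {s i<..<t i} r * x n r) \<partial>?M) \<le> (\<integral>r. x n r \<partial>?M)"
    proof (rule integral_mono)
      fix r
      \<comment> \<open>By disjointness at most one indicator is nonzero at \<open>r\<close>, so the
        excess parts add up to at most one integral over \<open>(0,T)\<close>, however many
        intervals there are.\<close>
      have "(\<Sum>i<k. indicator {s i<..<t i} r) \<le> (1::real)"
      proof (cases "\<exists>i<k. r \<in> {s i<..<t i}")
        case True
        then obtain i where i: "i < k" "r \<in> {s i<..<t i}" by blast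
        have "r \<notin> {s l<..<t l}" if "l < k" "l \<noteq> i" for l
          using disj[of i l] i that by blast
        then have "(indicator {s l<..<t l} r :: real) = (if l = i then 1 else 0)" if "l < k" for l
          using i(2) that by (cases "l = i") (simp_all add: indicator_def del: greaterThanLessThan_iff)
        then have "(\<Sum>l<k. indicator {s l<..<t l} r) = (\<Sum>l<k. if l = i then 1 else (0::real))"
          by (intro sum.cong) auto
        then show ?thesis using i by simp
      next
        case False
        then have "(\<Sum>l<k. indicator {s l<..<t l} r) = (0::real)"
          by (intro sum.neutral) (auto simp: indicator_def)
        then show ?thesis by simp
      qed
      from mult_right_mono[OF this, of "x n r"]
      show "(\<Sum>i<k. indicator {s i<..<t i} r * x n r) \<le> x n r"
        by (simp add: sum_distrib_right x_def)
      show "integrable ?M (\<lambda>r. \<Sum>i<k. indicator {s i<..<t i} r * x n r)"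
        by (intro Bochner_Integration.integrable_sum ii xi) auto
    qed (rule xi)
    also have "real n * (\<Sum>i<k. t i - s i) + (\<integral>r. x n r \<partial>?M) < e / 2 + e / 2"
    proof (rule add_le_less_mono[OF _ n])
      have "real n * (\<Sum>i<k. t i - s i) \<le> (real n + 1) * \<delta>"
        using small st by (intro mult_mono sum_nonneg) (auto intro: less_imp_le)
      also have "\<dots> = e / 2" unfolding \<delta>_def using of_nat_0_le_iff[of n] by (simp add: divide_simps)
      finally show "real n * (\<Sum>i<k. t i - s i) \<le> e / 2" .
    qed
    finally show ?thesis by simp
  qed
  moreover have "\<delta> > 0" using e by (simp add: \<delta>_def)
  ultimately show "\<exists>\<delta>>0. \<forall>(n::nat) s t.
      (\<forall>i<n. 0 \<le> s i \<and> s i \<le> t i \<and> t i \<le> T) \<and>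
      (\<forall>i<n. \<forall>k<n. i \<noteq> k \<longrightarrow> {s i<..<t i} \<inter> {s k<..<t k} = {}) \<and>
      (\<Sum>i<n. t i - s i) < \<delta> \<longrightarrow>
      (\<Sum>i<n. norm (antideriv T g (t i) - antideriv T g (s i))) < e"
    by (intro exI[of _ \<delta>]) blast
qed

section \<open>Consequences of a finite Morrey norm\<close>

lemma Ioo_subintervals: "0 \<le> s \<Longrightarrow> s < t \<Longrightarrow> t \<le> T \<Longrightarrow> {s<..<t} \<in> subintervals T"
  by (auto simp: subintervals_def is_interval_oo)

lemma morrey_norm_nonneg:
  assumes "f \<in> morrey_space T p lam" "0 < T"
  shows "0 \<le> morrey_norm T p lam f"
proof -
  have "morrey_quantity p lam f {0<..<T} \<le> morrey_norm T p lam f"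
    unfolding morrey_norm_def using assms
    by (intro cSUP_upper Ioo_subintervals) (auto simp: morrey_space_def)
  moreover have "0 \<le> morrey_quantity p lam f {0<..<T}"
    by (simp add: morrey_quantity_def)
  ultimately show ?thesis by linarith
qed

lemma morrey_integral_powr_le:
  assumes f: "f \<in> morrey_space T p lam" and p: "1 < p" and st: "0 \<le> s" "s < t" "t \<le> T"
  shows "(\<integral>r. norm (f r) powr p \<partial>lebesgue_on {s<..<t}) powr (1 / p) \<le> (t - s) powr (lam / p) * morrey_norm T p lam f"
proof -
  have "morrey_quantity p lam f {s<..<t} \<le> morrey_norm T p lam f"
    unfolding morrey_norm_def using assms
    by (intro cSUP_upper Ioo_subintervals) (auto simp: morrey_space_def)
  then have "(t - s) powr (lam / p) * ((t - s) powr (- lam / p) * (\<integral>r. norm (f r) powr p \<partial>lebesgue_on {s<..<t}) powr (1 / p))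
      \<le> (t - s) powr (lam / p) * morrey_norm T p lam f"
    using st by (intro mult_left_mono) (auto simp: morrey_quantity_def)
  moreover have "(t - s) powr (lam / p) * (t - s) powr (- lam / p) = 1"
    using st by (simp flip: powr_add)
  ultimately show ?thesis
    by (metis mult.assoc mult_1)
qed

lemma morrey_strongly_integrable:
  assumes f: "f \<in> morrey_space T p lam" and p: "1 < p"
  shows "strongly_integrable (lebesgue_on {0<..<T}) f"
proof -
  interpret complete_measure "lebesgue_on {0<..<T}" by (rule complete_measure_interval)
  have m: "strongly_measurable (lebesgue_on {0<..<T}) f"
    and ip: "integrable (lebesgue_on {0<..<T}) (\<lambda>t. norm (f t) powr p)"
    using f by (auto simp: morrey_space_def)
  have "integrable (lebesgue_on {0<..<T}) (\<lambda>t. norm (f t))"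
    by (rule Hoelder_finite_measure(1)[OF finite_measure_interval p
          borel_measurable_norm_strongly_measurable[OF m] norm_ge_zero ip])
  with m show ?thesis by (simp add: strongly_integrable_def)
qed

text \<open>Hoelder's inequality gives the exponent \<open>1 - 1 / p\<close>, the Morrey bound for
  the \<open>p\<close>-integral gives \<open>lam / p\<close>, and the sum is the
  \<open>\<theta>\<close> of the theorem.\<close>

lemma morrey_integral_le:
  assumes f: "f \<in> morrey_space T p lam" and p: "1 < p" and st: "0 \<le> s" "s < t" "t \<le> T"
  shows "(\<integral>r. norm (f r) \<partial>lebesgue_on {s<..<t}) \<le> (t - s) powr (1 - (1 - lam) / p) * morrey_norm T p lam f"
proof -
  have sub: "{s<..<t} \<subseteq> {0<..<T}" using st by auto
  have "integrable (lebesgue_on {0<..<T}) (\<lambda>r. norm (f r) powr p)" using f by (simp add: morrey_space_def)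
  then have ip: "integrable (lebesgue_on {s<..<t}) (\<lambda>r. norm (f r) powr p)"
    by (rule integrable_lebesgue_on_subset) (use sub in auto)
  have "integrable (lebesgue_on {0<..<T}) (\<lambda>r. norm (f r))"
    using morrey_strongly_integrable[OF f p] by (simp add: strongly_integrable_def)
  then have i1: "integrable (lebesgue_on {s<..<t}) (\<lambda>r. norm (f r))"
    by (rule integrable_lebesgue_on_subset) (use sub in auto)
  have "(\<integral>r. norm (f r) \<partial>lebesgue_on {s<..<t})
      \<le> (t - s) powr (1 - 1 / p) * (\<integral>r. norm (f r) powr p \<partial>lebesgue_on {s<..<t}) powr (1 / p)"
    using Hoelder_finite_measure(2)[OF finite_measure_interval p _ _ ip] i1 st
    by (simp add: measure_restrict_space)
  also have "\<dots> \<le> (t - s) powr (1 - 1 / p) * ((t - s) powr (lam / p) * morrey_norm T p lam f)"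
    by (intro mult_left_mono morrey_integral_powr_le assms) auto
  also have "\<dots> = (t - s) powr (1 - 1 / p + lam / p) * morrey_norm T p lam f"
    by (simp add: powr_add)
  also have "1 - 1 / p + lam / p = 1 - (1 - lam) / p" by (simp add: diff_divide_distrib)
  finally show ?thesis .
qed

lemma AE_lebesgue_on_subset:
  assumes "AE x in lebesgue_on S. P x" "A \<subseteq> S" "A \<in> sets lebesgue" "S \<in> sets lebesgue"
  shows "AE x in lebesgue_on A. P x"
  using assms by (auto simp: AE_restrict_space_iff elim!: eventually_mono)

lemma emeasure_Ioo_nonzero: "s < t \<Longrightarrow> emeasure (lebesgue_on {s<..<t::real}) (space (lebesgue_on {s<..<t})) \<noteq> 0"
  by (simp add: emeasure_restrict_space)

text \<open>Otherwise the \<open>p\<close>-integral over the interval would strictly exceed its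
  Morrey bound. \<open>P\<close> allows the point to be picked where the continuous representative
  agrees with \<open>j (u r)\<close>.\<close>

lemma morrey_exists_small_value:
  assumes f: "f \<in> morrey_space T p lam" and p: "1 < p" and st: "0 \<le> s" "s < t" "t \<le> T"
    and P: "AE r in lebesgue_on {0<..<T}. P r"
  shows "\<exists>r\<in>{s<..<t}. P r \<and> norm (f r) \<le> (t - s) powr (- (1 - lam) / p) * morrey_norm T p lam f"
proof (rule ccontr)
  let ?N = "morrey_norm T p lam f" and ?I = "lebesgue_on {s<..<t}"
  let ?B = "(t - s) powr (- (1 - lam) / p) * ?N"
  assume neg: "\<not> ?thesis"
  have N: "0 \<le> ?N" using st by (intro morrey_norm_nonneg[OF f]) auto
  have sub: "{s<..<t} \<subseteq> {0<..<T}" using st by auto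
  interpret finite_measure ?I by (rule finite_measure_interval)
  have "integrable (lebesgue_on {0<..<T}) (\<lambda>r. norm (f r) powr p)" using f by (simp add: morrey_space_def)
  then have ip: "integrable ?I (\<lambda>r. norm (f r) powr p)"
    by (rule integrable_lebesgue_on_subset) (use sub in auto)
  have "AE r in ?I. P r"
    using P by (rule AE_lebesgue_on_subset) (use sub in auto)
  moreover have "AE r in ?I. r \<in> {s<..<t}" by (rule AE_I2) simp
  ultimately have "AE r in ?I. ?B powr p < norm (f r) powr p"
  proof eventually_elim
    case (elim r)
    then have "?B < norm (f r)" using neg by force
    then show ?case using N p by (intro powr_less_mono2) auto
  qed
  \<comment> \<open>Strictness survives integration because the interval has positive
    measure.\<close>
  then have "(\<integral>r. ?B powr p \<partial>?I) < (\<integral>r. norm (f r) powr p \<partial>?I)"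
    using emeasure_Ioo_nonzero[OF st(2)] ip by (intro integral_less_AE_space) auto
  also have "\<dots> = ((\<integral>r. norm (f r) powr p \<partial>?I) powr (1 / p)) powr p"
    using p by (simp add: powr_powr integral_nonneg)
  also have "\<dots> \<le> ((t - s) powr (lam / p) * ?N) powr p"
    using p st by (intro powr_mono2 morrey_integral_powr_le f) auto
  \<comment> \<open>The constant \<open>?B powr p\<close> integrates exactly to the Morrey bound,
    since \<open>(t - s) * (t - s) powr (lam - 1) = (t - s) powr lam\<close>.\<close>
  also have "\<dots> = (t - s) * ?B powr p"
  proof -
    have "(t - s) * ?B powr p = (t - s) powr 1 * (t - s) powr (lam - 1) * ?N powr p"
      using st N p by (simp add: powr_mult powr_powr)
    also have "(t - s) powr 1 * (t - s) powr (lam - 1) = (t - s) powr lam"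
      by (subst powr_add[symmetric]) simp
    finally show ?thesis using st N p by (auto simp: powr_mult powr_powr)
  qed
  also have "(t - s) * ?B powr p = (\<integral>r. ?B powr p \<partial>?I)"
    using st by (simp add: measure_restrict_space)
  finally show False by simp
qed

text \<open>The set of disagreement is relatively open in \<open>{0..T}\<close>; if nonempty it
  contains an interval of positive length, even when \<open>x\<close> is an endpoint. Thus the
  traces at \<open>0\<close> and \<open>T\<close> do not depend on the continuous
  representative.\<close>

lemma continuous_on_eq_if_AE_eq:
  fixes v w :: "real \<Rightarrow> 'a::real_normed_vector"
  assumes v: "continuous_on {0..T} v" and w: "continuous_on {0..T} w" and "0 < T"
    and eq: "AE t in lebesgue_on {0<..<T}. w t = v t" and x: "x \<in> {0..T}"
  shows "w x = v x"
proof (rule ccontr)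
  assume neq: "w x \<noteq> v x"
  have "continuous_on {0..T} (\<lambda>t. norm (w t - v t))"
    by (intro continuous_intros v w)
  then obtain d where "d > 0" and d: "\<And>t. t \<in> {0..T} \<Longrightarrow> dist t x < d \<Longrightarrow>
      dist (norm (w t - v t)) (norm (w x - v x)) < norm (w x - v x)"
    using x neq unfolding continuous_on_iff by (metis right_minus_eq zero_less_norm_iff)
  define a b where "a = max 0 (x - d)" and "b = min T (x + d)"
  have ab: "a < b" using x \<open>d > 0\<close> \<open>0 < T\<close> by (auto simp: a_def b_def)
  have "AE t in lebesgue_on {a<..<b}. w t = v t"
    using eq by (rule AE_lebesgue_on_subset) (auto simp: a_def b_def)
  moreover have "AE t in lebesgue_on {a<..<b}. w t \<noteq> v t"
  proof (rule AE_I2)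
    fix t assume "t \<in> space (lebesgue_on {a<..<b})"
    then have "t \<in> {0..T}" "dist t x < d" by (auto simp: a_def b_def dist_real_def)
    from d[OF this] show "w t \<noteq> v t" by (auto simp: dist_real_def)
  qed
  ultimately have "AE t in lebesgue_on {a<..<b}. False" by eventually_elim simp
  then have "emeasure (lebesgue_on {a<..<b}) (space (lebesgue_on {a<..<b})) = 0"
    by (simp add: eventually_False ae_filter_eq_bot_iff)
  then show False using emeasure_Ioo_nonzero[OF ab] by simp
qed

section \<open>Bounds for the K-functional and the interpolation norm\<close>

lemma K_functional_le:
  assumes "0 \<le> r" "x = i0 x0 + i1 x1"
  shows "K_functional i0 i1 r x \<le> norm x0 + r * norm x1"
  unfolding K_functional_def using assms
  by (intro cInf_lower bdd_belowI[of _ 0]) auto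

lemma K_functional_nonneg:
  assumes "0 \<le> r" "x = i0 x0 + i1 x1"
  shows "0 \<le> K_functional i0 i1 r x"
  unfolding K_functional_def using assms
  by (intro cInf_greatest) auto

lemma interp_normI:
  assumes "x = i0 x0 + i1 x1" and "\<And>r. 0 < r \<Longrightarrow> r powr (- \<theta>) * K_functional i0 i1 r x \<le> B"
  shows "x \<in> interp_space i0 i1 \<theta>" "interp_norm i0 i1 \<theta> x \<le> B"
proof -
  show "x \<in> interp_space i0 i1 \<theta>"
    unfolding interp_space_def using assms by (auto intro!: bdd_aboveI2)
  show "interp_norm i0 i1 \<theta> x \<le> B"
    unfolding interp_norm_def using assms(2) by (intro cSUP_least) auto
qed

lemma interp_norm_nonneg:
  assumes "x \<in> interp_space i0 i1 \<theta>"
  shows "0 \<le> interp_norm i0 i1 \<theta> x"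
proof -
  obtain x0 x1 where x: "x = i0 x0 + i1 x1" using assms by (auto simp: interp_space_def)
  have "0 \<le> 1 powr (- \<theta>) * K_functional i0 i1 1 x"
    using K_functional_nonneg[of 1 x i0 x0 i1 x1] x by simp
  also have "\<dots> \<le> interp_norm i0 i1 \<theta> x"
    unfolding interp_norm_def using assms by (intro cSUP_upper) (auto simp: interp_space_def)
  finally show ?thesis .
qed

text \<open>The decomposition \<open>0 + x\<close> serves for \<open>r \<le> 1\<close>, and
  \<open>j x + 0\<close> for \<open>r > 1\<close>. The bound carries convergence in the norm of
  \<open>'b\<close> over to the interpolation norm, which the strong measurability in (iii)
  needs.\<close>

lemma interp_norm_embedding:
  assumes "linear i0" "linear i1" and ij: "\<And>x. i0 (j x) = i1 x"
    and L: "\<And>x. norm (j x) \<le> norm x * L" "0 \<le> L" and \<theta>: "0 < \<theta>" "\<theta> < 1"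
  shows "i1 x \<in> interp_space i0 i1 \<theta>" "interp_norm i0 i1 \<theta> (i1 x) \<le> (1 + L) * norm x"
proof -
  have eq: "i1 x = i0 0 + i1 x" "i1 x = i0 (j x) + i1 0"
    using assms(1,2) by (simp_all add: ij linear_0)
  have "r powr (- \<theta>) * K_functional i0 i1 r (i1 x) \<le> (1 + L) * norm x" if r: "0 < r" for r
  proof (cases "r \<le> 1")
    case True
    have "r powr (- \<theta>) * K_functional i0 i1 r (i1 x) \<le> r powr (- \<theta>) * (r * norm x)"
      using K_functional_le[of r "i1 x" i0 0 i1 x] eq(1) r by (intro mult_left_mono) auto
    also have "\<dots> = r powr (1 - \<theta>) * norm x" using r by (simp add: powr_diff powr_minus field_simps)
    also have "\<dots> \<le> 1 * norm x" using True r \<theta> by (intro mult_right_mono powr_le1) auto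
    also have "\<dots> \<le> (1 + L) * norm x" using L(2) by (intro mult_right_mono) auto
    finally show ?thesis .
  next
    case False
    have "r powr (- \<theta>) * K_functional i0 i1 r (i1 x) \<le> 1 * (norm x * L)"
    proof (rule mult_mono)
      show "r powr (- \<theta>) \<le> 1" using False \<theta> by (simp add: powr_minus inverse_le_1_iff ge_one_powr_ge_zero)
      show "K_functional i0 i1 r (i1 x) \<le> norm x * L"
        using K_functional_le[of r "i1 x" i0 "j x" i1 0] eq(2) L(1)[of x] r by simp
      show "0 \<le> K_functional i0 i1 r (i1 x)" using K_functional_nonneg[of r "i1 x" i0 0 i1 x] eq(1) r by simp
    qed simp
    also have "\<dots> \<le> (1 + L) * norm x" by (simp add: algebra_simps)
    finally show ?thesis .
  qed
  note * = this
  show "i1 x \<in> interp_space i0 i1 \<theta>" using eq(1) * by (rule interp_normI)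
  show "interp_norm i0 i1 \<theta> (i1 x) \<le> (1 + L) * norm x" using eq(1) * by (rule interp_normI)
qed

text \<open>For \<open>r \<le> H\<close> the decomposition \<open>x = (x - j y) + j y\<close> given by \<open>h = r\<close> bounds the
  \<open>K\<close>-functional; for \<open>r > H\<close> the trivial decomposition \<open>x = x + 0\<close> does.\<close>

lemma interp_norm_le_of_approx:
  assumes "linear i0" "linear i1" and ij: "\<And>x. i0 (j x) = i1 x"
    and L: "\<And>x. norm (j x) \<le> norm x * L" "0 \<le> L" and \<theta>: "0 < \<theta>" and H: "0 < H" and N: "0 \<le> N"
    and approx: "\<And>h. 0 < h \<Longrightarrow> h \<le> H \<Longrightarrow> \<exists>y. norm (x - j y) \<le> h powr \<theta> * N \<and> norm y \<le> h powr (\<theta> - 1) * N"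
  shows "i0 x \<in> interp_space i0 i1 \<theta>" "interp_norm i0 i1 \<theta> (i0 x) \<le> (2 + L / H) * N"
proof -
  have eq: "i0 x = i0 (x - j y) + i1 y" for y
    using assms(1) by (simp add: linear_diff ij)
  have eq0: "i0 x = i0 x + i1 0" using assms(2) by (simp add: linear_0)
  have "r powr (- \<theta>) * K_functional i0 i1 r (i0 x) \<le> (2 + L / H) * N" if r: "0 < r" for r
  proof (cases "r \<le> H")
    case True
    then obtain y where y: "norm (x - j y) \<le> r powr \<theta> * N" "norm y \<le> r powr (\<theta> - 1) * N"
      using approx r by blast
    have "K_functional i0 i1 r (i0 x) \<le> norm (x - j y) + r * norm y"
      using r by (intro K_functional_le eq) auto
    also have "\<dots> \<le> r powr \<theta> * N + r * (r powr (\<theta> - 1) * N)"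
      using y r by (intro add_mono mult_left_mono) auto
    also have "\<dots> = r powr \<theta> * (2 * N)" using r by (simp add: powr_diff)
    finally have "r powr (- \<theta>) * K_functional i0 i1 r (i0 x) \<le> r powr (- \<theta>) * (r powr \<theta> * (2 * N))"
      by (intro mult_left_mono) auto
    also have "\<dots> = 2 * N" using r by (simp add: powr_minus)
    also have "\<dots> \<le> (2 + L / H) * N" using L(2) H N by (intro mult_right_mono) auto
    finally show ?thesis .
  next
    case False
    \<comment> \<open>The trivial decomposition needs a bound on \<open>norm x\<close>. It comes
      from the largest admissible \<open>h = H\<close>, where
      \<open>H powr (\<theta> - 1) * L = H powr \<theta> * (L / H)\<close> accounts for the summand
      \<open>L / H\<close>.\<close>
    obtain y where y: "norm (x - j y) \<le> H powr \<theta> * N" "norm y \<le> H powr (\<theta> - 1) * N"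
      using approx[OF H] by blast
    have "norm x \<le> norm (x - j y) + norm (j y)" by (metis diff_add_cancel norm_triangle_ineq)
    also have "\<dots> \<le> H powr \<theta> * N + (H powr (\<theta> - 1) * N) * L"
      using y L by (intro add_mono order_trans[OF L(1)] mult_right_mono) auto
    also have "\<dots> = H powr \<theta> * ((1 + L / H) * N)" using H by (simp add: powr_diff field_simps)
    finally have nx: "norm x \<le> H powr \<theta> * ((1 + L / H) * N)" .
    have "r powr (- \<theta>) * K_functional i0 i1 r (i0 x) \<le> H powr (- \<theta>) * (H powr \<theta> * ((1 + L / H) * N))"
    proof (rule mult_mono)
      show "r powr (- \<theta>) \<le> H powr (- \<theta>)" using False H \<theta> by (intro powr_mono2') auto
      show "K_functional i0 i1 r (i0 x) \<le> H powr \<theta> * ((1 + L / H) * N)"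
        using K_functional_le[of r "i0 x" i0 x i1 0] eq0 r nx by simp
      show "0 \<le> K_functional i0 i1 r (i0 x)" using K_functional_nonneg[of r "i0 x" i0 x i1 0] eq0 r by simp
    qed simp
    also have "\<dots> = (1 + L / H) * N" using H by (simp add: powr_minus)
    also have "\<dots> \<le> (2 + L / H) * N" using N by (intro mult_right_mono) auto
    finally show ?thesis .
  qed
  note * = this
  show "i0 x \<in> interp_space i0 i1 \<theta>" using eq0 * by (rule interp_normI)
  show "interp_norm i0 i1 \<theta> (i0 x) \<le> (2 + L / H) * N" using eq0 * by (rule interp_normI)
qed

text \<open>The real-valued supremum in (ii) is informative only together with
  \<open>bdd_above\<close>. Well-defined traces are expressed by the last clause of (iii), as
  endpoint values shared by all continuous representatives.\<close>

theorem theorem3p2: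
  fixes i0 :: "'a::banach \<Rightarrow> 'v::{real_vector,t2_space}"
    and i1 :: "'b::banach \<Rightarrow> 'v"
    and j :: "'b \<Rightarrow> 'a"
    and p lam T \<theta> :: real
  assumes "banach_couple i0 i1"
    and "bounded_linear j" and "\<And>x. i0 (j x) = i1 x"
    and "1 < p" and "0 \<le> lam" and "lam < 1" and "0 < T"
    and "\<theta> = 1 - (1 - lam) / p"
  shows "0 < \<theta> \<and> \<theta> < 1 \<and>
    (\<exists>C::real. \<forall>u \<in> morrey_evolution T p lam j. \<forall>g \<in> morrey_space T p lam.
      has_distributional_derivative T (j \<circ> u) g \<longrightarrow>
      (\<exists>v :: real \<Rightarrow> 'a.
        absolutely_continuous_on 0 T v \<and>
        (AE t in lebesgue_on {0<..<T}. v t = j (u t)) \<and>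
        \<comment> \<open>(i)\<close>
        (\<forall>s t. 0 \<le> s \<and> s < t \<and> t \<le> T \<longrightarrow>
          has_strong_integral (lebesgue_on {s<..<t}) g (v t - v s) \<and>
          norm (v t - v s) \<le> \<bar>t - s\<bar> powr \<theta> * morrey_norm T p lam g) \<and>
        \<comment> \<open>(ii)\<close>
        (\<forall>t\<in>{0..T}. i0 (v t) \<in> interp_space i0 i1 \<theta>) \<and>
        bdd_above ((\<lambda>t. interp_norm i0 i1 \<theta> (i0 (v t))) ` {0..T}) \<and>
        (SUP t\<in>{0..T}. interp_norm i0 i1 \<theta> (i0 (v t)))
          \<le> C * (morrey_norm T p lam u + morrey_norm T p lam g) \<and>
        \<comment> \<open>(iii)\<close>
        v \<in> holder_space T \<theta> \<and>
        (\<lambda>t. i0 (v t)) \<in> Linfty_interp T i0 i1 \<theta> \<and>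
        i0 (v 0) \<in> interp_space i0 i1 \<theta> \<and> i0 (v T) \<in> interp_space i0 i1 \<theta> \<and>
        (\<forall>w. continuous_on {0..T} w \<and> (AE t in lebesgue_on {0<..<T}. w t = j (u t)) \<longrightarrow>
          w 0 = v 0 \<and> w T = v T)))"
proof -
  note ij = assms(3) and p = assms(4) and T = assms(7)
  have lin: "linear i0" "linear i1" using assms(1) by (auto simp: banach_couple_def)
  have "0 < (1 - lam) / p" using assms by simp
  moreover have "(1 - lam) / p < 1" using assms by (simp add: divide_less_eq)
  ultimately have \<theta>: "0 < \<theta>" "\<theta> < 1" using assms(8) by auto
  obtain L where L0: "L > 0" and L: "\<And>x. norm (j x) \<le> norm x * L"
    using bounded_linear.pos_bounded[OF assms(2)] by blast
  define C where "C = 2 + L / (T / 2)"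
  let ?M = "lebesgue_on {0<..<T}"
  interpret complete_measure ?M by (rule complete_measure_interval)
  have "\<exists>v. absolutely_continuous_on 0 T v \<and>
        (AE t in ?M. v t = j (u t)) \<and>
        (\<forall>s t. 0 \<le> s \<and> s < t \<and> t \<le> T \<longrightarrow>
          has_strong_integral (lebesgue_on {s<..<t}) g (v t - v s) \<and>
          norm (v t - v s) \<le> \<bar>t - s\<bar> powr \<theta> * morrey_norm T p lam g) \<and>
        (\<forall>t\<in>{0..T}. i0 (v t) \<in> interp_space i0 i1 \<theta>) \<and>
        bdd_above ((\<lambda>t. interp_norm i0 i1 \<theta> (i0 (v t))) ` {0..T}) \<and>
        (SUP t\<in>{0..T}. interp_norm i0 i1 \<theta> (i0 (v t)))
          \<le> C * (morrey_norm T p lam u + morrey_norm T p lam g) \<and>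
        v \<in> holder_space T \<theta> \<and>
        (\<lambda>t. i0 (v t)) \<in> Linfty_interp T i0 i1 \<theta> \<and>
        i0 (v 0) \<in> interp_space i0 i1 \<theta> \<and> i0 (v T) \<in> interp_space i0 i1 \<theta> \<and>
        (\<forall>w. continuous_on {0..T} w \<and> (AE t in ?M. w t = j (u t)) \<longrightarrow> w 0 = v 0 \<and> w T = v T)"
    if "u \<in> morrey_evolution T p lam j" and gM: "g \<in> morrey_space T p lam"
      and deriv: "has_distributional_derivative T (j \<circ> u) g" for u g
  proof -
    have uM: "u \<in> morrey_space T p lam" using that(1) by (simp add: morrey_evolution_def)
    have ui: "strongly_integrable ?M u" and gi: "strongly_integrable ?M g"
      using uM gM p by (auto intro: morrey_strongly_integrable)
    let ?Nu = "morrey_norm T p lam u" and ?Ng = "morrey_norm T p lam g"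
    have N: "0 \<le> ?Nu" "0 \<le> ?Ng" using uM gM T by (auto intro: morrey_norm_nonneg)
    have "strongly_integrable ?M (j \<circ> u)"
      using strongly_integrable_bounded_linear[OF assms(2) ui] by (simp add: o_def)
    then obtain c where c: "AE t in ?M. (j \<circ> u) t = c + antideriv T g t"
      using distributional_derivative_antideriv[OF T _ gi deriv] by blast
    define v where "v t = c + antideriv T g t" for t
    have dv: "v t - v s = antideriv T g t - antideriv T g s" for s t by (simp add: v_def)
    have ae: "AE t in ?M. v t = j (u t)"
      using c by eventually_elim (simp add: v_def)
    have ac: "absolutely_continuous_on 0 T v"
      using absolutely_continuous_on_antideriv[OF gi] by (simp add: absolutely_continuous_on_def dv)
    have int: "has_strong_integral (lebesgue_on {s<..<t}) g (v t - v s)"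
      if "0 \<le> s" "s < t" "t \<le> T" for s t
      unfolding dv using that by (intro antideriv_diff gi) auto
    have incr: "norm (v t - v s) \<le> \<bar>t - s\<bar> powr \<theta> * ?Ng" if st: "0 \<le> s" "s < t" "t \<le> T" for s t
    proof -
      have "norm (v t - v s) \<le> (\<integral>r. norm (g r) \<partial>lebesgue_on {s<..<t})"
        unfolding dv using st by (intro norm_antideriv_increment_le gi) auto
      also have "\<dots> \<le> (t - s) powr \<theta> * ?Ng"
        unfolding assms(8) by (intro morrey_integral_le gM p st)
      finally show ?thesis using st by simp
    qed
    \<comment> \<open>The point \<open>r\<close> chosen below may lie on either side of
      \<open>t\<close>.\<close>
    have incr': "norm (v t - v s) \<le> \<bar>t - s\<bar> powr \<theta> * ?Ng" if "s \<in> {0..T}" "t \<in> {0..T}" for s t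
      using incr[of s t] incr[of t s] that by (cases s t rule: linorder_cases) (auto simp: norm_minus_commute)
    have cont: "continuous_on S v" for S
      unfolding v_def by (intro continuous_intros continuous_on_antideriv gi)
    have bound: "i0 (v t) \<in> interp_space i0 i1 \<theta>" "interp_norm i0 i1 \<theta> (i0 (v t)) \<le> C * (?Nu + ?Ng)"
      if t: "t \<in> {0..T}" for t
    proof -
      have approx: "\<exists>y. norm (v t - j y) \<le> h powr \<theta> * (?Nu + ?Ng) \<and> norm y \<le> h powr (\<theta> - 1) * (?Nu + ?Ng)"
        if h: "0 < h" "h \<le> T / 2" for h
      proof -
        \<comment> \<open>If \<open>t + h\<close> exceeds \<open>T\<close>, then
          \<open>t - h\<close> is nonnegative because \<open>h \<le> T / 2\<close>.\<close>
        define a where "a = (if t + h \<le> T then t else t - h)"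
        have a: "0 \<le> a" "a < a + h" "a + h \<le> T" "a \<le> t" "t \<le> a + h"
          using t h by (auto simp: a_def)
        obtain r where r: "r \<in> {a<..<a + h}" "v r = j (u r)"
          "norm (u r) \<le> (a + h - a) powr (- (1 - lam) / p) * ?Nu"
          using morrey_exists_small_value[OF uM p a(1-3) ae] by blast
        have "norm (v t - j (u r)) \<le> \<bar>t - r\<bar> powr \<theta> * ?Ng"
          using incr'[of r t] r(1,2) a t by simp
        also have "\<dots> \<le> h powr \<theta> * (?Nu + ?Ng)"
          using r(1) a \<theta> N by (intro mult_mono powr_mono2) auto
        finally have 1: "norm (v t - j (u r)) \<le> h powr \<theta> * (?Nu + ?Ng)" .
        have "\<theta> - 1 = - (1 - lam) / p" unfolding assms(8) by (simp only: minus_divide_left)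
        then have "norm (u r) \<le> h powr (\<theta> - 1) * ?Nu" using r(3) by simp
        also have "\<dots> \<le> h powr (\<theta> - 1) * (?Nu + ?Ng)" using N by (intro mult_left_mono) auto
        finally show ?thesis using 1 by blast
      qed
      have HN: "0 < T / 2" "0 \<le> ?Nu + ?Ng" using T N by auto
      note interp = interp_norm_le_of_approx[OF lin ij L less_imp_le[OF L0] \<theta>(1) HN]
      show "i0 (v t) \<in> interp_space i0 i1 \<theta>" by (rule interp(1)) (rule approx)
      show "interp_norm i0 i1 \<theta> (i0 (v t)) \<le> C * (?Nu + ?Ng)"
        unfolding C_def by (rule interp(2)) (rule approx)
    qed
    have sup: "(SUP t\<in>{0..T}. interp_norm i0 i1 \<theta> (i0 (v t))) \<le> C * (?Nu + ?Ng)"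
      using bound(2) T by (intro cSUP_least) auto
    have hold: "v \<in> holder_space T \<theta>"
    proof -
      have "norm (v t - v s) / \<bar>t - s\<bar> powr \<theta> \<le> ?Ng" if "0 \<le> s" "s < t" "t \<le> T" for s t
        using incr[OF that] that by (simp add: divide_le_eq mult.commute)
      then show ?thesis
        unfolding holder_space_def using cont by (auto intro!: bdd_aboveI[where M="?Ng"])
    qed
    have Linf: "(\<lambda>t. i0 (v t)) \<in> Linfty_interp T i0 i1 \<theta>"
      unfolding Linfty_interp_def
    proof (intro CollectI conjI exI)
      show "AE t in ?M. interp_norm i0 i1 \<theta> (i0 (v t)) \<le> C * (?Nu + ?Ng)"
        using bound(2) by (intro AE_I2) auto
      \<comment> \<open>The simple approximants of \<open>u\<close> are reused through
        \<open>i1\<close>; the embedding estimate makes them converge to \<open>i0 (v t)\<close> in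
        the interpolation norm.\<close>
      have "strongly_measurable ?M u" using uM by (simp add: morrey_space_def)
      then obtain s where s: "\<And>i. simple_function ?M (s i)" "AE t in ?M. (\<lambda>i. s i t) \<longlonglongrightarrow> u t"
        by (rule strongly_measurableE) blast
      note emb = interp_norm_embedding[OF lin ij L less_imp_le[OF L0] \<theta>]
      show "strongly_measurable_in ?M (interp_space i0 i1 \<theta>) (interp_norm i0 i1 \<theta>) (\<lambda>t. i0 (v t))"
        unfolding strongly_measurable_in_def
      proof (intro exI[of _ "\<lambda>i t. i1 (s i t)"] conjI allI)
        show "simple_function ?M (\<lambda>t. i1 (s i t))" for i
          using s(1) by (rule simple_function_compose1)
        show "(\<lambda>t. i1 (s i t)) ` space ?M \<subseteq> interp_space i0 i1 \<theta>" for i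
          using emb(1) by auto
        show "AE t in ?M. i0 (v t) \<in> interp_space i0 i1 \<theta> \<and>
            (\<lambda>i. interp_norm i0 i1 \<theta> (i0 (v t) - i1 (s i t))) \<longlonglongrightarrow> 0"
          using ae s(2)
        proof eventually_elim
          case (elim t)
          have eq: "i0 (v t) - i1 (s i t) = i1 (u t - s i t)" for i
            using lin(2) by (simp add: elim(1) ij linear_diff)
          have "(\<lambda>i. (1 + L) * norm (u t - s i t)) \<longlonglongrightarrow> (1 + L) * norm (u t - u t)"
            by (intro tendsto_intros elim)
          then have lim: "(\<lambda>i. (1 + L) * norm (u t - s i t)) \<longlonglongrightarrow> 0" by simp
          have "(\<lambda>i. interp_norm i0 i1 \<theta> (i0 (v t) - i1 (s i t))) \<longlonglongrightarrow> 0"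
            unfolding eq
          proof (rule tendsto_sandwich[OF _ _ tendsto_const lim])
            show "eventually (\<lambda>i. 0 \<le> interp_norm i0 i1 \<theta> (i1 (u t - s i t))) sequentially"
              by (intro always_eventually allI interp_norm_nonneg emb(1))
            show "eventually (\<lambda>i. interp_norm i0 i1 \<theta> (i1 (u t - s i t)) \<le> (1 + L) * norm (u t - s i t)) sequentially"
              by (intro always_eventually allI emb(2))
          qed
          then show ?case using emb(1)[of "u t"] by (simp add: elim(1) ij)
        qed
      qed
    qed
    have uniq: "w x = v x"
      if "continuous_on {0..T} w" "AE t in ?M. w t = j (u t)" "x \<in> {0..T}" for w x
    proof (rule continuous_on_eq_if_AE_eq[OF cont that(1) T _ that(3)])
      show "AE t in ?M. w t = v t" using ae that(2) by eventually_elim simp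
    qed
    show ?thesis
    proof (intro exI[of _ v] conjI)
      show "bdd_above ((\<lambda>t. interp_norm i0 i1 \<theta> (i0 (v t))) ` {0..T})"
        using bound(2) by (intro bdd_aboveI2)
      show "\<forall>s t. 0 \<le> s \<and> s < t \<and> t \<le> T \<longrightarrow>
          has_strong_integral (lebesgue_on {s<..<t}) g (v t - v s) \<and>
          norm (v t - v s) \<le> \<bar>t - s\<bar> powr \<theta> * ?Ng"
        using int incr by blast
      show "\<forall>t\<in>{0..T}. i0 (v t) \<in> interp_space i0 i1 \<theta>" using bound(1) by blast
      show "i0 (v 0) \<in> interp_space i0 i1 \<theta>" "i0 (v T) \<in> interp_space i0 i1 \<theta>"
        using T by (auto intro: bound(1))
      show "\<forall>w. continuous_on {0..T} w \<and> (AE t in ?M. w t = j (u t)) \<longrightarrow> w 0 = v 0 \<and> w T = v T"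
        using uniq T by simp
    qed (fact ac ae sup hold Linf)+
  qed
  note main = this
  show ?thesis
    by (intro conjI \<theta> exI[of _ C] ballI impI) (rule main)
qed

end
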